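(* Assume $r\ne0$ and let $\alpha\in k$. Then for every $\lambda\in\Lambda$ the evaluation formula $$R_\lambda(-\rho_\alpha)=(-1)^{|\lambda|_{\rm odd}}A_\lambda(\alpha)B_\lambda$$ holds, where $$A_\lambda(\alpha):=\prod_{1\le i\le n,\ n-i\text{ even}}[\alpha+(n-i)r\uparrow\lambda_i]=\prod_{s\in\lambda,\ n-l'(s)\text{ odd}}\big(\alpha+a'(s)+(n-l'(s)-1)r\big)$$ and $$B_\lambda:=\frac{\prod_{1\le i<j\le n,\ j-i\text{ odd}}[(j-i+1)r\uparrow\lambda_i-\lambda_j]}{\prod_{1\le i<j\le n,\ j-i\text{ even}}[(j-i)r\uparrow\lambda_i-\lambda_j]}=\frac{\prod_{s\in\lambda,\ n-l'(s)\text{ even}}\big(a'(s)+(n-l'(s))r\big)}{\prod_{s\in\lambda,\ l_\lambda(s)\text{ odd}}\big(a_\lambda(s)+(l_\lambda(s)+1)r\big)} .$$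
   Context: Let $k$ be a field of characteristic zero, $n\ge 1$, $\mathcal P=k[z_1,\dots,z_n]$, and let $W\subseteq S_n$ be the group of permutations $\pi$ with $\pi(i)\equiv i \bmod 2$ for all $i$, acting by permuting variables. $\Lambda$ is the set of integer tuples $\lambda=(\lambda_1\ge\dots\ge\lambda_n\ge 0)$ and $|\lambda|_{\rm odd}=\sum_{i\text{ odd}}\lambda_i$. Fix $r\in k$ which is not a negative rational number and put $\rho=((n-1)r,(n-2)r,\dots,r,0)$. For $\lambda\in\Lambda$ let $[\lambda]_m=\lambda_m-\lambda_{m+1}+\dots+(-1)^{n-m}\lambda_n$. $R_\lambda(z)=R_\lambda(z;r)\in\mathcal P^W$ is the unique $W$-invariant polynomial of degree $|\lambda|_{\rm odd}$ which satisfies $R_\lambda(\rho+\mu)=0$ for all $\mu\in\Lambda$ with $|\mu|_{\rm odd}\le|\lambda|_{\rm odd}$, $\mu\ne\lambda$, and in which the monomial $z^{[\lambda]}$ has coefficient $1$ (it is known that this exists and is unique). For $\alpha\in k$, $\rho_\alpha=\rho+(\alpha,\dots,\alpha)$. $[x\uparrow m]=x(x+1)\cdots(x+m-1)$ is the rising factorial. A partition $\lambda$ is identified with its diagram, the set of boxes $s=(i,j)$ with $1\le i\le n$, $1\le j\le\lambda_i$; $\lambda'$ is the dual (transposed) partition. For $s=(i,j)\in\lambda$: $a_\lambda(s)=\lambda_i-j$, $l_\lambda(s)=\lambda'_j-i$, $a'(s)=j-1$, $l'(s)=i-1$. *)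

theory Defs
  imports
    Complex_Main
    "HOL-Library.Poly_Mapping"
    "HOL-Combinatorics.Permutations"
begin

text \<open>
  Polynomials over \<open>'k\<close> are finitely supported maps from exponent vectors to coefficients, with the
  convolution product of \<open>HOL-Library.Poly_Mapping\<close>. As in the mathematics, indices run
  through \<open>{1..n}\<close>.
\<close>

type_synonym 'k mpoly = "(nat \<Rightarrow>\<^sub>0 nat) \<Rightarrow>\<^sub>0 'k"

definition polys :: "nat \<Rightarrow> 'k::zero mpoly set" where
  "polys n = {p. \<forall>m \<in> Poly_Mapping.keys p. Poly_Mapping.keys m \<subseteq> {1..n}}"

definition eval_poly :: "'k::comm_semiring_1 mpoly \<Rightarrow> (nat \<Rightarrow> 'k) \<Rightarrow> 'k" where
  "eval_poly p z =
     (\<Sum>m \<in> Poly_Mapping.keys p.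
        Poly_Mapping.lookup p m *
        (\<Prod>i \<in> Poly_Mapping.keys m. z i ^ Poly_Mapping.lookup m i))"

definition monom_degree :: "(nat \<Rightarrow>\<^sub>0 nat) \<Rightarrow> nat" where
  "monom_degree m = (\<Sum>i \<in> Poly_Mapping.keys m. Poly_Mapping.lookup m i)"

text \<open>The inserted \<open>0\<close> only matters for the zero polynomial.\<close>

definition total_degree :: "'k::zero mpoly \<Rightarrow> nat" where
  "total_degree p = Max (insert 0 (monom_degree ` Poly_Mapping.keys p))"

definition parity_perms :: "nat \<Rightarrow> (nat \<Rightarrow> nat) set" where
  "parity_perms n =
     {\<pi>. \<pi> permutes {1..n} \<and> (\<forall>i \<in> {1..n}. \<pi> i mod 2 = i mod 2)}"

text \<open>
  Substitution of \<open>z\<^bsub>\<pi> i\<^esub>\<close> for \<open>z\<^bsub>i\<^esub>\<close>. The coefficient of a monomial in the result is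
  read off at the exponent vector composed with \<open>\<pi>\<close>; \<open>map_key\<close> is only meaningful for
  injective maps, which \<open>\<pi>\<close> and the induced map on exponent vectors are for a permutation.
\<close>

definition permute_vars :: "(nat \<Rightarrow> nat) \<Rightarrow> 'k::zero mpoly \<Rightarrow> 'k mpoly" where
  "permute_vars \<pi> p = Poly_Mapping.map_key (Poly_Mapping.map_key \<pi>) p"

lemma inj_map_key:
  assumes "bij \<pi>"
  shows "inj (Poly_Mapping.map_key \<pi> :: (nat \<Rightarrow>\<^sub>0 nat) \<Rightarrow> _)"
proof (rule injI, rule poly_mapping_eqI)
  fix m m' :: "nat \<Rightarrow>\<^sub>0 nat" and i
  assume eq: "Poly_Mapping.map_key \<pi> m = Poly_Mapping.map_key \<pi> m'"
  have "inj \<pi>" "\<pi> (inv \<pi> i) = i"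
    using assms by (simp_all add: bij_is_inj bij_is_surj surj_f_inv_f)
  then show "Poly_Mapping.lookup m i = Poly_Mapping.lookup m' i"
    using arg_cong[OF eq, of "\<lambda>x. Poly_Mapping.lookup x (inv \<pi> i)"]
    by (simp add: map_key.rep_eq)
qed

lemma lookup_permute_vars:
  assumes "bij \<pi>"
  shows "Poly_Mapping.lookup (permute_vars \<pi> p) m =
         Poly_Mapping.lookup p (Poly_Mapping.map_key \<pi> m)"
  using inj_map_key[OF assms] by (simp add: permute_vars_def map_key.rep_eq)

definition W_invariants :: "nat \<Rightarrow> 'k::zero mpoly set" where
  "W_invariants n =
     {p \<in> polys n. \<forall>\<pi> \<in> parity_perms n. permute_vars \<pi> p = p}"

text \<open>
  Tuples are functions vanishing outside \<open>{1..n}\<close>, so that two tuples are equal iff they are equal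
  as functions.
\<close>

definition Lambda :: "nat \<Rightarrow> (nat \<Rightarrow> nat) set" where
  "Lambda n = {l. (\<forall>i \<in> {1..<n}. l (Suc i) \<le> l i) \<and> (\<forall>i. i \<notin> {1..n} \<longrightarrow> l i = 0)}"

definition odd_size :: "nat \<Rightarrow> (nat \<Rightarrow> nat) \<Rightarrow> nat" where
  "odd_size n l = (\<Sum>i | i \<in> {1..n} \<and> odd i. l i)"

definition alt_tail :: "nat \<Rightarrow> (nat \<Rightarrow> nat) \<Rightarrow> nat \<Rightarrow> int" where
  "alt_tail n l m = (\<Sum>i = m..n. (-1) ^ (i - m) * int (l i))"

text \<open>For \<open>l \<in> Lambda n\<close> the numbers \<open>alt_tail n l m\<close> are nonnegative, so \<open>nat\<close> does not truncate.\<close>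

definition alt_exponent :: "nat \<Rightarrow> (nat \<Rightarrow> nat) \<Rightarrow> (nat \<Rightarrow>\<^sub>0 nat)" where
  "alt_exponent n l = (\<Sum>m = 1..n. Poly_Mapping.single m (nat (alt_tail n l m)))"

definition rho :: "nat \<Rightarrow> 'k::comm_ring_1 \<Rightarrow> nat \<Rightarrow> 'k" where
  "rho n r i = of_nat (n - i) * r"

definition rho_shift :: "nat \<Rightarrow> 'k::comm_ring_1 \<Rightarrow> 'k \<Rightarrow> nat \<Rightarrow> 'k" where
  "rho_shift n r \<alpha> i = rho n r i + \<alpha>"

definition semisym_R :: "nat \<Rightarrow> 'k::comm_ring_1 \<Rightarrow> (nat \<Rightarrow> nat) \<Rightarrow> 'k mpoly" where
  "semisym_R n r l = (THE p.
     p \<in> W_invariants n \<and>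
     total_degree p = odd_size n l \<and>
     (\<forall>\<mu> \<in> Lambda n. odd_size n \<mu> \<le> odd_size n l \<and> \<mu> \<noteq> l \<longrightarrow>
        eval_poly p (\<lambda>i. rho n r i + of_nat (\<mu> i)) = 0) \<and>
     Poly_Mapping.lookup p (alt_exponent n l) = 1)"

definition diagram :: "nat \<Rightarrow> (nat \<Rightarrow> nat) \<Rightarrow> (nat \<times> nat) set" where
  "diagram n l = {(i, j). 1 \<le> i \<and> i \<le> n \<and> 1 \<le> j \<and> j \<le> l i}"

definition dual :: "nat \<Rightarrow> (nat \<Rightarrow> nat) \<Rightarrow> nat \<Rightarrow> nat" where
  "dual n l j = card {i \<in> {1..n}. j \<le> l i}"

text \<open>
  The truncated subtractions below are harmless: the four functions are only used at boxes of the
  diagram.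
\<close>

definition arm :: "(nat \<Rightarrow> nat) \<Rightarrow> nat \<times> nat \<Rightarrow> nat" where
  "arm l s = l (fst s) - snd s"

definition leg :: "nat \<Rightarrow> (nat \<Rightarrow> nat) \<Rightarrow> nat \<times> nat \<Rightarrow> nat" where
  "leg n l s = dual n l (snd s) - fst s"

definition coarm :: "nat \<times> nat \<Rightarrow> nat" where
  "coarm s = snd s - 1"

definition coleg :: "nat \<times> nat \<Rightarrow> nat" where
  "coleg s = fst s - 1"

definition A_factor :: "nat \<Rightarrow> 'k::comm_ring_1 \<Rightarrow> (nat \<Rightarrow> nat) \<Rightarrow> 'k \<Rightarrow> 'k" where
  "A_factor n r l \<alpha> =
     (\<Prod>i | i \<in> {1..n} \<and> even (n - i). pochhammer (\<alpha> + of_nat (n - i) * r) (l i))"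

definition B_factor :: "nat \<Rightarrow> 'k::field \<Rightarrow> (nat \<Rightarrow> nat) \<Rightarrow> 'k" where
  "B_factor n r l =
     (\<Prod>(i, j) | 1 \<le> i \<and> i < j \<and> j \<le> n \<and> odd (j - i).
        pochhammer (of_nat (j - i + 1) * r) (l i - l j)) /
     (\<Prod>(i, j) | 1 \<le> i \<and> i < j \<and> j \<le> n \<and> even (j - i).
        pochhammer (of_nat (j - i) * r) (l i - l j))"

end

theory Submission
  imports Defs "HOL-Computational_Algebra.Polynomial"
begin

text \<open>
  Let \<open>X\<close> be the set of indices \<open>i \<le> n\<close> with \<open>n - i\<close> even, and \<open>Y\<close> the set of the other ones.
  Two reductions govern the interpolation polynomials. If \<open>\<lambda>\<^sub>n > 0\<close>, then \<open>R\<^sub>\<lambda>\<close> vanishes on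
  \<open>z\<^sub>n = 0\<close>, by symmetry on \<open>z\<^sub>i = 0\<close> for all \<open>i \<in> X\<close>, and \<open>R\<^sub>\<lambda>(z)\<close> is the product of these
  \<open>z\<^sub>i\<close> and of the polynomial of \<open>\<lambda> - (1,\<dots>,1)\<close> at \<open>z - (1,\<dots>,1)\<close>
  (\<open>is_interp_add_columnE\<close>). If \<open>\<lambda>\<^sub>n = 0\<close>, then setting \<open>z\<^sub>n = 0\<close> and translating by \<open>r\<close>
  gives the polynomial of \<open>\<lambda>\<close> in \<open>n - 1\<close> variables (\<open>is_interp_restrict_last\<close>). The same
  induction yields uniqueness and existence of interpolation and the nonvanishing of the
  coefficient used for the normalization. Under the first reduction the value at \<open>-\<rho>\<^sub>\<alpha>\<close> becomes a
  value at \<open>\<alpha> + 1\<close>; under the second one the value at \<open>-\<rho>\<^sub>0\<close> becomes the value in \<open>n - 1\<close>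
  variables at \<open>2r\<close>. So it suffices to know, for \<open>\<lambda>\<^sub>n = 0\<close>, that the value is proportional to
  \<open>A\<^sub>\<lambda>(\<alpha>)\<close>: the constant of proportionality is then found at \<open>\<alpha> = 0\<close>, where \<open>A\<^sub>\<lambda>\<close> does not
  vanish because \<open>r \<noteq> 0\<close>, and this produces exactly the recursion that \<open>B\<^sub>\<lambda>\<close> satisfies.

  Proportionality comes from a difference operator \<open>D\<close> with
  \<open>D R\<^sub>\<lambda> = c (\<Prod>i\<in>X. \<lambda>\<^sub>i + \<rho>\<^sub>i + \<alpha>) R\<^sub>\<lambda>\<close> and
  \<open>(D f)(-\<rho>\<^sub>\<alpha>) = c (\<Prod>i\<in>X. \<rho>\<^sub>i + \<alpha>) f(-\<rho>\<^bsub>\<alpha>+1\<^esub>)\<close> for a constant \<open>c \<noteq> 0\<close>. It is a quotient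
  \<open>N / \<Delta>\<close>, where \<open>\<Delta>\<close> is the product of all \<open>z\<^sub>a - z\<^sub>b\<close> with \<open>a\<close>, \<open>b\<close> of equal parity, and
  \<open>N\<close> is a determinant whose rows and columns are indexed by \<open>X\<close>, a column \<open>k\<close> standing for the
  index \<open>k - 1\<close> (which is in \<open>Y\<close>, or is \<open>0\<close> and then stands for no variable). The entry is
  \<open>(z\<^sub>i + \<alpha>) (\<Prod>j. z\<^sub>i - z\<^sub>j + r) - z\<^sub>i (\<Prod>j. z\<^sub>i - z\<^sub>j - r) T\<close>, where \<open>j\<close> runs through
  \<open>Y - {k - 1}\<close> and \<open>T\<close> lowers \<open>z\<^sub>i\<close> and \<open>z\<^bsub>k-1\<^esub>\<close> by one; all shifts act before all
  multiplications. This determinant has the required properties for the following reasons.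

  \<^item> An entry \<open>A - B T = (A - B) + B (1 - T)\<close> raises degrees by one less than \<open>deg B\<close>, so \<open>N\<close>
    raises degrees by at most \<open>deg \<Delta>\<close> (\<open>poly_fun_numerator_op\<close>). It alternates under swaps of
    variables of equal parity (\<open>numerator_op_swap\<close>), so that \<open>\<Delta>\<close> divides it and \<open>D\<close> is an
    operator on semisymmetric polynomials that does not raise degrees.
  \<^item> At \<open>\<rho> + \<mu>\<close>, each term of the determinant whose shift would leave \<open>\<Lambda>\<close> has a vanishing
    factor (\<open>surviving_shift\<close>). Hence \<open>D R\<^sub>\<lambda>\<close> has the zeros of \<open>R\<^sub>\<lambda>\<close>, and by
    uniqueness it is a multiple of \<open>R\<^sub>\<lambda>\<close>; the multiple is read off at \<open>\<rho> + \<lambda>\<close>, where only the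
    terms without a shift contribute.
  \<^item> At \<open>-\<rho>\<^sub>\<alpha>\<close>, only the diagonal term in which everything is shifted survives
    (\<open>numerator_op_at_rho\<close>).
  \<^item> Both evaluations involve the determinant of the products \<open>\<Prod>j. z\<^sub>i - z\<^sub>j \<plusminus> r\<close>. It alternates
    and has the degree of \<open>\<Delta>\<close>, so it is \<open>c \<Delta>\<close>, and translating the variables in \<open>Y\<close> shows
    that \<open>c\<close> does not depend on the sign or on \<open>r\<close> (\<open>lagrange_det_eq_vandermonde\<close>). Thus \<open>c\<close>
    cancels and need not be computed.

  The expressions of \<open>A\<^sub>\<lambda>\<close> and \<open>B\<^sub>\<lambda>\<close> as products over boxes are rearrangements row by row.
\<close>


section \<open>Polynomial functions with a degree bound\<close>

text \<open>
  Polynomials are treated as functions, which is faithful over an infinite field and turns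
  substitutions and divisions into pointwise identities. The degree bound is an integer, so that
  operations lowering the degree need no case distinction: a negative bound forces the zero
  function.
\<close>

inductive poly_fun :: "nat \<Rightarrow> int \<Rightarrow> ((nat \<Rightarrow> 'k::field_char_0) \<Rightarrow> 'k) \<Rightarrow> bool"
  for n :: nat where
  zero: "poly_fun n d (\<lambda>z. 0)"
| const: "0 \<le> d \<Longrightarrow> poly_fun n d (\<lambda>z. c)"
| var_mult: "poly_fun n d f \<Longrightarrow> i \<in> {1..n} \<Longrightarrow> poly_fun n (d + 1) (\<lambda>z. z i * f z)"
| add: "poly_fun n d f \<Longrightarrow> poly_fun n d g \<Longrightarrow> poly_fun n d (\<lambda>z. f z + g z)"

lemma poly_fun_mono:
  "poly_fun n d f \<Longrightarrow> d \<le> e \<Longrightarrow> poly_fun n e f"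
proof (induction arbitrary: e rule: poly_fun.induct)
  case (var_mult d f i)
  have "poly_fun n (e - 1) f"
    using var_mult by simp
  from poly_fun.var_mult[OF this var_mult.hyps(2)] show ?case by simp
qed (auto intro: poly_fun.intros)

lemma poly_fun_cong:
  "poly_fun n d f \<Longrightarrow> (\<And>i. i \<in> {1..n} \<Longrightarrow> z i = w i) \<Longrightarrow> f z = f w"
  by (induction rule: poly_fun.induct) auto

lemma poly_fun_neg_degree:
  "poly_fun n d f \<Longrightarrow> d < 0 \<Longrightarrow> f z = 0"
  by (induction rule: poly_fun.induct) auto

lemma poly_fun_cmult:
  "poly_fun n d f \<Longrightarrow> poly_fun n d (\<lambda>z. c * f z)"
proof (induction rule: poly_fun.induct)
  case (var_mult d f i)
  from poly_fun.var_mult[OF var_mult.IH var_mult.hyps(2)]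
  show ?case by (simp add: mult.left_commute)
next
  case (add d f g)
  from poly_fun.add[OF add.IH] show ?case by (simp add: distrib_left)
qed (auto intro: poly_fun.intros)

lemma poly_fun_diff:
  "poly_fun n d f \<Longrightarrow> poly_fun n d g \<Longrightarrow> poly_fun n d (\<lambda>z. f z - g z)"
  using poly_fun.add[OF _ poly_fun_cmult[of n d g "-1"]] by simp

lemma poly_fun_var: "i \<in> {1..n} \<Longrightarrow> poly_fun n 1 (\<lambda>z. z i)"
  using poly_fun.var_mult[OF poly_fun.const[of 0 n 1]] by simp

lemma poly_fun_mult:
  "poly_fun n d f \<Longrightarrow> poly_fun n e g \<Longrightarrow> poly_fun n (d + e) (\<lambda>z. f z * g z)"
proof (induction rule: poly_fun.induct)
  case (const d c)
  then show ?case
    using poly_fun_mono[OF poly_fun_cmult[of n e g c]] by simp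
next
  case (var_mult d f i)
  from poly_fun.var_mult[OF var_mult.IH[OF var_mult.prems] var_mult.hyps(2)]
  show ?case by (simp add: mult.assoc algebra_simps)
next
  case (add d f g)
  from poly_fun.add[OF add.IH[OF add.prems]] show ?case by (simp add: distrib_right)
qed (auto intro: poly_fun.intros)

lemma poly_fun_sum:
  "(\<And>x. x \<in> S \<Longrightarrow> poly_fun n d (f x)) \<Longrightarrow> poly_fun n d (\<lambda>z. \<Sum>x\<in>S. f x z)"
  by (induction S rule: infinite_finite_induct) (auto intro: poly_fun.intros)

lemma poly_fun_prod:
  "finite S \<Longrightarrow> (\<And>x. x \<in> S \<Longrightarrow> poly_fun n (d x) (f x)) \<Longrightarrow>
    poly_fun n (\<Sum>x\<in>S. d x) (\<lambda>z. \<Prod>x\<in>S. f x z)"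
  by (induction S rule: finite_induct) (auto intro: poly_fun.const poly_fun_mult)

lemma poly_fun_subst:
  "poly_fun n d f \<Longrightarrow> (\<And>i. i \<in> {1..n} \<Longrightarrow> poly_fun m 1 (g i)) \<Longrightarrow>
    poly_fun m d (\<lambda>z. f (\<lambda>i. g i z))"
proof (induction rule: poly_fun.induct)
  case (var_mult d f i)
  from poly_fun_mult[OF var_mult.prems[OF var_mult.hyps(2)] var_mult.IH[OF var_mult.prems]]
  show ?case by (simp add: add.commute)
qed (auto intro: poly_fun.intros)

lemma poly_fun_translate:
  assumes "poly_fun n d f"
  shows "poly_fun n d (\<lambda>z. f (\<lambda>i. z i + w i))"
  by (rule poly_fun_subst[OF assms, where g = "\<lambda>i z. z i + w i"])
    (rule poly_fun.add[OF poly_fun_var poly_fun.const], auto)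

lemma poly_fun_difference:
  "poly_fun n d f \<Longrightarrow> poly_fun n (d - 1) (\<lambda>z. f z - f (\<lambda>i. z i - w i))"
proof (induction rule: poly_fun.induct)
  case (var_mult d f i)
  have 1: "poly_fun n d (\<lambda>z. z i * (f z - f (\<lambda>i. z i - w i)))"
    using poly_fun.var_mult[OF var_mult.IH var_mult.hyps(2)] by simp
  have 2: "poly_fun n d (\<lambda>z. w i * f (\<lambda>i. z i - w i))"
    using poly_fun_cmult[OF poly_fun_translate[OF var_mult.hyps(1), of "\<lambda>i. - w i"], of "w i"]
    by simp
  from poly_fun.add[OF 1 2] show ?case by (simp add: algebra_simps)
next
  case (add d f g)
  from poly_fun.add[OF add.IH] show ?case by (simp add: algebra_simps)
qed (auto intro: poly_fun.intros)

text \<open>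
  The difference of any two values has degree bound \<open>- 1\<close>.
\<close>

lemma poly_fun_degree_0:
  assumes "poly_fun n 0 f" shows "f z = f w"
  using poly_fun_neg_degree[OF poly_fun_difference[OF assms, of "\<lambda>i. z i - w i"], of z] by simp

lemma poly_fun_on_line:
  "poly_fun n d f \<Longrightarrow> \<exists>P. \<forall>t. f (\<lambda>i. z i + t * u i) = poly P t"
proof (induction rule: poly_fun.induct)
  case (zero d) then show ?case by (intro exI[of _ 0]) simp
next
  case (const d c) then show ?case by (intro exI[of _ "[:c:]"]) simp
next
  case (var_mult d f i)
  then obtain P where "\<forall>t. f (\<lambda>i. z i + t * u i) = poly P t" by blast
  then show ?case by (intro exI[of _ "[:z i, u i:] * P"]) (simp add: algebra_simps)
next
  case (add d f g)
  then obtain P Q where "\<forall>t. f (\<lambda>i. z i + t * u i) = poly P t"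
    "\<forall>t. g (\<lambda>i. z i + t * u i) = poly Q t" by blast
  then show ?case by (intro exI[of _ "P + Q"]) simp
qed

text \<open>
  A polynomial that vanishes at all but finitely many points of a line vanishes on the whole line,
  in particular at its origin \<open>z\<close>.
\<close>

lemma poly_fun_density:
  assumes f: "poly_fun n d f" and "finite B"
    and vanish: "\<And>t. t \<notin> B \<Longrightarrow> f (\<lambda>i. z i + t * u i) = 0"
  shows "f z = 0"
proof -
  obtain P where P: "\<And>t. f (\<lambda>i. z i + t * u i) = poly P t"
    using poly_fun_on_line[OF f] by blast
  have "- B \<subseteq> {t. poly P t = 0}" using vanish P by auto
  moreover have "infinite (- B)"
    using \<open>finite B\<close> by (simp add: finite_compl infinite_UNIV_char_0)
  ultimately have "P = 0" using poly_roots_finite finite_subset by blast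
  with P[of 0] show ?thesis by simp
qed

text \<open>
  With the convention \<open>z\<^sub>0 = 0\<close> a coordinate \<open>z\<^sub>a\<close> is the difference for the pair \<open>(a, 0)\<close>, so
  that coordinate hyperplanes and diagonals can be treated together.
\<close>

definition diff_form :: "nat \<times> nat \<Rightarrow> (nat \<Rightarrow> 'k::field_char_0) \<Rightarrow> 'k" where
  "diff_form s z = z (fst s) - (z(0 := 0)) (snd s)"

lemma poly_fun_zero_ext:
  "b \<in> {0..n} \<Longrightarrow> poly_fun n 1 (\<lambda>z. (z(0 := 0)) b)"
  by (cases "b = 0") (auto intro: poly_fun.zero poly_fun_var)

lemma poly_fun_divide_diff_form:
  assumes "poly_fun n d f" and a: "a \<in> {1..n}" and b: "b \<in> {0..n}"
  shows "\<exists>g. poly_fun n (d - 1) g \<and>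
    (\<forall>z. f z = f (z(a := (z(0 := 0)) b)) + diff_form (a, b) z * g z)"
  using assms(1)
proof (induction rule: poly_fun.induct)
  case (var_mult d f i)
  then obtain g where g: "poly_fun n (d - 1) g"
    and eq: "\<And>z. f z = f (z(a := (z(0 := 0)) b)) + diff_form (a, b) z * g z" by blast
  have 1: "poly_fun n d (\<lambda>z. z i * g z)"
    using poly_fun.var_mult[OF g var_mult.hyps(2)] by simp
  have 2: "poly_fun n d (\<lambda>z. f (z(a := (z(0 := 0)) b)))"
    unfolding fun_upd_def[of _ a]
  proof (rule poly_fun_subst[OF var_mult.hyps(1),
        where g = "\<lambda>i z. if i = a then (z(0 := 0)) b else z i"])
    show "poly_fun n 1 (\<lambda>z. if i = a then (z(0 := 0)) b else z i)" if "i \<in> {1..n}" for i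
      using that by (cases "i = a") (simp_all only: poly_fun_zero_ext[OF b] poly_fun_var simp_thms if_True if_False)
  qed
  show ?case
  proof (cases "i = a")
    case True
    show ?thesis
    proof (intro exI conjI allI)
      show "poly_fun n (d + 1 - 1) (\<lambda>z. z i * g z + f (z(a := (z(0 := 0)) b)))"
        using poly_fun.add[OF 1 2] by simp
      show "z i * f z = (z(a := (z(0 := 0)) b)) i * f (z(a := (z(0 := 0)) b)) +
        diff_form (a, b) z * (z i * g z + f (z(a := (z(0 := 0)) b)))" for z
        by (subst eq) (use True in \<open>simp add: algebra_simps diff_form_def\<close>)
    qed
  next
    case False
    show ?thesis
    proof (intro exI conjI allI)
      show "poly_fun n (d + 1 - 1) (\<lambda>z. z i * g z)" using 1 by simp
      show "z i * f z = (z(a := (z(0 := 0)) b)) i * f (z(a := (z(0 := 0)) b)) +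
        diff_form (a, b) z * (z i * g z)" for z
        by (subst eq) (use False in \<open>simp add: algebra_simps\<close>)
    qed
  qed
next
  case (add d f1 f2)
  then obtain g1 g2 where g: "poly_fun n (d - 1) g1" "poly_fun n (d - 1) g2"
    and eq: "\<And>z. f1 z = f1 (z(a := (z(0 := 0)) b)) + diff_form (a, b) z * g1 z"
      "\<And>z. f2 z = f2 (z(a := (z(0 := 0)) b)) + diff_form (a, b) z * g2 z" by blast
  show ?case
  proof (intro exI conjI allI)
    show "poly_fun n (d - 1) (\<lambda>z. g1 z + g2 z)" by (rule poly_fun.add[OF g])
    show "f1 z + f2 z = f1 (z(a := (z(0 := 0)) b)) + f2 (z(a := (z(0 := 0)) b)) +
      diff_form (a, b) z * (g1 z + g2 z)" for z
      using eq(1)[of z] eq(2)[of z] unfolding distrib_left by (metis add.assoc add.left_commute)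
  qed
qed (auto intro!: exI[of _ "\<lambda>z. 0"] poly_fun.zero)

lemma finite_diff_form_zeros:
  fixes z u :: "nat \<Rightarrow> 'k::field_char_0"
  assumes "u (fst s) \<noteq> (u(0 := 0)) (snd s)"
  shows "finite {t. diff_form s (\<lambda>i. z i + t * u i) = 0}"
proof -
  define w where "w = u (fst s) - (u(0 := 0)) (snd s)"
  have "diff_form s (\<lambda>i. z i + t * u i) = diff_form s z + t * w" for t
    by (simp add: diff_form_def w_def algebra_simps)
  moreover have "w \<noteq> 0" using assms by (simp add: w_def)
  ultimately have "{t. diff_form s (\<lambda>i. z i + t * u i) = 0} \<subseteq> {- diff_form s z / w}"
    by (auto simp: field_simps add_eq_0_iff2)
  then show ?thesis by (rule finite_subset) simp
qed

text \<open>
  Along the direction \<open>(1, 2, 3, \<dots>)\<close> every one of the forms is a nonconstant function of the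
  parameter, so each line in this direction meets the excluded set in finitely many points.
\<close>

lemma poly_fun_cancel_diff_forms:
  fixes f :: "(nat \<Rightarrow> 'k::field_char_0) \<Rightarrow> 'k"
  assumes "finite S" and S: "\<And>a b. (a, b) \<in> S \<Longrightarrow> b < a" and f: "poly_fun n d f"
    and vanish: "\<And>z. (\<Prod>s\<in>S. diff_form s z) \<noteq> 0 \<Longrightarrow> f z = 0"
  shows "f z = 0"
proof (rule poly_fun_density[OF f])
  define u :: "nat \<Rightarrow> 'k" where "u = (\<lambda>i. of_nat i)"
  show "finite (\<Union>s\<in>S. {t. diff_form s (\<lambda>i. z i + t * u i) = 0})"
    using \<open>finite S\<close>
    by (auto intro!: finite_diff_form_zeros simp: u_def fun_upd_def dest!: S split: if_splits)
  show "f (\<lambda>i. z i + t * u i) = 0"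
    if "t \<notin> (\<Union>s\<in>S. {t. diff_form s (\<lambda>i. z i + t * u i) = 0})" for t
    using that \<open>finite S\<close> by (intro vanish) auto
qed

text \<open>
  The forms are divided out one by one. For the next form \<open>z\<^sub>a - z\<^sub>b\<close> one has to see that the
  quotient by the previous ones still vanishes on \<open>z\<^sub>a = z\<^sub>b\<close>; this follows by density along a line
  inside that hyperplane on which no previous form vanishes identically.
\<close>

lemma poly_fun_divide_diff_forms:
  fixes f :: "(nat \<Rightarrow> 'k::field_char_0) \<Rightarrow> 'k"
  assumes "finite S" and "\<And>a b. (a, b) \<in> S \<Longrightarrow> b < a \<and> a \<le> n" and f: "poly_fun n d f"
    and "\<And>s z. s \<in> S \<Longrightarrow> diff_form s z = 0 \<Longrightarrow> f z = 0"
  shows "\<exists>g. poly_fun n (d - int (card S)) g \<and> (\<forall>z. f z = (\<Prod>s\<in>S. diff_form s z) * g z)"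
  using assms(1,2,4)
proof (induction S rule: finite_induct)
  case empty
  with f show ?case by auto
next
  case (insert s S)
  obtain a b where s: "s = (a, b)" by force
  have ab: "b < a" "a \<le> n" using insert.prems(1) s by auto
  obtain g where g: "poly_fun n (d - int (card S)) g"
    and fg: "\<And>z. f z = (\<Prod>s\<in>S. diff_form s z) * g z"
    using insert.IH insert.prems by blast
  have vanish: "g z = 0" if z: "diff_form s z = 0" for z
  proof (rule poly_fun_density[OF g])
    \<comment> \<open>the direction stays inside \<open>z\<^sub>a = z\<^sub>b\<close>, and is otherwise as generic as possible\<close>
    define u :: "nat \<Rightarrow> 'k" where "u = (\<lambda>i. if i = a then of_nat b else of_nat i)"
    have ne: "u c \<noteq> (u(0 := 0)) e" if "(c, e) \<in> S" for c e
    proof -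
      have "e < c" "(c, e) \<noteq> (a, b)" using that insert.prems(1) insert.hyps s by auto
      then show ?thesis using ab by (auto simp: u_def split: if_splits)
    qed
    show "finite (\<Union>s\<in>S. {t. diff_form s (\<lambda>i. z i + t * u i) = 0})"
      using insert.hyps(1) ne by (auto intro!: finite_diff_form_zeros)
    show "g (\<lambda>i. z i + t * u i) = 0"
      if t: "t \<notin> (\<Union>s\<in>S. {t. diff_form s (\<lambda>i. z i + t * u i) = 0})" for t
    proof -
      have "diff_form s (\<lambda>i. z i + t * u i) = 0"
        using z ab by (auto simp: s diff_form_def u_def fun_upd_def split: if_splits)
      then have "f (\<lambda>i. z i + t * u i) = 0" using insert.prems(2) by blast
      then show ?thesis using t insert.hyps(1) by (auto simp: fg)
    qed
  qed
  obtain h where h: "poly_fun n (d - int (card S) - 1) h"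
    and gh: "\<And>z. g z = g (z(a := (z(0 := 0)) b)) + diff_form (a, b) z * h z"
    using poly_fun_divide_diff_form[OF g, of a b] ab by auto
  have "g (z(a := (z(0 := 0)) b)) = 0" for z
    using ab by (intro vanish) (auto simp: s diff_form_def fun_upd_def)
  then have "f z = (\<Prod>s\<in>insert s S. diff_form s z) * h z" for z
    using insert.hyps fg[of z] gh[of z] by (simp add: s)
  moreover have "d - int (card S) - 1 = d - int (card (insert s S))"
    using insert.hyps by simp
  ultimately show ?case using h by metis
qed


section \<open>Semisymmetric functions and uniqueness of interpolation\<close>

text \<open>
  In the partition of the indices by parity, \<open>xset n\<close> is the class of the last index \<open>n\<close>.
\<close>

definition xset :: "nat \<Rightarrow> nat set" where "xset n = {i \<in> {1..n}. even (n - i)}"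
definition yset :: "nat \<Rightarrow> nat set" where "yset n = {i \<in> {1..n}. odd (n - i)}"

lemma finite_xset [simp]: "finite (xset n)" and finite_yset [simp]: "finite (yset n)"
  by (simp_all add: xset_def yset_def)

lemma xset_pred:
  assumes "i \<in> xset n" shows "i - 1 \<notin> xset n"
proof
  assume "i - 1 \<in> xset n"
  then have "Suc (n - i) = n - (i - 1)" "even (n - (i - 1))" using assms by (auto simp: xset_def)
  then show False using assms by (simp add: xset_def flip: \<open>Suc (n - i) = n - (i - 1)\<close>)
qed

lemma card_xset: "card (xset n) = card {i \<in> {1..n}. odd i}"
proof (cases "odd n")
  case True
  then have "xset n = {i \<in> {1..n}. odd i}" by (auto simp: xset_def)
  then show ?thesis by simp
next
  case False
  then have "bij_betw (\<lambda>i. i - 1) (xset n) {i \<in> {1..n}. odd i}"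
    by (intro bij_betw_byWitness[where f' = Suc]) (auto simp: xset_def, presburger+)
  then show ?thesis by (rule bij_betw_same_card)
qed

text \<open>
  Invariance is required for transpositions only, since they are what the arguments use; they
  generate the whole group of permutations that preserve parity, see \<open>semisym_permute\<close>.
\<close>

definition semisym :: "nat \<Rightarrow> int \<Rightarrow> ((nat \<Rightarrow> 'k::field_char_0) \<Rightarrow> 'k) \<Rightarrow> bool" where
  "semisym n d f \<longleftrightarrow> poly_fun n d f \<and>
    (\<forall>a \<in> {1..n}. \<forall>b \<in> {1..n}. even (a + b) \<longrightarrow> (\<forall>z. f (z \<circ> transpose a b) = f z))"

lemma semisym_poly_fun: "semisym n d f \<Longrightarrow> poly_fun n d f"
  by (simp add: semisym_def)

lemma semisym_swap:
  "semisym n d f \<Longrightarrow> a \<in> {1..n} \<Longrightarrow> b \<in> {1..n} \<Longrightarrow> even (a + b) \<Longrightarrow> f (z \<circ> transpose a b) = f z"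
  by (simp add: semisym_def)

lemma semisymI:
  "poly_fun n d f \<Longrightarrow> (\<And>a b z. a \<in> {1..n} \<Longrightarrow> b \<in> {1..n} \<Longrightarrow> even (a + b) \<Longrightarrow>
    f (z \<circ> transpose a b) = f z) \<Longrightarrow> semisym n d f"
  by (simp add: semisym_def)

lemma semisym_add:
  "semisym n d f \<Longrightarrow> semisym n d g \<Longrightarrow> semisym n d (\<lambda>z. f z + g z)"
  by (auto simp: semisym_def intro: poly_fun.add)

lemma semisym_diff:
  "semisym n d f \<Longrightarrow> semisym n d g \<Longrightarrow> semisym n d (\<lambda>z. f z - g z)"
  by (auto simp: semisym_def intro: poly_fun_diff)

lemma semisym_cmult: "semisym n d f \<Longrightarrow> semisym n d (\<lambda>z. c * f z)"
  by (auto simp: semisym_def intro: poly_fun_cmult)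

lemma semisym_mult:
  "semisym n d f \<Longrightarrow> semisym n e g \<Longrightarrow> semisym n (d + e) (\<lambda>z. f z * g z)"
  by (auto simp: semisym_def intro: poly_fun_mult)

lemma semisym_translate:
  assumes "semisym n d f" shows "semisym n d (\<lambda>z. f (\<lambda>i. z i + c))"
proof (rule semisymI)
  show "poly_fun n d (\<lambda>z. f (\<lambda>i. z i + c))"
    using poly_fun_translate[OF semisym_poly_fun[OF assms], of "\<lambda>i. c"] .
  fix a b and z :: "nat \<Rightarrow> 'a" assume "a \<in> {1..n}" "b \<in> {1..n}" "even (a + b)"
  from semisym_swap[OF assms this, of "\<lambda>i. z i + c"]
  show "f (\<lambda>i. (z \<circ> transpose a b) i + c) = f (\<lambda>i. z i + c)" by (simp add: o_def)
qed

lemma prod_xset_swap: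
  assumes "a \<in> {1..n}" "b \<in> {1..n}" "even (a + b)"
  shows "(\<Prod>i\<in>xset n. (z \<circ> transpose a b) i) = (\<Prod>i\<in>xset n. z i)"
proof (cases "a \<in> xset n")
  case True
  then have "b \<in> xset n" using assms by (auto simp: xset_def)
  then have "transpose a b permutes xset n" using True by (rule permutes_swap_id[rotated])
  from prod.permute[OF this, of z] show ?thesis by (simp add: o_def)
next
  case False
  then have "b \<notin> xset n" using assms by (auto simp: xset_def)
  with False show ?thesis by (intro prod.cong) (auto simp: transpose_def)
qed

lemma poly_fun_prod_xset: "poly_fun n (int (card (xset n))) (\<lambda>z. \<Prod>i\<in>xset n. z i)"
  using poly_fun_prod[OF finite_xset, of n n "\<lambda>_. 1" "\<lambda>i z. z i"]
  by (simp add: poly_fun_var xset_def)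

lemma semisym_prod_xset: "semisym n (int (card (xset n))) (\<lambda>z. \<Prod>i\<in>xset n. z i)"
  by (rule semisymI[OF poly_fun_prod_xset prod_xset_swap])

lemma prod_diff_forms_xset: "(\<Prod>s\<in>(\<lambda>i. (i, 0)) ` xset n. diff_form s z) = (\<Prod>i\<in>xset n. z i)"
  by (subst prod.reindex) (auto simp: inj_on_def diff_form_def)

text \<open>
  By symmetry the zeros on \<open>z\<^sub>n = 0\<close> are repeated on \<open>z\<^sub>i = 0\<close> for every \<open>i\<close> in the class of \<open>n\<close>.
\<close>

lemma semisym_divide:
  assumes "0 < n" and f: "semisym n d f" and vanish: "\<And>z. z n = 0 \<Longrightarrow> f z = 0"
  obtains g where "semisym n (d - int (card (xset n))) g"
    and "\<And>z. f z = (\<Prod>i\<in>xset n. z i) * g z"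
proof -
  let ?S = "(\<lambda>i. (i, 0)) ` xset n :: (nat \<times> nat) set"
  have S: "b < a \<and> a \<le> n" if "(a, b) \<in> ?S" for a b
    using that by (auto simp: xset_def)
  have "f z = 0" if s: "s \<in> ?S" "diff_form s z = 0" for s z
  proof -
    obtain i where i: "i \<in> xset n" "s = (i, 0)" using s(1) by blast
    have "f (z \<circ> transpose i n) = 0"
      using s i by (intro vanish) (simp add: diff_form_def)
    moreover have "f (z \<circ> transpose i n) = f z"
      using i \<open>0 < n\<close> by (intro semisym_swap[OF f]) (auto simp: xset_def)
    ultimately show ?thesis by simp
  qed
  then obtain g where g: "poly_fun n (d - int (card ?S)) g"
    and fg: "\<And>z. f z = (\<Prod>s\<in>?S. diff_form s z) * g z"
    using poly_fun_divide_diff_forms[of ?S n d f] S semisym_poly_fun[OF f]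
    by (metis finite_imageI finite_xset)
  have card: "card ?S = card (xset n)" by (simp add: card_image inj_on_def)
  have swap: "g (z \<circ> transpose a b) = g z"
    if ab: "a \<in> {1..n}" "b \<in> {1..n}" "even (a + b)" for a b z
  proof -
    have "poly_fun n (d - int (card ?S)) (\<lambda>z. g (z \<circ> transpose a b))"
      unfolding o_def
      by (rule poly_fun_subst[OF g, where g = "\<lambda>i z. z (transpose a b i)"])
        (use ab in \<open>auto intro!: poly_fun_var simp: transpose_def\<close>)
    from poly_fun_diff[OF this g]
    have "poly_fun n (d - int (card ?S)) (\<lambda>z. g (z \<circ> transpose a b) - g z)" .
    moreover have "g (z \<circ> transpose a b) - g z = 0"
      if z: "(\<Prod>s\<in>?S. diff_form s z) \<noteq> 0" for z
    proof -
      have "(\<Prod>i\<in>xset n. z i) * g (z \<circ> transpose a b) = (\<Prod>i\<in>xset n. z i) * g z"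
        using semisym_swap[OF f ab, of z] fg[of z] fg[of "z \<circ> transpose a b"]
          prod_xset_swap[OF ab, of z] by (simp only: prod_diff_forms_xset)
      then show ?thesis using z by (simp only: prod_diff_forms_xset) simp
    qed
    ultimately have "g (z \<circ> transpose a b) - g z = 0"
      using poly_fun_cancel_diff_forms[of ?S n _ "\<lambda>z. g (z \<circ> transpose a b) - g z" z] S
      by fastforce
    then show ?thesis by simp
  qed
  show ?thesis
    using that[of g] semisymI[OF g swap] fg by (simp only: card prod_diff_forms_xset)
qed

text \<open>
  Passing from \<open>n + 1\<close> to \<open>n\<close> variables lowers every remaining entry of \<open>\<rho>\<close> by \<open>r\<close>; with
  \<open>c = r\<close> the translation compensates for this, so that interpolation points restrict to
  interpolation points.
\<close>

definition restrict_last :: "nat \<Rightarrow> 'k::field_char_0 \<Rightarrow> ((nat \<Rightarrow> 'k) \<Rightarrow> 'k) \<Rightarrow> (nat \<Rightarrow> 'k) \<Rightarrow> 'k" where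
  "restrict_last n c f z = f (\<lambda>i. if i = Suc n then 0 else z i + c)"

lemma semisym_restrict_last:
  assumes f: "semisym (Suc n) d f" shows "semisym n d (restrict_last n c f)"
proof (rule semisymI)
  show "poly_fun n d (restrict_last n c f)"
    unfolding restrict_last_def[abs_def]
  proof (rule poly_fun_subst[OF semisym_poly_fun[OF f],
        where g = "\<lambda>i z. if i = Suc n then 0 else z i + c"])
    show "poly_fun n 1 (\<lambda>z. if i = Suc n then 0 else z i + c)" if "i \<in> {1..Suc n}" for i
      using that poly_fun.add[OF poly_fun_var[of i n] poly_fun.const[of 1 n c]]
      by (cases "i = Suc n") (auto intro: poly_fun.zero)
  qed
  fix a b and z :: "nat \<Rightarrow> 'a" assume ab: "a \<in> {1..n}" "b \<in> {1..n}" "even (a + b)"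
  have "(\<lambda>i. if i = Suc n then 0 else (z \<circ> transpose a b) i + c) =
    (\<lambda>i. if i = Suc n then 0 else z i + c) \<circ> transpose a b"
    using ab by (auto simp: fun_eq_iff transpose_def)
  then show "restrict_last n c f (z \<circ> transpose a b) = restrict_last n c f z"
    using ab by (simp add: restrict_last_def semisym_swap[OF f])
qed

definition interp_point :: "nat \<Rightarrow> 'k::field_char_0 \<Rightarrow> (nat \<Rightarrow> nat) \<Rightarrow> nat \<Rightarrow> 'k" where
  "interp_point n r \<mu> = (\<lambda>i. rho n r i + of_nat (\<mu> i))"

definition add_column :: "nat \<Rightarrow> (nat \<Rightarrow> nat) \<Rightarrow> nat \<Rightarrow> nat" where
  "add_column n \<mu> = (\<lambda>i. if i \<in> {1..n} then \<mu> i + 1 else 0)"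

lemma Lambda_antimono:
  assumes "\<mu> \<in> Lambda n" "1 \<le> i" "i \<le> j" shows "\<mu> j \<le> \<mu> i"
proof (cases "j \<le> n")
  case True
  from assms(3) True show ?thesis
  proof (induction j rule: dec_induct)
    case (step j)
    then have "\<mu> (Suc j) \<le> \<mu> j" using assms by (auto simp: Lambda_def)
    with step show ?case by simp
  qed simp
next
  case False
  then show ?thesis using assms by (auto simp: Lambda_def)
qed

lemma Lambda_Suc: "\<mu> \<in> Lambda n \<Longrightarrow> \<mu> \<in> Lambda (Suc n)"
  by (auto simp: Lambda_def)

lemma Lambda_last: "\<mu> \<in> Lambda n \<Longrightarrow> \<mu> (Suc n) = 0"
  by (auto simp: Lambda_def)

lemma add_column_Lambda: "\<mu> \<in> Lambda n \<Longrightarrow> add_column n \<mu> \<in> Lambda n"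
  by (auto simp: Lambda_def add_column_def)

lemma Lambda_Suc_cases:
  assumes "\<mu> \<in> Lambda (Suc n)"
  obtains "\<mu> \<in> Lambda n" | \<nu> where "\<nu> \<in> Lambda (Suc n)" "\<mu> = add_column (Suc n) \<nu>"
proof (cases "\<mu> (Suc n) = 0")
  case True
  then have "\<mu> \<in> Lambda n"
    using assms by (auto simp: Lambda_def) (metis atLeastAtMost_iff le_SucE)
  then show ?thesis by (rule that(1))
next
  case False
  have "\<mu> i \<noteq> 0" if "i \<in> {1..Suc n}" for i
    using Lambda_antimono[OF assms, of i "Suc n"] that False by auto
  moreover have "\<mu> i = 0" if "i \<notin> {1..Suc n}" for i
    using assms that by (simp add: Lambda_def)
  ultimately have "\<mu> i = add_column (Suc n) (\<lambda>i. \<mu> i - 1) i" for i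
    by (cases "i \<in> {1..Suc n}") (simp_all add: add_column_def del: atLeastAtMost_iff)
  then have "\<mu> = add_column (Suc n) (\<lambda>i. \<mu> i - 1)" by (rule ext)
  moreover have "(\<lambda>i. \<mu> i - 1) \<in> Lambda (Suc n)"
    using assms by (auto simp: Lambda_def intro: diff_le_mono)
  ultimately show ?thesis by (rule that(2)[rotated])
qed

lemma Lambda_0: "\<mu> \<in> Lambda 0 \<longleftrightarrow> \<mu> = (\<lambda>i. 0)"
  by (auto simp: Lambda_def)

lemma odd_size_Suc: "\<mu> \<in> Lambda n \<Longrightarrow> odd_size (Suc n) \<mu> = odd_size n \<mu>"
  unfolding odd_size_def
proof (rule sum.mono_neutral_right)
  assume "\<mu> \<in> Lambda n"
  then show "\<forall>i\<in>{i \<in> {1..Suc n}. odd i} - {i \<in> {1..n}. odd i}. \<mu> i = 0"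
    by (auto simp: Lambda_def)
qed auto

lemma odd_size_add_column: "odd_size n (add_column n \<mu>) = odd_size n \<mu> + card (xset n)"
proof -
  have "odd_size n (add_column n \<mu>) = (\<Sum>i | i \<in> {1..n} \<and> odd i. \<mu> i + 1)"
    unfolding odd_size_def by (rule sum.cong) (auto simp: add_column_def)
  then show ?thesis by (simp add: sum_Suc odd_size_def card_xset)
qed

text \<open>
  The condition that \<open>r\<close> is not a negative rational number, in the form without denominators in
  which it is applied.
\<close>

definition not_neg_rat :: "'k::field_char_0 \<Rightarrow> bool" where
  "not_neg_rat r \<longleftrightarrow> (\<forall>a b. 0 < b \<longrightarrow> of_nat a * r + of_nat b \<noteq> 0)"

lemma interp_point_add_column:
  "i \<in> {1..n} \<Longrightarrow> interp_point n r (add_column n \<mu>) i = interp_point n r \<mu> i + 1"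
  by (simp add: interp_point_def add_column_def)

lemma prod_interp_point_add_column:
  assumes "not_neg_rat r" shows "(\<Prod>i\<in>xset n. interp_point n r (add_column n \<mu>) i) \<noteq> 0"
proof -
  have "interp_point n r (add_column n \<mu>) i \<noteq> 0" if "i \<in> xset n" for i
  proof -
    have "interp_point n r (add_column n \<mu>) i = of_nat (n - i) * r + of_nat (Suc (\<mu> i))"
      using that by (simp add: interp_point_def add_column_def xset_def rho_def)
    then show ?thesis using assms by (simp only: not_neg_rat_def) blast
  qed
  then show ?thesis by simp
qed

lemma restrict_last_interp_point:
  assumes f: "poly_fun (Suc n) d f" and "\<mu> \<in> Lambda n"
  shows "restrict_last n r f (interp_point n r \<mu>) = f (interp_point (Suc n) r \<mu>)"
  unfolding restrict_last_def
proof (rule poly_fun_cong[OF f])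
  fix i assume "i \<in> {1..Suc n}"
  then show "(if i = Suc n then 0 else interp_point n r \<mu> i + r) = interp_point (Suc n) r \<mu> i"
    using Lambda_last[OF assms(2)]
    by (auto simp: interp_point_def rho_def Suc_diff_le algebra_simps)
qed

lemma restrict_last_eq:
  assumes f: "poly_fun (Suc n) d f" and "z (Suc n) = 0"
  shows "f z = restrict_last n c f (\<lambda>i. z i - c)"
  unfolding restrict_last_def
  by (rule poly_fun_cong[OF f]) (use assms in auto)

text \<open>
  Induction on the number of variables and, inside, on the degree. The restriction to \<open>z\<^sub>n = 0\<close>
  satisfies the hypotheses in one variable less and so vanishes; then the product of the \<open>z\<^sub>i\<close> of
  the class of \<open>n\<close> splits off. Since this product is nonzero at all points \<open>\<rho> + \<mu>\<close> with
  \<open>\<mu>\<^sub>n > 0\<close> (here \<open>r\<close> must not be a negative rational), the translated quotient satisfies the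
  hypotheses in a smaller degree.
\<close>

lemma semisym_interp_unique:
  assumes r: "not_neg_rat r" and "semisym n d f"
    and "\<And>\<mu>. \<mu> \<in> Lambda n \<Longrightarrow> int (odd_size n \<mu>) \<le> d \<Longrightarrow> f (interp_point n r \<mu>) = 0"
  shows "f z = 0"
  using assms(2,3)
proof (induction n arbitrary: d f z)
  case 0
  show ?case
  proof (cases "d < 0")
    case True
    then show ?thesis using 0 poly_fun_neg_degree semisym_poly_fun by blast
  next
    case False
    have "f (interp_point 0 r (\<lambda>i. 0)) = 0"
      using False by (intro 0) (auto simp: Lambda_0 odd_size_def)
    moreover have "f z = f (interp_point 0 r (\<lambda>i. 0))"
      by (rule poly_fun_cong[OF semisym_poly_fun[OF 0(1)]]) auto
    ultimately show ?thesis by simp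
  qed
next
  case (Suc n)
  note IHn = Suc.IH
  from Suc.prems show ?case
  proof (induction "nat (d + 1)" arbitrary: d f z rule: less_induct)
    case less
    note f = \<open>semisym (Suc n) d f\<close>
    show ?case
    proof (cases "d < 0")
      case True
      then show ?thesis using f poly_fun_neg_degree semisym_poly_fun by blast
    next
      case False
      have r0: "restrict_last n r f w = 0" for w
      proof (rule IHn[OF semisym_restrict_last[OF f]])
        fix \<mu> assume "\<mu> \<in> Lambda n" "int (odd_size n \<mu>) \<le> d"
        then show "restrict_last n r f (interp_point n r \<mu>) = 0"
          using less.prems(2)[of \<mu>] Lambda_Suc
          by (simp add: restrict_last_interp_point[OF semisym_poly_fun[OF f]] odd_size_Suc)
      qed
      then have "f z = 0" if "z (Suc n) = 0" for z
        using restrict_last_eq[of n d f z r] semisym_poly_fun[OF f] that by simp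
      then obtain g where g: "semisym (Suc n) (d - int (card (xset (Suc n)))) g"
        and fg: "\<And>z. f z = (\<Prod>i\<in>xset (Suc n). z i) * g z"
        using semisym_divide[OF _ f] by blast
      let ?p = "int (card (xset (Suc n)))"
      have "Suc n \<in> xset (Suc n)" by (simp add: xset_def)
      then have p: "0 < ?p" using card_gt_0_iff by fastforce
      have "g (\<lambda>i. (z i - 1) + 1) = 0"
      proof (rule less.hyps[of "d - ?p" "\<lambda>z. g (\<lambda>i. z i + 1)"])
        show "nat (d - ?p + 1) < nat (d + 1)" using p False by linarith
        show "semisym (Suc n) (d - ?p) (\<lambda>z. g (\<lambda>i. z i + 1))"
          by (rule semisym_translate[OF g])
        fix \<mu> assume \<mu>: "\<mu> \<in> Lambda (Suc n)" "int (odd_size (Suc n) \<mu>) \<le> d - ?p"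
        then have "f (interp_point (Suc n) r (add_column (Suc n) \<mu>)) = 0"
          by (intro less.prems(2) add_column_Lambda) (simp_all add: odd_size_add_column)
        then have "g (interp_point (Suc n) r (add_column (Suc n) \<mu>)) = 0"
          using prod_interp_point_add_column[OF r, of "Suc n" \<mu>] by (simp add: fg)
        moreover have "g (interp_point (Suc n) r (add_column (Suc n) \<mu>)) =
          g (\<lambda>i. interp_point (Suc n) r \<mu> i + 1)"
          by (rule poly_fun_cong[OF semisym_poly_fun[OF g]]) (rule interp_point_add_column)
        ultimately show "g (\<lambda>i. interp_point (Suc n) r \<mu> i + 1) = 0" by simp
      qed
      then show ?thesis by (simp add: fg)
    qed
  qed
qed


section \<open>Elementary symmetric generators and existence of interpolation\<close>

text \<open>
  The elementary symmetric polynomial of degree \<open>k\<close> in the variables whose index has the parity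
  of \<open>q\<close>.
\<close>

definition parity_elem :: "nat \<Rightarrow> nat \<Rightarrow> nat \<Rightarrow> (nat \<Rightarrow> 'k::field_char_0) \<Rightarrow> 'k" where
  "parity_elem n q k z = (\<Sum>S | S \<subseteq> {i \<in> {1..n}. even (i + q)} \<and> card S = k. \<Prod>i\<in>S. z i)"

text \<open>
  Polynomials in the elementary symmetric polynomials of the two classes of variables, with the
  degree bound that counts the generator of degree \<open>k\<close> with weight \<open>k\<close>. They are introduced
  because each generator visibly lifts from \<open>n\<close> to \<open>n + 1\<close> variables.
\<close>

inductive elem_generated :: "nat \<Rightarrow> int \<Rightarrow> ((nat \<Rightarrow> 'k::field_char_0) \<Rightarrow> 'k) \<Rightarrow> bool"
  for n :: nat where
  zero: "elem_generated n d (\<lambda>z. 0)"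
| const: "0 \<le> d \<Longrightarrow> elem_generated n d (\<lambda>z. c)"
| elem_mult: "elem_generated n d f \<Longrightarrow> elem_generated n (d + int k) (\<lambda>z. parity_elem n q k z * f z)"
| add: "elem_generated n d f \<Longrightarrow> elem_generated n d g \<Longrightarrow> elem_generated n d (\<lambda>z. f z + g z)"

lemma semisym_parity_elem: "semisym n (int k) (parity_elem n q k)"
proof (rule semisymI)
  have fin: "finite S" if "S \<subseteq> {i \<in> {1..n}. even (i + q)}" for S
    using that by (rule finite_subset) simp
  have "poly_fun n (int k) (\<lambda>z. \<Prod>i\<in>S. z i)"
    if "S \<subseteq> {i \<in> {1..n}. even (i + q)} \<and> card S = k" for S
  proof -
    have "poly_fun n (\<Sum>i\<in>S. 1) (\<lambda>z. \<Prod>i\<in>S. z i)"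
      using that fin by (intro poly_fun_prod poly_fun_var) auto
    then show ?thesis using that by simp
  qed
  then show "poly_fun n (int k) (parity_elem n q k)"
    unfolding parity_elem_def[abs_def] by (intro poly_fun_sum) simp
next
  fix a b and z :: "nat \<Rightarrow> 'a"
  assume ab: "a \<in> {1..n}" "b \<in> {1..n}" "even (a + b)"
  let ?t = "transpose a b" and ?I = "{i \<in> {1..n}. even (i + q)}"
  have t: "?t i \<in> ?I" if "i \<in> ?I" for i
    using that ab unfolding transpose_def mem_Collect_eq atLeastAtMost_iff by presburger
  have inj: "inj_on ?t S" for S by (rule inj_on_subset[OF inj_transpose]) simp
  show "parity_elem n q k (z \<circ> ?t) = parity_elem n q k z"
    unfolding parity_elem_def
  proof (rule sum.reindex_bij_witness[where i = "image ?t" and j = "image ?t"])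
    fix S assume S: "S \<in> {S. S \<subseteq> ?I \<and> card S = k}"
    show "?t ` ?t ` S = S" by (simp add: image_image)
    show "?t ` S \<in> {S. S \<subseteq> ?I \<and> card S = k}"
      using S t by (auto simp: card_image[OF inj])
    show "(\<Prod>i\<in>?t ` S. z i) = (\<Prod>i\<in>S. (z \<circ> ?t) i)"
      by (subst prod.reindex[OF inj]) simp
  next
    fix S assume S: "S \<in> {S. S \<subseteq> ?I \<and> card S = k}"
    show "?t ` ?t ` S = S" by (simp add: image_image)
    show "?t ` S \<in> {S. S \<subseteq> ?I \<and> card S = k}"
      using S t by (auto simp: card_image[OF inj])
  qed
qed

lemma elem_generated_semisym: "elem_generated n d f \<Longrightarrow> semisym n d f"
proof (induction rule: elem_generated.induct)
  case (elem_mult d f k q)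
  from semisym_mult[OF semisym_parity_elem elem_mult.IH] show ?case by (simp add: add.commute)
qed (auto simp: semisym_def intro: poly_fun.intros)

lemma parity_elem_Suc: 
  assumes "z (Suc n) = 0" shows "parity_elem (Suc n) q k z = parity_elem n q k z"
  unfolding parity_elem_def
proof (rule sum.mono_neutral_right)
  show "finite {S. S \<subseteq> {i \<in> {1..Suc n}. even (i + q)} \<and> card S = k}"
    by (rule finite_subset[of _ "Pow {1..Suc n}"]) auto
  show "\<forall>S\<in>{S. S \<subseteq> {i \<in> {1..Suc n}. even (i + q)} \<and> card S = k} -
      {S. S \<subseteq> {i \<in> {1..n}. even (i + q)} \<and> card S = k}. (\<Prod>i\<in>S. z i) = 0"
  proof
    fix S assume S: "S \<in> {S. S \<subseteq> {i \<in> {1..Suc n}. even (i + q)} \<and> card S = k} -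
      {S. S \<subseteq> {i \<in> {1..n}. even (i + q)} \<and> card S = k}"
    have "finite S" by (rule finite_subset[of _ "{1..Suc n}"]) (use S in auto)
    moreover have "Suc n \<in> S"
    proof (rule ccontr)
      assume n: "Suc n \<notin> S"
      have "i \<in> {1..n}" if "i \<in> S" for i
      proof -
        have "i \<in> {1..Suc n}" "i \<noteq> Suc n" using that S n by auto
        then show ?thesis by simp
      qed
      then have "S \<subseteq> {i \<in> {1..n}. even (i + q)}" using S by blast
      with S show False by blast
    qed
    ultimately show "(\<Prod>i\<in>S. z i) = 0" using assms by auto
  qed
qed auto

lemma elem_generated_lift:
  "elem_generated n d f \<Longrightarrow> \<exists>F. elem_generated (Suc n) d F \<and> (\<forall>z. z (Suc n) = 0 \<longrightarrow> F z = f z)"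
proof (induction rule: elem_generated.induct)
  case (elem_mult d f k q)
  then obtain F where F: "elem_generated (Suc n) d F" "\<And>z. z (Suc n) = 0 \<Longrightarrow> F z = f z" by blast
  from elem_generated.elem_mult[OF F(1), of k q] F(2) show ?case
    by (intro exI[of _ "\<lambda>z. parity_elem (Suc n) q k z * F z"]) (simp add: parity_elem_Suc)
next
  case (add d f g)
  then obtain F G where "elem_generated (Suc n) d F" "\<And>z. z (Suc n) = 0 \<Longrightarrow> F z = f z"
    "elem_generated (Suc n) d G" "\<And>z. z (Suc n) = 0 \<Longrightarrow> G z = g z" by blast
  then show ?case by (intro exI[of _ "\<lambda>z. F z + G z"]) (simp add: elem_generated.add)
qed (auto intro: elem_generated.intros)

lemma parity_elem_xset: "parity_elem n n (card (xset n)) z = (\<Prod>i\<in>xset n. z i)"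
proof -
  have I: "{i \<in> {1..n}. even (i + n)} = xset n" by (auto simp: xset_def)
  have "{S. S \<subseteq> xset n \<and> card S = card (xset n)} = {xset n}"
    by (auto dest: card_subset_eq[OF finite_xset])
  then show ?thesis unfolding parity_elem_def I by simp
qed

text \<open>
  The fundamental theorem on symmetric polynomials for two classes of variables, with control of
  degrees: subtract a lift of the restriction to \<open>z\<^sub>n = 0\<close>; the difference is divisible by the
  top elementary symmetric polynomial of the class of \<open>n\<close>.
\<close>

lemma semisym_elem_generated: "semisym n d f \<Longrightarrow> elem_generated n d f"
proof (induction n arbitrary: d f)
  case 0
  have f: "f = (\<lambda>z. f (\<lambda>i. 0))"
    by (intro ext poly_fun_cong[OF semisym_poly_fun[OF 0]]) auto
  show ?case
  proof (cases "d < 0")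
    case True
    then have "f = (\<lambda>z. 0)" using poly_fun_neg_degree[OF semisym_poly_fun[OF 0]] by blast
    then show ?thesis by (simp add: elem_generated.zero)
  next
    case False
    then show ?thesis by (subst f) (simp add: elem_generated.const)
  qed
next
  case (Suc n)
  note IHn = Suc.IH
  from Suc.prems show ?case
  proof (induction "nat (d + 1)" arbitrary: d f rule: less_induct)
    case less
    note f = \<open>semisym (Suc n) d f\<close>
    let ?p = "int (card (xset (Suc n)))"
    show ?case
    proof (cases "d < 0")
      case True
      then have "f = (\<lambda>z. 0)" using poly_fun_neg_degree[OF semisym_poly_fun[OF f]] by blast
      then show ?thesis by (simp add: elem_generated.zero)
    next
      case False
      from elem_generated_lift[OF IHn[OF semisym_restrict_last[OF f]]]
      obtain F where F: "elem_generated (Suc n) d F"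
        and F_eq: "\<And>z. z (Suc n) = 0 \<Longrightarrow> F z = restrict_last n 0 f z" by blast
      have "f z - F z = 0" if "z (Suc n) = 0" for z
        using that restrict_last_eq[of n d f z 0] semisym_poly_fun[OF f] F_eq[of z] by simp
      then obtain g where g: "semisym (Suc n) (d - ?p) g"
        and fg: "\<And>z. f z - F z = (\<Prod>i\<in>xset (Suc n). z i) * g z"
        using semisym_divide[OF _ semisym_diff[OF f elem_generated_semisym[OF F]]] by blast
      have "Suc n \<in> xset (Suc n)" by (simp add: xset_def)
      then have p: "0 < ?p" using card_gt_0_iff by fastforce
      have "elem_generated (Suc n) (d - ?p) g"
        by (rule less.hyps[OF _ g]) (use p False in linarith)
      from elem_generated.elem_mult[OF this, of "card (xset (Suc n))" "Suc n"]
      have "elem_generated (Suc n) d (\<lambda>z. (\<Prod>i\<in>xset (Suc n). z i) * g z)"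
        by (simp add: parity_elem_xset)
      from elem_generated.add[OF F this]
      have "elem_generated (Suc n) d (\<lambda>z. F z + (\<Prod>i\<in>xset (Suc n). z i) * g z)" .
      moreover have "F z + (\<Prod>i\<in>xset (Suc n). z i) * g z = f z" for z
        using fg[of z] by (simp add: algebra_simps)
      ultimately show ?thesis by simp
    qed
  qed
qed

lemma semisym_lift:
  assumes "semisym n d g"
  obtains G where "semisym (Suc n) d G" "\<And>z. z (Suc n) = 0 \<Longrightarrow> G z = g z"
  using elem_generated_lift[OF semisym_elem_generated[OF assms]] elem_generated_semisym by blast

text \<open>
  First the values at the \<open>\<mu>\<close> with \<open>\<mu>\<^sub>n = 0\<close> are realised in one variable less and lifted. Adding
  a multiple of the product of the \<open>z\<^sub>i\<close> of the class of \<open>n\<close> does not disturb them, and adjusting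
  the values at the remaining \<open>\<mu>\<close> is an interpolation problem of smaller degree.
\<close>

lemma semisym_interp_exists:
  assumes r: "not_neg_rat r"
  shows "\<exists>f. semisym n d f \<and>
    (\<forall>\<mu> \<in> Lambda n. int (odd_size n \<mu>) \<le> d \<longrightarrow> f (interp_point n r \<mu>) = v \<mu>)"
proof (induction n arbitrary: d v)
  case 0
  show ?case
  proof (cases "d < 0")
    case True
    then show ?thesis by (intro exI[of _ "\<lambda>z. 0"]) (simp add: semisym_def poly_fun.zero)
  next
    case False
    then show ?thesis
      by (intro exI[of _ "\<lambda>z. v (\<lambda>i. 0)"]) (simp add: semisym_def poly_fun.const Lambda_0)
  qed
next
  case (Suc n)
  note IHn = Suc.IH
  show ?case
  proof (induction "nat (d + 1)" arbitrary: d v rule: less_induct)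
    case less
    let ?p = "int (card (xset (Suc n)))"
    show ?case
    proof (cases "d < 0")
      case True
      then show ?thesis by (intro exI[of _ "\<lambda>z. 0"]) (simp add: semisym_def poly_fun.zero)
    next
      case False
      obtain g where g: "semisym n d g"
        and gv: "\<And>\<mu>. \<mu> \<in> Lambda n \<Longrightarrow> int (odd_size n \<mu>) \<le> d \<Longrightarrow> g (interp_point n r \<mu>) = v \<mu>"
        using IHn[of d v] by blast
      obtain G where G: "semisym (Suc n) d G"
        and Gg: "\<And>z. z (Suc n) = 0 \<Longrightarrow> G z = g (\<lambda>i. z i + - r)"
        using semisym_lift[OF semisym_translate[OF g, of "- r"]] by blast
      have "Suc n \<in> xset (Suc n)" by (simp add: xset_def)
      then have p: "0 < ?p" using card_gt_0_iff by fastforce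
      define w where "w \<nu> = (v (add_column (Suc n) \<nu>) - G (interp_point (Suc n) r (add_column (Suc n) \<nu>))) /
        (\<Prod>i\<in>xset (Suc n). interp_point (Suc n) r (add_column (Suc n) \<nu>) i)" for \<nu>
      have "nat (d - ?p + 1) < nat (d + 1)" using p False by linarith
      from less.hyps[OF this, of w]
      obtain H where H: "semisym (Suc n) (d - ?p) H"
        and Hw: "\<And>\<nu>. \<nu> \<in> Lambda (Suc n) \<Longrightarrow> int (odd_size (Suc n) \<nu>) \<le> d - ?p \<Longrightarrow>
          H (interp_point (Suc n) r \<nu>) = w \<nu>" by blast
      define f where "f z = G z + (\<Prod>i\<in>xset (Suc n). z i) * H (\<lambda>i. z i + - 1)" for z
      have "semisym (Suc n) d (\<lambda>z. (\<Prod>i\<in>xset (Suc n). z i) * H (\<lambda>i. z i + - 1))"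
        using semisym_mult[OF semisym_prod_xset semisym_translate[OF H, of "- 1"]] by simp
      from semisym_add[OF G this] have "semisym (Suc n) d f" unfolding f_def .
      moreover have "f (interp_point (Suc n) r \<mu>) = v \<mu>"
        if \<mu>: "\<mu> \<in> Lambda (Suc n)" "int (odd_size (Suc n) \<mu>) \<le> d" for \<mu>
        using \<mu>(1)
      proof (cases rule: Lambda_Suc_cases)
        case 1
        have 0: "interp_point (Suc n) r \<mu> (Suc n) = 0"
          using Lambda_last[OF 1] by (simp add: interp_point_def rho_def)
        then have "(\<Prod>i\<in>xset (Suc n). interp_point (Suc n) r \<mu> i) = 0"
          using \<open>Suc n \<in> xset (Suc n)\<close> by (auto intro!: prod_zero)
        moreover have "g (\<lambda>i. interp_point (Suc n) r \<mu> i + - r) = g (interp_point n r \<mu>)"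
          by (rule poly_fun_cong[OF semisym_poly_fun[OF g]])
            (auto simp: interp_point_def rho_def Suc_diff_le algebra_simps)
        ultimately show ?thesis
          using gv[OF 1] \<mu>(2) Gg[of "interp_point (Suc n) r \<mu>"] 0 by (simp add: f_def odd_size_Suc[OF 1])
      next
        case (2 \<nu>)
        have "H (\<lambda>i. interp_point (Suc n) r \<mu> i + - 1) = H (interp_point (Suc n) r \<nu>)"
          unfolding 2(2)
          by (rule poly_fun_cong[OF semisym_poly_fun[OF H]]) (simp only: interp_point_add_column, simp)
        moreover have "H (interp_point (Suc n) r \<nu>) = w \<nu>"
          using \<mu>(2) by (intro Hw 2(1)) (simp add: 2(2) odd_size_add_column)
        ultimately show ?thesis
          using prod_interp_point_add_column[OF r, of "Suc n" \<nu>] by (simp add: f_def w_def 2(2))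
      qed
      ultimately show ?thesis by blast
    qed
  qed
qed


section \<open>Polynomials as functions, and their coefficients\<close>

definition monom_eval :: "(nat \<Rightarrow> 'k::comm_semiring_1) \<Rightarrow> (nat \<Rightarrow>\<^sub>0 nat) \<Rightarrow> 'k" where
  "monom_eval z m = (\<Prod>i\<in>Poly_Mapping.keys m. z i ^ Poly_Mapping.lookup m i)"

lemma monom_eval_superset:
  assumes "finite V" "Poly_Mapping.keys m \<subseteq> V"
  shows "monom_eval z m = (\<Prod>i\<in>V. z i ^ Poly_Mapping.lookup m i)"
  unfolding monom_eval_def
  by (rule prod.mono_neutral_left) (use assms in \<open>auto simp: in_keys_iff\<close>)

lemma monom_eval_single [simp]: "monom_eval z (Poly_Mapping.single i 1) = z i"
  by (simp add: monom_eval_def)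

lemma monom_eval_0 [simp]: "monom_eval z 0 = 1"
  by (simp add: monom_eval_def)

lemma monom_eval_add: "monom_eval z (m + m') = monom_eval z m * monom_eval z m'"
proof -
  let ?V = "Poly_Mapping.keys m \<union> Poly_Mapping.keys m'"
  have "monom_eval z (m + m') = (\<Prod>i\<in>?V. z i ^ Poly_Mapping.lookup (m + m') i)"
    by (rule monom_eval_superset) (simp_all add: keys_add)
  also have "\<dots> = monom_eval z m * monom_eval z m'"
    by (simp add: monom_eval_superset[of ?V m] monom_eval_superset[of ?V m'] lookup_add power_add prod.distrib)
  finally show ?thesis .
qed

lemma monom_degree_superset:
  assumes "finite V" "Poly_Mapping.keys m \<subseteq> V"
  shows "monom_degree m = (\<Sum>i\<in>V. Poly_Mapping.lookup m i)"
  unfolding monom_degree_def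
  by (rule sum.mono_neutral_left) (use assms in \<open>auto simp: in_keys_iff\<close>)

lemma monom_degree_add: "monom_degree (m + m') = monom_degree m + monom_degree m'"
proof -
  let ?V = "Poly_Mapping.keys m \<union> Poly_Mapping.keys m'"
  have "monom_degree (m + m') = (\<Sum>i\<in>?V. Poly_Mapping.lookup (m + m') i)"
    by (rule monom_degree_superset) (simp_all add: keys_add)
  also have "\<dots> = monom_degree m + monom_degree m'"
    by (simp add: monom_degree_superset[of ?V m] monom_degree_superset[of ?V m']
        lookup_add sum.distrib)
  finally show ?thesis .
qed

lemma monom_degree_single [simp]: "monom_degree (Poly_Mapping.single i k) = k"
  by (simp add: monom_degree_def)

lemma monom_degree_0 [simp]: "monom_degree 0 = 0"
  by (simp add: monom_degree_def)

lemma eval_poly_superset: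
  assumes "finite K" "Poly_Mapping.keys p \<subseteq> K"
  shows "eval_poly p z = (\<Sum>m\<in>K. Poly_Mapping.lookup p m * monom_eval z m)"
  unfolding eval_poly_def monom_eval_def[symmetric]
  by (rule sum.mono_neutral_left) (use assms in \<open>auto simp: in_keys_iff\<close>)

lemma eval_poly_0 [simp]: "eval_poly 0 z = 0"
  by (simp add: eval_poly_def)

lemma eval_poly_add: "eval_poly (p + q) z = eval_poly p z + eval_poly q z"
proof -
  let ?K = "Poly_Mapping.keys p \<union> Poly_Mapping.keys q"
  have "eval_poly (p + q) z = (\<Sum>m\<in>?K. Poly_Mapping.lookup (p + q) m * monom_eval z m)"
    by (rule eval_poly_superset) (simp_all add: keys_add)
  also have "\<dots> = eval_poly p z + eval_poly q z"
    by (simp add: eval_poly_superset[of ?K p] eval_poly_superset[of ?K q]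
        lookup_add sum.distrib distrib_right)
  finally show ?thesis .
qed

lemma eval_poly_sum: "eval_poly (\<Sum>x\<in>S. p x) z = (\<Sum>x\<in>S. eval_poly (p x) z)"
  by (induction S rule: infinite_finite_induct) (simp_all add: eval_poly_add)

lemma eval_poly_single [simp]: "eval_poly (Poly_Mapping.single m c) z = c * monom_eval z m"
  by (simp add: eval_poly_def monom_eval_def)

lemma mpoly_expand:
  "p = (\<Sum>m\<in>Poly_Mapping.keys p. Poly_Mapping.single m (Poly_Mapping.lookup p m))"
  by (rule poly_mapping_eqI)
    (simp add: lookup_sum lookup_single when_def in_keys_iff sum.delta)

lemma eval_poly_monom_mult:
  "eval_poly (Poly_Mapping.single a c * p) z = c * monom_eval z a * eval_poly p z"
proof -
  have "eval_poly (Poly_Mapping.single a c * p) z =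
    eval_poly (Poly_Mapping.single a c *
      (\<Sum>m\<in>Poly_Mapping.keys p. Poly_Mapping.single m (Poly_Mapping.lookup p m))) z"
    using mpoly_expand[of p] by simp
  also have "\<dots> = (\<Sum>m\<in>Poly_Mapping.keys p. c * monom_eval z a * (Poly_Mapping.lookup p m * monom_eval z m))"
    by (simp add: sum_distrib_left mult_single eval_poly_sum monom_eval_add mult_ac)
  also have "\<dots> = c * monom_eval z a * eval_poly p z"
    by (simp add: eval_poly_superset[of "Poly_Mapping.keys p"] sum_distrib_left)
  finally show ?thesis .
qed

lemma lookup_monom_mult:
  fixes p :: "'k::comm_semiring_1 mpoly"
  shows "Poly_Mapping.lookup (Poly_Mapping.single a c * p) e =
    (\<Sum>m\<in>Poly_Mapping.keys p. c * Poly_Mapping.lookup p m when a + m = e)"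
proof -
  have "Poly_Mapping.lookup (Poly_Mapping.single a c * p) e = Poly_Mapping.lookup
    (Poly_Mapping.single a c *
      (\<Sum>m\<in>Poly_Mapping.keys p. Poly_Mapping.single m (Poly_Mapping.lookup p m))) e"
    using mpoly_expand[of p] by simp
  then show ?thesis
    by (simp add: sum_distrib_left mult_single lookup_sum lookup_single)
qed

lemma lookup_monom_mult_add:
  fixes p :: "'k::comm_semiring_1 mpoly"
  shows "Poly_Mapping.lookup (Poly_Mapping.single a c * p) (a + m) = c * Poly_Mapping.lookup p m"
  by (simp add: lookup_monom_mult when_def in_keys_iff sum.delta)

text \<open>
  Induction on the variables: for fixed values of the others, the sum is a polynomial in the next
  variable, so that its coefficients vanish. The third hypothesis only asks that the exponents
  be distinguished by the variables of \<open>V\<close>; in this form it passes to the exponents with a given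
  entry at the new variable.
\<close>

lemma power_products_independent:
  fixes c :: "('b \<Rightarrow>\<^sub>0 nat) \<Rightarrow> 'k::field_char_0"
  assumes "finite V" "finite K"
    and "\<And>m m'. m \<in> K \<Longrightarrow> m' \<in> K \<Longrightarrow>
      (\<And>i. i \<in> V \<Longrightarrow> Poly_Mapping.lookup m i = Poly_Mapping.lookup m' i) \<Longrightarrow> m = m'"
    and "\<And>z. (\<Sum>m\<in>K. c m * (\<Prod>i\<in>V. z i ^ Poly_Mapping.lookup m i)) = 0"
    and "m \<in> K"
  shows "c m = 0"
  using assms
proof (induction V arbitrary: K m rule: finite_induct)
  case empty
  then have "K = {m}" by auto
  with empty show ?case by simp
next
  case (insert v V)
  let ?K = "{m' \<in> K. Poly_Mapping.lookup m' v = Poly_Mapping.lookup m v}"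
  have "(\<Sum>m\<in>?K. c m * (\<Prod>i\<in>V. z i ^ Poly_Mapping.lookup m i)) = 0" for z
  proof -
    define P where "P = (\<Sum>m\<in>K. Polynomial.monom
      (c m * (\<Prod>i\<in>V. z i ^ Poly_Mapping.lookup m i)) (Poly_Mapping.lookup m v))"
    have "poly P x = 0" for x
    proof -
      have "(\<Prod>i\<in>V. (z(v := x)) i ^ Poly_Mapping.lookup m i) =
        (\<Prod>i\<in>V. z i ^ Poly_Mapping.lookup m i)" for m
        using insert.hyps by (intro prod.cong) auto
      then have "poly P x =
        (\<Sum>m\<in>K. c m * (\<Prod>i\<in>insert v V. (z(v := x)) i ^ Poly_Mapping.lookup m i))"
        using insert.hyps by (simp add: P_def poly_sum poly_monom mult_ac)
      then show ?thesis using insert.prems(3)[of "z(v := x)"] by simp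
    qed
    then have "P = 0" using poly_all_0_iff_0 by blast
    then have "coeff P (Poly_Mapping.lookup m v) = 0" by simp
    then show ?thesis
      using insert.prems(1)
      by (simp add: P_def coeff_sum sum.inter_filter[symmetric] if_distrib cong: if_cong)
  qed
  moreover have "m1 = m2"
    if "m1 \<in> ?K" "m2 \<in> ?K"
      "\<And>i. i \<in> V \<Longrightarrow> Poly_Mapping.lookup m1 i = Poly_Mapping.lookup m2 i" for m1 m2
    using that by (intro insert.prems(2)) auto
  ultimately show ?case
    using insert.prems(1,4) by (intro insert.IH[of ?K]) auto
qed

lemma eval_poly_inject:
  fixes p q :: "'k::field_char_0 mpoly"
  assumes eq: "\<And>z. eval_poly p z = eval_poly q z"
  shows "p = q"
proof (rule poly_mapping_eqI)
  fix m
  \<comment> \<open>\<open>m\<close> is inserted because it need not occur in \<open>p\<close> or \<open>q\<close>\<close>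
  let ?K = "insert m (Poly_Mapping.keys p \<union> Poly_Mapping.keys q)"
  let ?V = "\<Union>m\<in>?K. Poly_Mapping.keys m"
  have sum0: "(\<Sum>m\<in>?K. (Poly_Mapping.lookup p m - Poly_Mapping.lookup q m) *
    (\<Prod>i\<in>?V. z i ^ Poly_Mapping.lookup m i)) = 0" for z
  proof -
    have "(\<Sum>m\<in>?K. (Poly_Mapping.lookup p m - Poly_Mapping.lookup q m) *
      (\<Prod>i\<in>?V. z i ^ Poly_Mapping.lookup m i)) =
      (\<Sum>m\<in>?K. (Poly_Mapping.lookup p m - Poly_Mapping.lookup q m) * monom_eval z m)"
      by (intro sum.cong refl) (subst monom_eval_superset[of ?V], auto)
    also have "\<dots> = eval_poly p z - eval_poly q z"
      by (subst (1 2) eval_poly_superset[of ?K]) (auto simp: left_diff_distrib sum_subtractf)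
    finally show ?thesis using eq by simp
  qed
  have "Poly_Mapping.lookup p m - Poly_Mapping.lookup q m = 0"
  proof (rule power_products_independent[of ?V ?K, OF _ _ _ sum0])
    fix m m' assume m: "m \<in> ?K" "m' \<in> ?K"
      and V: "\<And>i. i \<in> ?V \<Longrightarrow> Poly_Mapping.lookup m i = Poly_Mapping.lookup m' i"
    show "m = m'"
    proof (rule poly_mapping_eqI)
      fix i
      show "Poly_Mapping.lookup m i = Poly_Mapping.lookup m' i"
      proof (cases "i \<in> ?V")
        case False
        then show ?thesis using m by (auto simp: in_keys_iff)
      qed (rule V)
    qed
  qed auto
  then show "Poly_Mapping.lookup p m = Poly_Mapping.lookup q m" by simp
qed

lemma eval_poly_poly_fun:
  assumes "p \<in> polys n" "int (total_degree p) \<le> d"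
  shows "poly_fun n d (eval_poly p)"
proof -
  have "poly_fun n d (\<lambda>z. Poly_Mapping.lookup p m * monom_eval z m)"
    if m: "m \<in> Poly_Mapping.keys p" for m
  proof -
    have keys: "Poly_Mapping.keys m \<subseteq> {1..n}" using m assms(1) by (auto simp: polys_def)
    have pow: "poly_fun n (int k) (\<lambda>z. z i ^ k)" if "i \<in> {1..n}" for i k
    proof (induction k)
      case (Suc k)
      from poly_fun.var_mult[OF this that] show ?case by (simp add: add.commute)
    qed (simp add: poly_fun.const)
    have "poly_fun n (\<Sum>i\<in>Poly_Mapping.keys m. int (Poly_Mapping.lookup m i)) (\<lambda>z. monom_eval z m)"
      unfolding monom_eval_def by (intro poly_fun_prod pow) (use keys in auto)
    moreover have "int (monom_degree m) \<le> d"
    proof -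
      have "monom_degree m \<le> total_degree p"
        unfolding total_degree_def using m by (intro Max_ge) auto
      then show ?thesis using assms(2) by linarith
    qed
    ultimately have "poly_fun n d (\<lambda>z. monom_eval z m)"
      unfolding monom_degree_def of_nat_sum by (rule poly_fun_mono)
    then show ?thesis by (rule poly_fun_cmult)
  qed
  then show ?thesis
    unfolding eval_poly_def monom_eval_def[symmetric] by (rule poly_fun_sum)
qed

lemma poly_fun_eval_poly:
  "poly_fun n d f \<Longrightarrow> \<exists>p \<in> polys n. (\<forall>m \<in> Poly_Mapping.keys p. int (monom_degree m) \<le> d) \<and>
    eval_poly p = f"
proof (induction rule: poly_fun.induct)
  case (zero d)
  then show ?case by (intro bexI[of _ 0]) (auto simp: polys_def)
next
  case (const d c)
  then show ?case
    by (intro bexI[of _ "Poly_Mapping.single 0 c"]) (auto simp: polys_def fun_eq_iff)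
next
  case (var_mult d f i)
  then obtain p where p: "p \<in> polys n" "\<And>m. m \<in> Poly_Mapping.keys p \<Longrightarrow> int (monom_degree m) \<le> d"
    "eval_poly p = f" by blast
  let ?x = "Poly_Mapping.single i 1 :: nat \<Rightarrow>\<^sub>0 nat"
  let ?q = "Poly_Mapping.single ?x 1 * p"
  have keys: "\<exists>m' \<in> Poly_Mapping.keys p. m = ?x + m'" if "m \<in> Poly_Mapping.keys ?q" for m
    using that keys_mult[of "Poly_Mapping.single ?x 1" p] by (auto split: if_splits)
  have "?q \<in> polys n"
    unfolding polys_def mem_Collect_eq
  proof
    fix m assume "m \<in> Poly_Mapping.keys ?q"
    then obtain m' where m': "m' \<in> Poly_Mapping.keys p" "m = ?x + m'" using keys by blast
    have "Poly_Mapping.keys m \<subseteq> {i} \<union> Poly_Mapping.keys m'"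
      using keys_add[of ?x m'] m'(2) by simp
    moreover have "Poly_Mapping.keys m' \<subseteq> {1..n}" using p(1) m'(1) by (simp add: polys_def)
    ultimately show "Poly_Mapping.keys m \<subseteq> {1..n}" using var_mult.hyps(2) by blast
  qed
  moreover have "int (monom_degree m) \<le> d + 1" if "m \<in> Poly_Mapping.keys ?q" for m
    using keys[OF that] p(2) by (auto simp: monom_degree_add)
  moreover have "eval_poly ?q = (\<lambda>z. z i * f z)"
    using p(3) by (auto simp: fun_eq_iff eval_poly_monom_mult simp del: One_nat_def)
  ultimately show ?case by blast
next
  case (add d f g)
  then obtain p q where pq: "p \<in> polys n" "\<And>m. m \<in> Poly_Mapping.keys p \<Longrightarrow> int (monom_degree m) \<le> d"
    "eval_poly p = f" "q \<in> polys n" "\<And>m. m \<in> Poly_Mapping.keys q \<Longrightarrow> int (monom_degree m) \<le> d"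
    "eval_poly q = g" by blast
  have keys: "m \<in> Poly_Mapping.keys p \<or> m \<in> Poly_Mapping.keys q"
    if "m \<in> Poly_Mapping.keys (p + q)" for m
    using that keys_add[of p q] by blast
  have "p + q \<in> polys n"
    using pq(1,4) keys unfolding polys_def by blast
  moreover have "\<forall>m\<in>Poly_Mapping.keys (p + q). int (monom_degree m) \<le> d"
    using pq(2,5) keys by blast
  moreover have "eval_poly (p + q) = (\<lambda>z. f z + g z)"
    using pq(3,6) by (auto simp: eval_poly_add)
  ultimately show ?case by blast
qed

text \<open>
  The coefficient is well defined as a polynomial is determined by its values, see
  \<open>eval_poly_inject\<close>.
\<close>

definition poly_coeff :: "((nat \<Rightarrow> 'k::field_char_0) \<Rightarrow> 'k) \<Rightarrow> (nat \<Rightarrow>\<^sub>0 nat) \<Rightarrow> 'k" where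
  "poly_coeff f m = Poly_Mapping.lookup (THE p. eval_poly p = f) m"

lemma poly_coeff_eval [simp]: "poly_coeff (eval_poly p) m = Poly_Mapping.lookup p m"
proof -
  have "(THE q. eval_poly q = eval_poly p) = p"
    by (rule the_equality) (auto intro: eval_poly_inject)
  then show ?thesis by (simp add: poly_coeff_def)
qed

lemma poly_coeff_add:
  assumes "poly_fun n d f" "poly_fun n d g"
  shows "poly_coeff (\<lambda>z. f z + g z) m = poly_coeff f m + poly_coeff g m"
proof -
  obtain p q where "eval_poly p = f" "eval_poly q = g"
    using assms poly_fun_eval_poly by metis
  then have "(\<lambda>z. f z + g z) = eval_poly (p + q)" by (auto simp: eval_poly_add)
  then show ?thesis
    using \<open>eval_poly p = f\<close> \<open>eval_poly q = g\<close> poly_coeff_eval[of p m] poly_coeff_eval[of q m]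
    by (simp add: lookup_add)
qed

lemma poly_coeff_cmult:
  assumes "poly_fun n d f"
  shows "poly_coeff (\<lambda>z. c * f z) m = c * poly_coeff f m"
proof -
  obtain p where p: "eval_poly p = f"
    using assms poly_fun_eval_poly by metis
  then have "(\<lambda>z. c * f z) = eval_poly (Poly_Mapping.single 0 c * p)"
    by (auto simp: eval_poly_monom_mult)
  then show ?thesis
    using p poly_coeff_eval[of p m] lookup_monom_mult_add[of 0 c p m] by simp
qed

lemma poly_coeff_high_degree:
  assumes "poly_fun n d f" "d < int (monom_degree m)"
  shows "poly_coeff f m = 0"
proof -
  obtain p where "eval_poly p = f" "\<And>m. m \<in> Poly_Mapping.keys p \<Longrightarrow> int (monom_degree m) \<le> d"
    using poly_fun_eval_poly[OF assms(1)] by blast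
  then show ?thesis using assms(2) poly_coeff_eval[of p m] by (force simp: in_keys_iff)
qed

lemma poly_coeff_var_mult:
  assumes "poly_fun n d f"
  shows "poly_coeff (\<lambda>z. z i * f z) (Poly_Mapping.single i 1 + m) = poly_coeff f m"
    and "Poly_Mapping.lookup m i = 0 \<Longrightarrow> poly_coeff (\<lambda>z. z i * f z) m = 0"
proof -
  obtain p where p: "eval_poly p = f"
    using assms poly_fun_eval_poly by metis
  let ?x = "Poly_Mapping.single i 1 :: nat \<Rightarrow>\<^sub>0 nat"
  have eq: "(\<lambda>z. z i * f z) = eval_poly (Poly_Mapping.single ?x 1 * p)"
    using p by (auto simp: eval_poly_monom_mult simp del: One_nat_def)
  show "poly_coeff (\<lambda>z. z i * f z) (?x + m) = poly_coeff f m"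
    unfolding eq using p by (simp only: poly_coeff_eval lookup_monom_mult_add) auto
  assume "Poly_Mapping.lookup m i = 0"
  then have "?x + m' \<noteq> m" for m' by (auto simp: lookup_add)
  then show "poly_coeff (\<lambda>z. z i * f z) m = 0"
    unfolding eq by (simp only: poly_coeff_eval lookup_monom_mult) simp
qed

text \<open>
  Translations change a polynomial by terms of lower degree only.
\<close>

lemma poly_coeff_translate:
  assumes "poly_fun n d f" "d \<le> int (monom_degree m)"
  shows "poly_coeff (\<lambda>z. f (\<lambda>i. z i + w i)) m = poly_coeff f m"
proof -
  have 1: "poly_fun n d (\<lambda>z. (- 1) * (f z - f (\<lambda>i. z i - - w i)))"
    by (intro poly_fun_cmult poly_fun_mono[OF poly_fun_difference[OF assms(1)]]) simp
  have "poly_coeff (\<lambda>z. (- 1) * (f z - f (\<lambda>i. z i - - w i))) m = 0"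
    by (rule poly_coeff_high_degree[OF poly_fun_cmult[OF poly_fun_difference[OF assms(1)]]])
      (use assms(2) in simp)
  with poly_coeff_add[OF assms(1) 1, of m] show ?thesis by simp
qed

lemma eval_permute_vars:
  assumes "bij \<pi>"
  shows "eval_poly (permute_vars \<pi> p) z = eval_poly p (z \<circ> \<pi>)"
proof -
  let ?M = "Poly_Mapping.map_key \<pi> :: (nat \<Rightarrow>\<^sub>0 nat) \<Rightarrow> _"
  have \<pi>: "inj \<pi>" "surj \<pi>" using assms by (simp_all add: bij_def)
  have monom_eval: "monom_eval z m = monom_eval (z \<circ> \<pi>) (?M m)" for m
  proof -
    have "monom_eval (z \<circ> \<pi>) (?M m) =
      (\<Prod>i\<in>\<pi> -` Poly_Mapping.keys m. z (\<pi> i) ^ Poly_Mapping.lookup m (\<pi> i))"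
      using \<pi> by (simp add: monom_eval_def keys_map_key map_key.rep_eq)
    also have "\<dots> = monom_eval z m"
      unfolding monom_eval_def
      by (rule prod.reindex_bij_witness[where i = "inv \<pi>" and j = \<pi>])
        (use \<pi> in \<open>auto simp: surj_f_inv_f\<close>)
    finally show ?thesis by simp
  qed
  have surj: "?M (Poly_Mapping.map_key (inv \<pi>) m) = m" for m
    using \<pi> assms
    by (intro poly_mapping_eqI) (simp add: map_key.rep_eq surj_imp_inj_inv)
  have inj: "inj ?M" by (rule inj_map_key[OF assms])
  have "eval_poly (permute_vars \<pi> p) z =
    (\<Sum>m\<in>?M -` Poly_Mapping.keys p. Poly_Mapping.lookup p (?M m) * monom_eval (z \<circ> \<pi>) (?M m))"
    unfolding eval_poly_def monom_eval_def[symmetric]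
    using inj by (simp add: permute_vars_def keys_map_key map_key.rep_eq monom_eval)
  also have "\<dots> = eval_poly p (z \<circ> \<pi>)"
    unfolding eval_poly_def monom_eval_def[symmetric]
    by (rule sum.reindex_bij_witness[where i = "Poly_Mapping.map_key (inv \<pi>)" and j = ?M])
      (use surj surj[THEN injD[OF inj]] in \<open>simp_all add: o_def\<close>)
  finally show ?thesis .
qed

text \<open>
  A permutation of \<open>{1..m}\<close> that preserves parity becomes one of \<open>{1..m-1}\<close> after a
  transposition of two indices of equal parity.
\<close>

lemma semisym_permute:
  assumes f: "semisym n d f" and \<pi>: "\<pi> \<in> parity_perms n"
  shows "f (z \<circ> \<pi>) = f z"
proof -
  have "f (z \<circ> \<pi>) = f z" if "m \<le> n" "\<pi> permutes {1..m}" "\<forall>i \<in> {1..m}. even (\<pi> i + i)" for m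
    using that
  proof (induction m arbitrary: \<pi> z)
    case (Suc m)
    define b where "b = \<pi> (Suc m)"
    define \<sigma> where "\<sigma> = transpose (Suc m) b \<circ> \<pi>"
    have b: "b \<in> {1..Suc m}" "even (b + Suc m)"
      using Suc.prems permutes_in_image[OF Suc.prems(2)] by (auto simp: b_def)
    have "{1..Suc m} = insert (Suc m) {1..m}" by auto
    with Suc.prems(2) have \<sigma>: "\<sigma> permutes {1..m}"
      unfolding \<sigma>_def b_def by (metis permutes_insert_lemma)
    have par: "even (\<sigma> i + i)" if "i \<in> {1..m}" for i
    proof -
      have "even (\<pi> i + i)" using Suc.prems(3) that by auto
      then show ?thesis
        using b(2) unfolding \<sigma>_def o_def transpose_def by presburger
    qed
    have "\<pi> = transpose (Suc m) b \<circ> \<sigma>" by (simp add: \<sigma>_def o_assoc[symmetric] fun_eq_iff)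
    then have "f (z \<circ> \<pi>) = f ((z \<circ> transpose (Suc m) b) \<circ> \<sigma>)" by (simp add: o_assoc)
    also have "\<dots> = f (z \<circ> transpose (Suc m) b)"
      using Suc.prems(1) \<sigma> par by (intro Suc.IH) auto
    also have "\<dots> = f z"
      using Suc.prems(1) b by (intro semisym_swap[OF f]) auto
    finally show ?case .
  qed simp
  moreover have "even (\<pi> i + i)" if "i \<in> {1..n}" for i
  proof -
    have "\<pi> i mod 2 = i mod 2" using \<pi> that by (simp add: parity_perms_def)
    then show ?thesis by presburger
  qed
  ultimately show ?thesis using \<pi> by (auto simp: parity_perms_def)
qed

lemma W_invariants_semisym:
  assumes "p \<in> W_invariants n" "int (total_degree p) \<le> d"
  shows "semisym n d (eval_poly p)"
proof (rule semisymI)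
  show "poly_fun n d (eval_poly p)"
    using assms by (intro eval_poly_poly_fun) (simp_all add: W_invariants_def)
  fix a b and z :: "nat \<Rightarrow> 'a"
  assume ab: "a \<in> {1..n}" "b \<in> {1..n}" "even (a + b)"
  have "transpose a b i mod 2 = i mod 2" for i
    using ab(3) unfolding transpose_def by presburger
  then have "transpose a b \<in> parity_perms n"
    unfolding parity_perms_def using ab by (simp add: permutes_swap_id)
  then have "permute_vars (transpose a b) p = p" using assms by (simp add: W_invariants_def)
  then show "eval_poly p (z \<circ> transpose a b) = eval_poly p z"
    using eval_permute_vars[of "transpose a b" p z] by simp
qed

lemma semisym_W_invariants:
  assumes "semisym n d f" "p \<in> polys n" "eval_poly p = f"
  shows "p \<in> W_invariants n"
  unfolding W_invariants_def
proof (intro CollectI conjI ballI assms)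
  fix \<pi> assume \<pi>: "\<pi> \<in> parity_perms n"
  then have "bij \<pi>" by (auto simp: parity_perms_def dest: permutes_bij)
  then show "permute_vars \<pi> p = p"
    using semisym_permute[OF assms(1) \<pi>] assms(3)
    by (intro eval_poly_inject) (simp add: eval_permute_vars)
qed


section \<open>A difference operator and its alternating numerator\<close>

text \<open>
  The product of the commuting factors \<open>A\<^sub>i - B\<^sub>i T\<^sub>i\<close>, \<open>i \<in> S\<close>, applied to \<open>f\<close>, where \<open>T\<^sub>i\<close> is
  the translation by \<open>- v\<^sub>i\<close> and all translations act on \<open>f\<close> alone and not on the coefficients.
\<close>

definition normal_ordered :: "nat set \<Rightarrow> (nat \<Rightarrow> (nat \<Rightarrow> 'k) \<Rightarrow> 'k) \<Rightarrow> (nat \<Rightarrow> (nat \<Rightarrow> 'k) \<Rightarrow> 'k) \<Rightarrow>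
    (nat \<Rightarrow> nat \<Rightarrow> 'k) \<Rightarrow> ((nat \<Rightarrow> 'k) \<Rightarrow> 'k) \<Rightarrow> (nat \<Rightarrow> 'k) \<Rightarrow> 'k::field_char_0" where
  "normal_ordered S A B v f z = (\<Sum>I\<in>Pow S. (\<Prod>i\<in>S - I. A i z) * (\<Prod>i\<in>I. - B i z) *
     f (\<lambda>k. z k - (\<Sum>i\<in>I. v i k)))"

lemma normal_ordered_insert:
  assumes "finite S" "a \<notin> S"
  shows "normal_ordered (insert a S) A B v f z =
    A a z * normal_ordered S A B v f z - B a z * normal_ordered S A B v (\<lambda>w. f (\<lambda>k. w k - v a k)) z"
proof -
  let ?T = "\<lambda>I. (\<Prod>i\<in>insert a S - I. A i z) * (\<Prod>i\<in>I. - B i z) *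
     f (\<lambda>k. z k - (\<Sum>i\<in>I. v i k))"
  have fin: "finite I" if "I \<in> Pow S" for I using that assms(1) by (auto intro: finite_subset)
  have "normal_ordered (insert a S) A B v f z = (\<Sum>I\<in>Pow S. ?T I) + (\<Sum>I\<in>insert a ` Pow S. ?T I)"
    unfolding normal_ordered_def Pow_insert using assms by (intro sum.union_disjoint) auto
  also have "(\<Sum>I\<in>Pow S. ?T I) = A a z * normal_ordered S A B v f z"
    unfolding normal_ordered_def sum_distrib_left
  proof (rule sum.cong)
    fix I assume I: "I \<in> Pow S"
    then have "insert a S - I = insert a (S - I)" using assms by auto
    then show "?T I = A a z * ((\<Prod>i\<in>S - I. A i z) * (\<Prod>i\<in>I. - B i z) *
      f (\<lambda>k. z k - (\<Sum>i\<in>I. v i k)))" using assms by (simp add: mult_ac)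
  qed simp
  also have "(\<Sum>I\<in>insert a ` Pow S. ?T I) = (\<Sum>I\<in>Pow S. ?T (insert a I))"
    using assms(2) by (intro sum.reindex[unfolded o_def]) (auto simp: inj_on_def)
  also have "\<dots> = - (B a z * normal_ordered S A B v (\<lambda>w. f (\<lambda>k. w k - v a k)) z)"
    unfolding normal_ordered_def sum_distrib_left sum_negf[symmetric]
  proof (rule sum.cong)
    fix I assume I: "I \<in> Pow S"
    then have "insert a S - insert a I = S - I" "a \<notin> I" using assms by auto
    then show "?T (insert a I) = - (B a z * ((\<Prod>i\<in>S - I. A i z) * (\<Prod>i\<in>I. - B i z) *
      f (\<lambda>k. z k - (\<Sum>i\<in>I. v i k) - v a k)))" using fin[OF I] by (simp add: algebra_simps)
  qed simp
  finally show ?thesis by simp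
qed

lemma normal_ordered_diff:
  "normal_ordered S A B v (\<lambda>z. f z - g z) z = normal_ordered S A B v f z - normal_ordered S A B v g z"
  by (simp add: normal_ordered_def right_diff_distrib sum_subtractf)

text \<open>
  Each factor is \<open>(A\<^sub>i - B\<^sub>i) + B\<^sub>i (1 - T\<^sub>i)\<close>. In the first summand the leading terms of the
  coefficients have cancelled, and in the second one the difference lowers the degree of \<open>f\<close>, so
  either way one degree is gained over \<open>B\<^sub>i\<close>.
\<close>

lemma poly_fun_normal_ordered:
  assumes "finite S"
    and "\<And>i. i \<in> S \<Longrightarrow> poly_fun n (e i + 1) (B i)"
    and "\<And>i. i \<in> S \<Longrightarrow> poly_fun n (e i) (\<lambda>z. A i z - B i z)"
    and "poly_fun n d f"
  shows "poly_fun n (d + (\<Sum>i\<in>S. e i)) (normal_ordered S A B v f)"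
  using assms
proof (induction S arbitrary: f d rule: finite_induct)
  case empty
  then show ?case by (simp add: normal_ordered_def[abs_def])
next
  case (insert a S)
  let ?f = "\<lambda>w. f (\<lambda>k. w k - v a k)"
  have 1: "poly_fun n (d + (\<Sum>i\<in>S. e i)) (normal_ordered S A B v f)"
    using insert by simp
  have 2: "poly_fun n (d - 1 + (\<Sum>i\<in>S. e i)) (normal_ordered S A B v (\<lambda>z. f z - ?f z))"
    using insert.prems by (intro insert.IH poly_fun_difference) simp_all
  have A: "poly_fun n (e a) (\<lambda>z. A a z - B a z)" and B: "poly_fun n (e a + 1) (B a)"
    using insert.prems by simp_all
  have "poly_fun n (d + (\<Sum>i\<in>insert a S. e i))
    (\<lambda>z. (A a z - B a z) * normal_ordered S A B v f z + B a z * normal_ordered S A B v (\<lambda>z. f z - ?f z) z)"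
    using poly_fun_mult[OF A 1] poly_fun_mult[OF B 2] insert.hyps
    by (intro poly_fun.add) (simp_all add: algebra_simps)
  also have "(\<lambda>z. (A a z - B a z) * normal_ordered S A B v f z + B a z * normal_ordered S A B v (\<lambda>z. f z - ?f z) z) =
    normal_ordered (insert a S) A B v f"
    using insert.hyps by (simp add: fun_eq_iff normal_ordered_insert normal_ordered_diff algebra_simps)
  finally show ?case .
qed

lemma normal_ordered_cong:
  assumes "\<And>i. i \<in> S \<Longrightarrow> A i z = A' i z'" "\<And>i. i \<in> S \<Longrightarrow> B i z = B' i z'"
    and "\<And>I. I \<subseteq> S \<Longrightarrow> f (\<lambda>k. z k - (\<Sum>i\<in>I. v i k)) = f' (\<lambda>k. z' k - (\<Sum>i\<in>I. v' i k))"
  shows "normal_ordered S A B v f z = normal_ordered S A' B' v' f' z'"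
  unfolding normal_ordered_def
proof (rule sum.cong)
  fix I assume I: "I \<in> Pow S"
  then have "(\<Prod>i\<in>S - I. A i z) = (\<Prod>i\<in>S - I. A' i z')" "(\<Prod>i\<in>I. - B i z) = (\<Prod>i\<in>I. - B' i z')"
    using assms(1,2) by (auto intro!: prod.cong)
  with assms(3)[of I] I show "(\<Prod>i\<in>S - I. A i z) * (\<Prod>i\<in>I. - B i z) *
     f (\<lambda>k. z k - (\<Sum>i\<in>I. v i k)) = (\<Prod>i\<in>S - I. A' i z') * (\<Prod>i\<in>I. - B' i z') *
     f' (\<lambda>k. z' k - (\<Sum>i\<in>I. v' i k))" by simp
qed simp

lemma normal_ordered_cong':
  assumes "\<And>i. i \<in> S \<Longrightarrow> A i z = A' i z" "\<And>i. i \<in> S \<Longrightarrow> B i z = B' i z"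
    and "\<And>i. i \<in> S \<Longrightarrow> v i = v' i"
  shows "normal_ordered S A B v f z = normal_ordered S A' B' v' f z"
proof (rule normal_ordered_cong)
  fix I assume "I \<subseteq> S"
  then have "(\<Sum>i\<in>I. v i k) = (\<Sum>i\<in>I. v' i k)" for k
    using assms(3) by (intro sum.cong) auto
  then show "f (\<lambda>k. z k - (\<Sum>i\<in>I. v i k)) = f (\<lambda>k. z k - (\<Sum>i\<in>I. v' i k))" by simp
qed (use assms(1,2) in auto)

lemma normal_ordered_reindex:
  assumes "\<tau> permutes S"
  shows "normal_ordered S (\<lambda>i. A (\<tau> i)) (\<lambda>i. B (\<tau> i)) (\<lambda>i. v (\<tau> i)) f z = normal_ordered S A B v f z"
  unfolding normal_ordered_def
proof (rule sum.reindex_bij_witness[where j = "image \<tau>" and i = "image (inv \<tau>)"])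
  have inj: "inj_on \<tau> T" for T by (rule permutes_inj_on[OF assms])
  fix I assume I: "I \<in> Pow S"
  show "inv \<tau> ` \<tau> ` I = I"
    by (simp add: image_image permutes_inverses(2)[OF assms])
  show "\<tau> ` I \<in> Pow S" using I permutes_image[OF assms] by auto
  have "S - \<tau> ` I = \<tau> ` (S - I)"
    using permutes_image[OF assms] inj[of UNIV] by (simp add: image_set_diff)
  then show "(\<Prod>i\<in>S - \<tau> ` I. A i z) * (\<Prod>i\<in>\<tau> ` I. - B i z) *
     f (\<lambda>k. z k - (\<Sum>i\<in>\<tau> ` I. v i k)) = (\<Prod>i\<in>S - I. A (\<tau> i) z) * (\<Prod>i\<in>I. - B (\<tau> i) z) *
     f (\<lambda>k. z k - (\<Sum>i\<in>I. v (\<tau> i) k))"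
    by (simp add: prod.reindex[OF inj] sum.reindex[OF inj])
next
  fix I assume I: "I \<in> Pow S"
  show "\<tau> ` inv \<tau> ` I = I"
    by (simp add: image_image permutes_inverses(1)[OF assms])
  show "inv \<tau> ` I \<in> Pow S" using I permutes_image[OF permutes_inv[OF assms]] by auto
qed

text \<open>
  For \<open>j = 0\<close>, which is not in \<open>yset n\<close>, no factor is omitted. This is the entry in the additional
  column that is needed when \<open>n\<close> is odd and \<open>xset n\<close> has one element more than \<open>yset n\<close>.
\<close>

definition lagrange_prod :: "nat \<Rightarrow> 'k \<Rightarrow> nat \<Rightarrow> nat \<Rightarrow> (nat \<Rightarrow> 'k) \<Rightarrow> 'k::field_char_0" where
  "lagrange_prod n s i j z = (\<Prod>j'\<in>yset n - {j}. z i - z j' + s)"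

lemma poly_fun_lagrange_prod:
  assumes "i \<in> xset n"
  shows "poly_fun n (int (card (yset n - {j}))) (lagrange_prod n s i j)"
proof -
  have "poly_fun n 1 (\<lambda>z. z i - z j' + s)" if "j' \<in> yset n" for j'
    using that assms
    by (intro poly_fun.add[OF poly_fun_diff[OF poly_fun_var poly_fun_var] poly_fun.const])
      (auto simp: xset_def yset_def)
  then have "poly_fun n (\<Sum>j'\<in>yset n - {j}. 1) (\<lambda>z. \<Prod>j'\<in>yset n - {j}. z i - z j' + s)"
    by (intro poly_fun_prod) auto
  then show ?thesis by (simp add: lagrange_prod_def[abs_def])
qed

text \<open>
  The two products differ by a translation of the variable \<open>z\<^sub>i\<close>.
\<close>

lemma poly_fun_lagrange_prod_diff:
  assumes "i \<in> xset n"
  shows "poly_fun n (int (card (yset n - {j})) - 1) (\<lambda>z. lagrange_prod n r i j z - lagrange_prod n (- r) i j z)"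
proof -
  have "lagrange_prod n (- r) i j z = lagrange_prod n r i j (\<lambda>k. z k - (if k = i then 2 * r else 0))" for z
    unfolding lagrange_prod_def using assms by (intro prod.cong) (auto simp: xset_def yset_def)
  then show ?thesis
    using poly_fun_difference[OF poly_fun_lagrange_prod[OF assms, of j r], of "\<lambda>k. if k = i then 2 * r else 0"]
    by simp
qed

definition shift_vec :: "nat \<Rightarrow> nat \<Rightarrow> nat \<Rightarrow> 'k::field_char_0" where
  "shift_vec i j k = (if k = i \<or> k = j then 1 else 0)"

text \<open>
  The determinant with rows \<open>i\<close> and columns \<open>\<pi> i\<close> in \<open>xset n\<close>, where the column \<open>k\<close> stands for
  the index \<open>k - 1\<close>. The predecessor maps \<open>xset n\<close> onto \<open>yset n\<close>, together with \<open>0\<close> if \<open>n\<close>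
  is odd; the coordinate \<open>0\<close> has no influence on polynomials in \<open>z\<^sub>1, \<dots>, z\<^sub>n\<close>. The functions
  \<open>a\<close> and \<open>b\<close> are \<open>x + \<alpha>\<close> and \<open>x\<close> for the difference operator; with \<open>1\<close> and \<open>0\<close> one
  obtains the determinant of the products.
\<close>

definition numerator_op :: "nat \<Rightarrow> 'k::field_char_0 \<Rightarrow> ('k \<Rightarrow> 'k) \<Rightarrow> ('k \<Rightarrow> 'k) \<Rightarrow> ((nat \<Rightarrow> 'k) \<Rightarrow> 'k) \<Rightarrow> (nat \<Rightarrow> 'k) \<Rightarrow> 'k" where
  "numerator_op n r a b f z = (\<Sum>\<pi> | \<pi> permutes xset n. of_int (sign \<pi>) *
     normal_ordered (xset n) (\<lambda>i z. a (z i) * lagrange_prod n r i (\<pi> i - 1) z)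
       (\<lambda>i z. b (z i) * lagrange_prod n (- r) i (\<pi> i - 1) z) (\<lambda>i. shift_vec i (\<pi> i - 1)) f z)"

definition pairs :: "nat \<Rightarrow> (nat \<times> nat) set" where
  "pairs n = {(a, b). 1 \<le> b \<and> b < a \<and> a \<le> n \<and> even (a + b)}"

lemma finite_pairs [simp]: "finite (pairs n)"
  by (rule finite_subset[of _ "{..n} \<times> {..n}"]) (auto simp: pairs_def)

text \<open>
  An ordered pair \<open>(i - 1, j)\<close> with \<open>j < i - 1\<close> is a pair of indices in \<open>yset n\<close>, and one with
  \<open>i - 1 < j\<close> gives the pair \<open>(i, j + 1)\<close> in \<open>xset n\<close>. Thus the degree of each product of
  entries is that of the Vandermonde product over both classes.
\<close>

lemma card_pairs: "(\<Sum>i\<in>xset n. card (yset n - {i - 1})) = card (pairs n)"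
proof -
  have "bij_betw (\<lambda>(i, j). if j < i - 1 then (i - 1, j) else (j + 1, i))
    (SIGMA i:xset n. yset n - {i - 1}) (pairs n)"
  proof (rule bij_betw_byWitness[where
        f' = "\<lambda>(a, b). if odd (n - a) then (a + 1, b) else (b, a - 1)"])
    show "\<forall>x\<in>SIGMA i:xset n. yset n - {i - 1}.
      (case (case x of (i, j) \<Rightarrow> if j < i - 1 then (i - 1, j) else (j + 1, i)) of
        (a, b) \<Rightarrow> if odd (n - a) then (a + 1, b) else (b, a - 1)) = x"
      by (auto simp: xset_def yset_def split: if_splits)
    show "\<forall>x\<in>pairs n. (case (case x of (a, b) \<Rightarrow>
        if odd (n - a) then (a + 1, b) else (b, a - 1)) of
        (i, j) \<Rightarrow> if j < i - 1 then (i - 1, j) else (j + 1, i)) = x"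
      by (auto simp: pairs_def)
    show "(\<lambda>(i, j). if j < i - 1 then (i - 1, j) else (j + 1, i)) `
      (SIGMA i:xset n. yset n - {i - 1}) \<subseteq> pairs n"
    proof
      fix x assume "x \<in> (\<lambda>(i, j). if j < i - 1 then (i - 1, j) else (j + 1, i)) `
        (SIGMA i:xset n. yset n - {i - 1})"
      then obtain i j where x: "x = (if j < i - 1 then (i - 1, j) else (j + 1, i))"
        "1 \<le> i" "i \<le> n" "even (n - i)" "1 \<le> j" "j \<le> n" "odd (n - j)" "j \<noteq> i - 1"
        by (auto simp: xset_def yset_def)
      show "x \<in> pairs n"
      proof (cases "j < i - 1")
        case True
        then have "even (i - 1 + j)" using x by presburger
        with True x show ?thesis by (simp add: pairs_def)
      next
        case False
        then have "even (j + 1 + i)" "i < j + 1" "j + 1 \<le> n" using x by presburger+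
        with False x show ?thesis by (simp add: pairs_def)
      qed
    qed
    show "(\<lambda>(a, b). if odd (n - a) then (a + 1, b) else (b, a - 1)) ` pairs n \<subseteq>
      (SIGMA i:xset n. yset n - {i - 1})"
    proof
      fix x assume "x \<in> (\<lambda>(a, b). if odd (n - a) then (a + 1, b) else (b, a - 1)) ` pairs n"
      then obtain p where p: "p \<in> pairs n"
        "x = (\<lambda>(a, b). if odd (n - a) then (a + 1, b) else (b, a - 1)) p" by (rule imageE)
      obtain a b where "p = (a, b)" by (cases p)
      with p have x: "x = (if odd (n - a) then (a + 1, b) else (b, a - 1))"
        "1 \<le> b" "b < a" "a \<le> n" "even (a + b)" by (simp_all add: pairs_def)
      show "x \<in> (SIGMA i:xset n. yset n - {i - 1})"
      proof (cases "odd (n - a)")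
        case True
        then have "even (n - (a + 1))" "a + 1 \<le> n" "odd (n - b)" using x by presburger+
        with True x show ?thesis by (simp add: xset_def yset_def)
      next
        case False
        then have "even (n - b)" "odd (n - (a - 1))" "a - 1 \<noteq> b - 1" "1 \<le> a - 1" "a - 1 \<le> n"
          using x by presburger+
        with False x show ?thesis by (simp add: xset_def yset_def)
      qed
    qed
  qed
  from bij_betw_same_card[OF this] show ?thesis by simp
qed

lemma card_pairs_permuted:
  assumes "\<pi> permutes xset n"
  shows "(\<Sum>i\<in>xset n. int (card (yset n - {\<pi> i - 1}))) = int (card (pairs n))"
  using sum.permute[OF assms, of "\<lambda>i. card (yset n - {i - 1})"] card_pairs[of n]
  by (simp add: o_def flip: of_nat_sum)

lemma poly_fun_numerator_op:
  assumes "poly_fun n d f"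
  shows "poly_fun n (d + int (card (pairs n))) (numerator_op n r (\<lambda>x. x + t) (\<lambda>x. x) f)"
  unfolding numerator_op_def[abs_def]
proof (rule poly_fun_sum, rule poly_fun_cmult)
  fix \<pi> assume "\<pi> \<in> {\<pi>. \<pi> permutes xset n}"
  then have \<pi>: "\<pi> permutes xset n" by simp
  let ?e = "\<lambda>i. int (card (yset n - {\<pi> i - 1}))"
  have X: "i \<in> {1..n}" if "i \<in> xset n" for i using that by (simp add: xset_def)
  have "poly_fun n (d + (\<Sum>i\<in>xset n. ?e i))
    (normal_ordered (xset n) (\<lambda>i z. (z i + t) * lagrange_prod n r i (\<pi> i - 1) z)
     (\<lambda>i z. z i * lagrange_prod n (- r) i (\<pi> i - 1) z) (\<lambda>i. shift_vec i (\<pi> i - 1)) f)"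
  proof (rule poly_fun_normal_ordered[OF finite_xset _ _ assms])
    fix i assume i: "i \<in> xset n"
    show "poly_fun n (?e i + 1) (\<lambda>z. z i * lagrange_prod n (- r) i (\<pi> i - 1) z)"
      by (rule poly_fun.var_mult[OF poly_fun_lagrange_prod[OF i] X[OF i]])
    have "poly_fun n (?e i) (\<lambda>z. z i * (lagrange_prod n r i (\<pi> i - 1) z - lagrange_prod n (- r) i (\<pi> i - 1) z))"
      using poly_fun.var_mult[OF poly_fun_lagrange_prod_diff[OF i] X[OF i], of "\<pi> i - 1" r] by simp
    from poly_fun.add[OF this poly_fun_cmult[OF poly_fun_lagrange_prod[OF i, of "\<pi> i - 1" r], of t]]
    show "poly_fun n (?e i) (\<lambda>z. (z i + t) * lagrange_prod n r i (\<pi> i - 1) z -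
      z i * lagrange_prod n (- r) i (\<pi> i - 1) z)" by (simp add: algebra_simps)
  qed
  then show "poly_fun n (d + int (card (pairs n)))
    (normal_ordered (xset n) (\<lambda>i z. (z i + t) * lagrange_prod n r i (\<pi> i - 1) z)
     (\<lambda>i z. z i * lagrange_prod n (- r) i (\<pi> i - 1) z) (\<lambda>i. shift_vec i (\<pi> i - 1)) f)"
    by (simp only: card_pairs_permuted[OF \<pi>])
qed

lemma lagrange_prod_swap:
  assumes ab: "a \<in> {1..n}" "b \<in> {1..n}" "even (a + b)"
  shows "lagrange_prod n s i j (z \<circ> transpose a b) = lagrange_prod n s (transpose a b i) (transpose a b j) z"
proof -
  let ?t = "transpose a b"
  have Y: "?t k \<in> yset n" if "k \<in> yset n" for k
    using that ab unfolding yset_def mem_Collect_eq atLeastAtMost_iff transpose_def by presburger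
  show ?thesis
    unfolding lagrange_prod_def o_def
    by (rule prod.reindex_bij_witness[where i = ?t and j = ?t]) (use Y in \<open>auto simp: inj_eq[OF inj_transpose]\<close>)
qed

lemma normal_ordered_swap:
  assumes ab: "a \<in> {1..n}" "b \<in> {1..n}" "even (a + b)"
    and f: "\<And>z. f (z \<circ> transpose a b) = f z"
  shows "normal_ordered (xset n) (\<lambda>i z. c (z i) * lagrange_prod n r i (\<sigma> i) z) (\<lambda>i z. d (z i) * lagrange_prod n s i (\<sigma> i) z)
      (\<lambda>i. shift_vec i (\<sigma> i)) f (z \<circ> transpose a b) =
    normal_ordered (xset n) (\<lambda>i z. c (z (transpose a b i)) * lagrange_prod n r (transpose a b i) (transpose a b (\<sigma> i)) z)
      (\<lambda>i z. d (z (transpose a b i)) * lagrange_prod n s (transpose a b i) (transpose a b (\<sigma> i)) z)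
      (\<lambda>i. shift_vec (transpose a b i) (transpose a b (\<sigma> i))) f z"
proof (rule normal_ordered_cong)
  let ?t = "transpose a b"
  fix I assume "I \<subseteq> xset n"
  have "(\<lambda>k. (z \<circ> ?t) k - (\<Sum>i\<in>I. shift_vec i (\<sigma> i) k)) =
    (\<lambda>k. z k - (\<Sum>i\<in>I. shift_vec (?t i) (?t (\<sigma> i)) k)) \<circ> ?t"
    by (auto simp: fun_eq_iff shift_vec_def inj_eq[OF inj_transpose] intro!: sum.cong)
  then show "f (\<lambda>k. (z \<circ> ?t) k - (\<Sum>i\<in>I. shift_vec i (\<sigma> i) k)) =
    f (\<lambda>k. z k - (\<Sum>i\<in>I. shift_vec (?t i) (?t (\<sigma> i)) k))" by (simp add: f)
qed (simp_all add: lagrange_prod_swap[OF ab])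

text \<open>
  Swapping two variables of \<open>xset n\<close> swaps two rows, swapping two variables of \<open>yset n\<close> swaps two
  columns.
\<close>

lemma numerator_op_swap:
  assumes ab: "a \<in> {1..n}" "b \<in> {1..n}" "even (a + b)" "a \<noteq> b"
    and f: "\<And>z. f (z \<circ> transpose a b) = f z"
  shows "numerator_op n r c d f (z \<circ> transpose a b) = - numerator_op n r c d f z"
proof -
  let ?t = "transpose a b" and ?X = "xset n"
  define T where "T \<pi> z = normal_ordered ?X (\<lambda>i z. c (z i) * lagrange_prod n r i (\<pi> i - 1) z)
       (\<lambda>i z. d (z i) * lagrange_prod n (- r) i (\<pi> i - 1) z) (\<lambda>i. shift_vec i (\<pi> i - 1)) f z" for \<pi> z
  have N: "numerator_op n r c d f z = (\<Sum>\<pi> | \<pi> permutes ?X. of_int (sign \<pi>) * T \<pi> z)" for z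
    by (simp add: numerator_op_def T_def)
  have T1: "T \<pi> (z \<circ> ?t) = normal_ordered ?X (\<lambda>i z. c (z (?t i)) * lagrange_prod n r (?t i) (?t (\<pi> i - 1)) z)
      (\<lambda>i z. d (z (?t i)) * lagrange_prod n (- r) (?t i) (?t (\<pi> i - 1)) z)
      (\<lambda>i. shift_vec (?t i) (?t (\<pi> i - 1))) f z" for \<pi>
    unfolding T_def by (rule normal_ordered_swap[where f = f, OF ab(1,2,3) f])
  show ?thesis
  proof (cases "a \<in> ?X")
    case True
    then have b: "b \<in> ?X" using ab unfolding xset_def mem_Collect_eq atLeastAtMost_iff by presburger
    have t: "?t permutes ?X" by (rule permutes_swap_id[OF True b])
    have T2: "T \<pi> (z \<circ> ?t) = T (\<pi> \<circ> ?t) z" if \<pi>: "\<pi> permutes ?X" for \<pi>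
    proof -
      have fixt: "?t (\<pi> i - 1) = \<pi> i - 1" if "i \<in> ?X" for i
      proof -
        have "\<pi> i \<in> ?X" using permutes_in_image[OF \<pi>] that by blast
        then have "\<pi> i - 1 \<notin> ?X" by (rule xset_pred)
        then have "\<pi> i - 1 \<noteq> a" "\<pi> i - 1 \<noteq> b" using True b by auto
        then show ?thesis by simp
      qed
      have "T \<pi> (z \<circ> ?t) = normal_ordered ?X
        (\<lambda>i z. c (z (?t i)) * lagrange_prod n r (?t i) ((\<pi> \<circ> ?t) (?t i) - 1) z)
        (\<lambda>i z. d (z (?t i)) * lagrange_prod n (- r) (?t i) ((\<pi> \<circ> ?t) (?t i) - 1) z)
        (\<lambda>i. shift_vec (?t i) ((\<pi> \<circ> ?t) (?t i) - 1)) f z"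
        unfolding T1
        by (rule normal_ordered_cong') (simp_all only: fixt o_apply transpose_involutory)
      also have "\<dots> = T (\<pi> \<circ> ?t) z"
        unfolding T_def
        by (rule normal_ordered_reindex[OF t, of "\<lambda>i z. c (z i) * lagrange_prod n r i ((\<pi> \<circ> ?t) i - 1) z"])
      finally show ?thesis .
    qed
    have "numerator_op n r c d f (z \<circ> ?t) =
      (\<Sum>\<pi> | \<pi> permutes ?X. - (of_int (sign (\<pi> \<circ> ?t)) * T (\<pi> \<circ> ?t) z))"
      unfolding N
    proof (rule sum.cong)
      fix \<pi> assume "\<pi> \<in> {\<pi>. \<pi> permutes ?X}"
      then have \<pi>: "\<pi> permutes ?X" by simp
      have "sign (\<pi> \<circ> ?t) = - sign \<pi>"
        using ab(4) permutes_imp_permutation[OF finite_xset \<pi>]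
        by (simp add: sign_compose permutation_swap_id sign_swap_id)
      then show "of_int (sign \<pi>) * T \<pi> (z \<circ> ?t) = - (of_int (sign (\<pi> \<circ> ?t)) * T (\<pi> \<circ> ?t) z)"
        by (simp add: T2[OF \<pi>])
    qed simp
    also have "\<dots> = - numerator_op n r c d f z"
      unfolding N sum_negf by (subst (2) sum_permutations_compose_right[OF t]) simp
    finally show ?thesis .
  next
    case False
    then have ab': "a + 1 \<in> ?X" "b + 1 \<in> ?X"
      using ab unfolding xset_def mem_Collect_eq atLeastAtMost_iff by presburger+
    have b: "b \<notin> ?X" using False ab unfolding xset_def mem_Collect_eq atLeastAtMost_iff by presburger
    let ?s = "transpose (a + 1) (b + 1)"
    have s: "?s permutes ?X" by (rule permutes_swap_id[OF ab'])
    have T2: "T \<pi> (z \<circ> ?t) = T (?s \<circ> \<pi>) z" if \<pi>: "\<pi> permutes ?X" for \<pi>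
    proof -
      have fixt: "?t i = i" if "i \<in> ?X" for i
        using that False b by (auto simp: transpose_def)
      have fixt2: "?t (\<pi> i - 1) = (?s \<circ> \<pi>) i - 1" if "i \<in> ?X" for i
      proof -
        have "\<pi> i \<in> ?X" using permutes_in_image[OF \<pi>] that by blast
        then have "1 \<le> \<pi> i" by (simp add: xset_def)
        then show ?thesis by (auto simp: transpose_def)
      qed
      show ?thesis
        unfolding T1 unfolding T_def
        by (rule normal_ordered_cong') (simp_all only: fixt fixt2)
    qed
    have "numerator_op n r c d f (z \<circ> ?t) =
      (\<Sum>\<pi> | \<pi> permutes ?X. - (of_int (sign (?s \<circ> \<pi>)) * T (?s \<circ> \<pi>) z))"
      unfolding N
    proof (rule sum.cong)
      fix \<pi> assume "\<pi> \<in> {\<pi>. \<pi> permutes ?X}"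
      then have \<pi>: "\<pi> permutes ?X" by simp
      have "sign (?s \<circ> \<pi>) = - sign \<pi>"
        using ab(4) permutes_imp_permutation[OF finite_xset \<pi>]
        by (simp add: sign_compose permutation_swap_id sign_swap_id)
      then show "of_int (sign \<pi>) * T \<pi> (z \<circ> ?t) = - (of_int (sign (?s \<circ> \<pi>)) * T (?s \<circ> \<pi>) z)"
        by (simp add: T2[OF \<pi>])
    qed simp
    also have "\<dots> = - numerator_op n r c d f z"
      unfolding N sum_negf by (subst (2) setum_permutations_compose_left[OF s]) simp
    finally show ?thesis .
  qed
qed

definition vandermonde :: "nat \<Rightarrow> (nat \<Rightarrow> 'k::field_char_0) \<Rightarrow> 'k" where
  "vandermonde n z = (\<Prod>s\<in>pairs n. diff_form s z)"

lemma diff_form_pairs: "(a, b) \<in> pairs n \<Longrightarrow> diff_form (a, b) z = z a - z b"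
  by (auto simp: pairs_def diff_form_def)

lemma alternating_divide:
  fixes F :: "(nat \<Rightarrow> 'k::field_char_0) \<Rightarrow> 'k"
  assumes F: "poly_fun n d F"
    and alt: "\<And>a b z. a \<in> {1..n} \<Longrightarrow> b \<in> {1..n} \<Longrightarrow> even (a + b) \<Longrightarrow> a \<noteq> b \<Longrightarrow>
      F (z \<circ> transpose a b) = - F z"
  obtains g where "poly_fun n (d - int (card (pairs n))) g" "\<And>z. F z = vandermonde n z * g z"
proof -
  have "F z = 0" if s: "s \<in> pairs n" "diff_form s z = 0" for s z
  proof -
    obtain a b where ab: "s = (a, b)" "1 \<le> b" "b < a" "a \<le> n" "even (a + b)"
      using s by (auto simp: pairs_def)
    have "z a = z b" using s ab diff_form_pairs[of a b n z] by simp
    then have "z \<circ> transpose a b = z" by (auto simp: fun_eq_iff transpose_def)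
    moreover have "F (z \<circ> transpose a b) = - F z" using ab by (intro alt) auto
    ultimately have "F z + F z = 0" by simp
    then show ?thesis by (simp flip: mult_2)
  qed
  moreover have "b < a \<and> a \<le> n" if "(a, b) \<in> pairs n" for a b
    using that by (simp add: pairs_def)
  ultimately show ?thesis
    using poly_fun_divide_diff_forms[OF finite_pairs _ F, of n] that unfolding vandermonde_def by blast
qed

definition lagrange_det :: "nat \<Rightarrow> 'k \<Rightarrow> (nat \<Rightarrow> 'k) \<Rightarrow> 'k::field_char_0" where
  "lagrange_det n s z = (\<Sum>\<pi> | \<pi> permutes xset n. of_int (sign \<pi>) * (\<Prod>i\<in>xset n. lagrange_prod n s i (\<pi> i - 1) z))"

lemma lagrange_det_numerator_op: "lagrange_det n s z = numerator_op n s (\<lambda>x. 1) (\<lambda>x. 0) (\<lambda>z. 1) z"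
proof -
  have "normal_ordered (xset n) (\<lambda>i z. 1 * lagrange_prod n s i (\<pi> i - 1) z) (\<lambda>i z. 0 * lagrange_prod n (- s) i (\<pi> i - 1) z)
     (\<lambda>i. shift_vec i (\<pi> i - 1)) (\<lambda>z. 1) z = (\<Prod>i\<in>xset n. lagrange_prod n s i (\<pi> i - 1) z)" for \<pi>
  proof -
    have "(\<Prod>i\<in>I. - (0 * lagrange_prod n (- s) i (\<pi> i - 1) z)) = 0" if "I \<in> Pow (xset n) - {{}}" for I
      using that by (intro prod_zero) (auto intro: finite_subset[OF _ finite_xset])
    then show ?thesis
      unfolding normal_ordered_def
      by (subst sum.mono_neutral_right[of "Pow (xset n)" "{{}}"]) auto
  qed
  then show ?thesis by (simp add: lagrange_det_def numerator_op_def)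
qed

text \<open>
  For \<open>s = 0\<close> the quotient by the Vandermonde product has degree zero. The parameter \<open>s\<close> is a
  translation of the variables of \<open>yset n\<close>, which leaves all differences within a class unchanged.
\<close>

lemma lagrange_det_eq_vandermonde:
  obtains c :: "'k::field_char_0" where "\<And>s z. lagrange_det n s z = c * vandermonde n z"
proof -
  have "poly_fun n (int (card (pairs n))) (lagrange_det n (0 :: 'k))"
    unfolding lagrange_det_def[abs_def]
  proof (rule poly_fun_sum, rule poly_fun_cmult)
    fix \<pi> assume "\<pi> \<in> {\<pi>. \<pi> permutes xset n}"
    then have \<pi>: "\<pi> permutes xset n" by simp
    show "poly_fun n (int (card (pairs n))) (\<lambda>z. \<Prod>i\<in>xset n. lagrange_prod n (0 :: 'k) i (\<pi> i - 1) z)"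
      unfolding card_pairs_permuted[OF \<pi>, symmetric]
      by (intro poly_fun_prod finite_xset poly_fun_lagrange_prod)
  qed
  then obtain g where g: "poly_fun n 0 g"
    and lag_g: "\<And>z. lagrange_det n (0 :: 'k) z = vandermonde n z * g z"
    using alternating_divide[of n _ "lagrange_det n (0 :: 'k)"] numerator_op_swap[of _ n _ "\<lambda>z. 1"]
    unfolding lagrange_det_numerator_op by (metis diff_self)
  have "lagrange_det n s z = g (\<lambda>i. 0) * vandermonde n z" for s z
  proof -
    \<comment> \<open>translating the variables of \<open>yset n\<close> absorbs \<open>s\<close>\<close>
    let ?z = "\<lambda>k. if k \<in> yset n then z k - s else z k"
    have "lagrange_prod n s i j z = lagrange_prod n 0 i j ?z" if "i \<in> xset n" for i j
      unfolding lagrange_prod_def using that by (intro prod.cong) (auto simp: xset_def yset_def)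
    then have "lagrange_det n s z = lagrange_det n 0 ?z"
      unfolding lagrange_det_def by (intro sum.cong refl arg_cong2[of _ _ _ _ times] prod.cong)
    moreover have "vandermonde n ?z = vandermonde n z"
      unfolding vandermonde_def
    proof (rule prod.cong)
      fix x assume "x \<in> pairs n"
      then obtain a b where ab: "x = (a, b)" "(a, b) \<in> pairs n" by (cases x) auto
      then have "a \<in> yset n \<longleftrightarrow> b \<in> yset n"
        unfolding pairs_def yset_def mem_Collect_eq atLeastAtMost_iff prod.case by presburger
      then show "diff_form x ?z = diff_form x z" using ab(1) by (simp add: diff_form_pairs[OF ab(2)])
    qed simp
    ultimately show ?thesis
      using lag_g[of ?z] poly_fun_degree_0[OF g, of ?z "\<lambda>i. 0"] by simp
  qed
  then show ?thesis by (rule that)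
qed


section \<open>The operator at interpolation points and at the evaluation point\<close>

text \<open>
  The shifts of different rows move disjoint sets of coordinates, so every coordinate is lowered
  by at most one.
\<close>

lemma sum_shift_vec:
  assumes \<pi>: "\<pi> permutes xset n" and I: "I \<subseteq> xset n" and k: "k \<in> {1..n}"
  shows "(\<Sum>i\<in>I. shift_vec i (\<pi> i - 1) k) = of_bool (k \<in> I \<or> Suc k \<in> \<pi> ` I)"
proof -
  have fin: "finite I" using I by (rule finite_subset) simp
  have \<pi>X: "\<pi> i \<in> xset n" if "i \<in> I" for i
    using permutes_in_image[OF \<pi>] I that by blast
  let ?J = "{i \<in> I. k = i \<or> k = \<pi> i - 1}"
  have "(\<Sum>i\<in>I. shift_vec i (\<pi> i - 1) k) = (\<Sum>i\<in>I. of_bool (k = i \<or> k = \<pi> i - 1))"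
    by (intro sum.cong) (auto simp: shift_vec_def)
  also have "\<dots> = of_nat (card ?J)" using fin by (simp add: Int_def)
  also have "card ?J = of_bool (k \<in> I \<or> Suc k \<in> \<pi> ` I)"
  proof (cases "k \<in> xset n")
    case True
    have ne: "k \<noteq> \<pi> i - 1" "\<pi> i \<noteq> Suc k" if "i \<in> I" for i
      using \<pi>X[OF that] True unfolding xset_def mem_Collect_eq atLeastAtMost_iff by presburger+
    then have "?J = {i \<in> I. k = i}" "Suc k \<notin> \<pi> ` I" by (blast, metis imageE)
    moreover have "{i \<in> I. k = i} = (if k \<in> I then {k} else {})" by auto
    ultimately show ?thesis by simp
  next
    case False
    then have kI: "k \<notin> I" using I by auto
    have J: "?J = {i \<in> I. \<pi> i = Suc k}"
    proof -
      have "k = i \<or> k = \<pi> i - 1 \<longleftrightarrow> \<pi> i = Suc k" if "i \<in> I" for i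
      proof -
        have "1 \<le> \<pi> i" using \<pi>X[OF that] by (simp add: xset_def)
        moreover have "k \<noteq> i" using that kI by blast
        ultimately show ?thesis by linarith
      qed
      then show ?thesis by auto
    qed
    show ?thesis
    proof (cases "Suc k \<in> \<pi> ` I")
      case True
      then obtain i where i: "i \<in> I" "\<pi> i = Suc k" by auto
      have "?J = {i}"
        unfolding J i(2)[symmetric] using i(1) by (auto simp: inj_eq[OF permutes_inj[OF \<pi>]])
      then show ?thesis using True by simp
    next
      case False
      then have "?J = {}" unfolding J by force
      then show ?thesis using False kI by (simp only: card.empty) simp
    qed
  qed
  finally show ?thesis by (simp only: of_nat_of_bool)
qed

lemma lagrange_prod_eq_0: "j' \<in> yset n \<Longrightarrow> j' \<noteq> j \<Longrightarrow> z i - z j' + s = 0 \<Longrightarrow> lagrange_prod n s i j z = 0"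
  unfolding lagrange_prod_def by (rule prod_zero) auto

text \<open>
  At \<open>\<rho> + \<mu>\<close> the coordinates \<open>k\<close> and \<open>k + 1\<close> differ by \<open>r\<close> exactly if \<open>\<mu>\<^sub>k = \<mu>\<^bsub>k+1\<^esub>\<close>. If a term
  lowers \<open>\<mu>\<^sub>k\<close> but not \<open>\<mu>\<^bsub>k+1\<^esub>\<close> in such a case, then one of its entries contains the vanishing
  factor \<open>z\<^sub>k - z\<^bsub>k+1\<^esub> - r\<close>, up to sign; it is not the omitted factor, for otherwise the two
  coordinates would be moved together. If \<open>\<mu>\<^sub>n = 0\<close> is lowered, the factor \<open>z\<^sub>n\<close> vanishes. Hence the shifts with
  nonzero coefficient do not leave \<open>\<Lambda>\<close>.
\<close>

lemma surviving_shift: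
  assumes \<pi>: "\<pi> permutes xset n" and I: "I \<subseteq> xset n" and \<mu>: "\<mu> \<in> Lambda n"
    and A: "\<And>i. i \<in> xset n - I \<Longrightarrow> lagrange_prod n r i (\<pi> i - 1) (interp_point n r \<mu>) \<noteq> 0"
    and B: "\<And>i. i \<in> I \<Longrightarrow> interp_point n r \<mu> i * lagrange_prod n (- r) i (\<pi> i - 1) (interp_point n r \<mu>) \<noteq> 0"
  obtains \<nu> where "\<nu> \<in> Lambda n" "I \<noteq> {} \<Longrightarrow> odd_size n \<nu> < odd_size n \<mu>"
    "\<And>k. k \<in> {1..n} \<Longrightarrow> interp_point n r \<mu> k - (\<Sum>i\<in>I. shift_vec i (\<pi> i - 1) k) = interp_point n r \<nu> k"
proof -
  let ?z = "interp_point n r \<mu>"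
  \<comment> \<open>the coordinates that are lowered\<close>
  define E where "E = {k \<in> {1..n}. k \<in> I \<or> Suc k \<in> \<pi> ` I}"
  have \<pi>X: "\<pi> i \<in> xset n \<longleftrightarrow> i \<in> xset n" for i
    by (rule permutes_in_image[OF \<pi>])
  have descent: "\<mu> (Suc k) < \<mu> k" if k: "k \<in> E" "Suc k \<notin> E" "k < n" for k
  proof (rule ccontr)
    assume "\<not> \<mu> (Suc k) < \<mu> k"
    moreover have k1: "1 \<le> k" using k by (simp add: E_def)
    ultimately have "\<mu> (Suc k) = \<mu> k"
      using Lambda_antimono[OF \<mu>, of k "Suc k"] by simp
    moreover have "n - k = Suc (n - Suc k)" using k(3) by simp
    ultimately have z: "?z k = ?z (Suc k) + r"
      by (simp add: interp_point_def rho_def algebra_simps)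
    show False
    proof (cases "k \<in> xset n")
      case True
      then have Y: "Suc k \<in> yset n" and "Suc k \<notin> xset n"
        using k(3) unfolding xset_def yset_def mem_Collect_eq atLeastAtMost_iff by presburger+
      then have "Suc k \<notin> \<pi> ` I" using \<pi>X I by auto
      then have kI: "k \<in> I" using k(1) by (simp add: E_def)
      have "Suc k \<noteq> \<pi> k - 1"
      proof
        assume "Suc k = \<pi> k - 1"
        then have "Suc (Suc k) = \<pi> k" by simp
        then have "Suc k \<in> E" using kI k(3) by (auto simp: E_def)
        with k(2) show False ..
      qed
      then have "lagrange_prod n (- r) k (\<pi> k - 1) ?z = 0"
        using Y z by (intro lagrange_prod_eq_0[of "Suc k"]) auto
      then show False using B[OF kI] by simp
    next
      case False
      then have Y: "k \<in> yset n" and X: "Suc k \<in> xset n"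
        using k(3) k1 unfolding xset_def yset_def mem_Collect_eq atLeastAtMost_iff by presburger+
      have "Suc k \<in> \<pi> ` I" using False k(1) I by (auto simp: E_def)
      then obtain i where i: "i \<in> I" "\<pi> i = Suc k" by auto
      have kI: "Suc k \<notin> I" using k(2,3) by (simp add: E_def)
      have "k \<noteq> \<pi> (Suc k) - 1"
      proof
        assume "k = \<pi> (Suc k) - 1"
        moreover have "\<pi> (Suc k) \<in> xset n" using \<pi>X X by blast
        then have "1 \<le> \<pi> (Suc k)" by (simp add: xset_def)
        ultimately have "\<pi> (Suc k) = \<pi> i" using i by simp
        then have "Suc k = i" using permutes_inj[OF \<pi>] by (auto dest: injD)
        with i kI show False by simp
      qed
      then have "lagrange_prod n r (Suc k) (\<pi> (Suc k) - 1) ?z = 0"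
        using Y z by (intro lagrange_prod_eq_0[of k]) auto
      then show False using A[of "Suc k"] X kI by simp
    qed
  qed
  have last: "0 < \<mu> n" if "n \<in> E"
  proof -
    have "Suc n \<notin> xset n" by (simp add: xset_def)
    then have "n \<in> I" using that \<pi>X I by (auto simp: E_def)
    from B[OF this] show ?thesis by (auto simp: interp_point_def rho_def intro: Nat.gr0I)
  qed
  have pos: "0 < \<mu> k" if "k \<in> E" for k
  proof -
    have "k \<le> n" using that by (simp add: E_def)
    then show ?thesis using that
    proof (induction k rule: inc_induct)
      case (step k)
      show ?case
      proof (cases "Suc k \<in> E")
        case True
        moreover have "1 \<le> k" using step.prems by (simp add: E_def)
        ultimately show ?thesis using step.IH Lambda_antimono[OF \<mu>, of k "Suc k"] by simp
      next
        case False
        then show ?thesis using descent[OF step.prems] step.hyps by simp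
      qed
    qed (rule last)
  qed
  define \<nu> where "\<nu> k = \<mu> k - of_bool (k \<in> E)" for k
  have "\<nu> \<in> Lambda n"
    unfolding Lambda_def
  proof (intro CollectI conjI ballI allI impI)
    fix k assume k: "k \<in> {1..<n}"
    then have "\<mu> (Suc k) \<le> \<mu> k" by (intro Lambda_antimono[OF \<mu>]) auto
    then show "\<nu> (Suc k) \<le> \<nu> k"
      using descent[of k] k by (cases "k \<in> E"; cases "Suc k \<in> E") (auto simp: \<nu>_def)
  next
    fix k assume "k \<notin> {1..n}"
    then show "\<nu> k = 0" using \<mu> by (auto simp: \<nu>_def Lambda_def)
  qed
  moreover have "odd_size n \<nu> < odd_size n \<mu>" if ne: "I \<noteq> {}"
  proof -
    obtain i where i: "i \<in> I" using ne by blast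
    have iX: "i \<in> xset n" "\<pi> i \<in> xset n" using i I \<pi>X by auto
    \<comment> \<open>for even \<open>n\<close> the odd indices form \<open>yset n\<close>, and are reached through the column\<close>
    have "\<exists>k \<in> E. odd k"
    proof (cases "odd n")
      case True
      then have "i \<in> E" "odd i" using i iX by (auto simp: E_def xset_def)
      then show ?thesis by blast
    next
      case False
      then have *: "odd (\<pi> i - 1)" "\<pi> i - 1 \<in> {1..n}" "Suc (\<pi> i - 1) = \<pi> i"
        using iX(2) unfolding xset_def mem_Collect_eq atLeastAtMost_iff by presburger+
      then have "Suc (\<pi> i - 1) \<in> \<pi> ` I" using i by (metis imageI)
      with * show ?thesis unfolding E_def by blast
    qed
    then obtain k where k: "k \<in> E" "odd k" by blast
    show ?thesis
      unfolding odd_size_def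
    proof (rule sum_strict_mono_ex1)
      show "\<exists>k\<in>{i \<in> {1..n}. odd i}. \<nu> k < \<mu> k"
        using k pos[OF k(1)] by (intro bexI[of _ k]) (auto simp: \<nu>_def E_def)
    qed (auto simp: \<nu>_def)
  qed
  moreover have "?z k - (\<Sum>i\<in>I. shift_vec i (\<pi> i - 1) k) = interp_point n r \<nu> k" if "k \<in> {1..n}" for k
  proof -
    have "k \<in> I \<or> Suc k \<in> \<pi> ` I \<longleftrightarrow> k \<in> E" using that by (auto simp: E_def)
    then show ?thesis
      unfolding sum_shift_vec[OF \<pi> I that] using pos[of k]
      by (auto simp: interp_point_def \<nu>_def of_nat_diff)
  qed
  ultimately show ?thesis by (rule that)
qed

lemma normal_ordered_trivial_term:
  assumes "finite S"
    and "\<And>I. I \<subseteq> S \<Longrightarrow> I \<noteq> J \<Longrightarrow> (\<Prod>i\<in>S - I. A i z) * (\<Prod>i\<in>I. - B i z) *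
      f (\<lambda>k. z k - (\<Sum>i\<in>I. v i k)) = 0" and "J \<subseteq> S"
  shows "normal_ordered S A B v f z = (\<Prod>i\<in>S - J. A i z) * (\<Prod>i\<in>J. - B i z) *
      f (\<lambda>k. z k - (\<Sum>i\<in>J. v i k))"
  unfolding normal_ordered_def
  by (subst sum.mono_neutral_right[of "Pow S" "{J}"]) (use assms in auto)

lemma numerator_op_at_interp_point:
  assumes f: "poly_fun n d f" and \<mu>: "\<mu> \<in> Lambda n"
    and vanish: "\<And>\<nu>. \<nu> \<in> Lambda n \<Longrightarrow> odd_size n \<nu> < odd_size n \<mu> \<Longrightarrow> f (interp_point n r \<nu>) = 0"
  shows "numerator_op n r a (\<lambda>x. x) f (interp_point n r \<mu>) =
    (\<Prod>i\<in>xset n. a (interp_point n r \<mu> i)) * lagrange_det n r (interp_point n r \<mu>) * f (interp_point n r \<mu>)"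
proof -
  let ?z = "interp_point n r \<mu>" and ?X = "xset n"
  have "normal_ordered ?X (\<lambda>i z. a (z i) * lagrange_prod n r i (\<pi> i - 1) z)
       (\<lambda>i z. z i * lagrange_prod n (- r) i (\<pi> i - 1) z) (\<lambda>i. shift_vec i (\<pi> i - 1)) f ?z =
    (\<Prod>i\<in>?X. a (?z i) * lagrange_prod n r i (\<pi> i - 1) ?z) * f ?z" if \<pi>: "\<pi> permutes ?X" for \<pi>
  proof (subst normal_ordered_trivial_term[where J = "{}"])
    fix I assume I: "I \<subseteq> ?X" "I \<noteq> {}"
    have fin: "finite I" using I(1) by (rule finite_subset) simp
    show "(\<Prod>i\<in>?X - I. a (?z i) * lagrange_prod n r i (\<pi> i - 1) ?z) *
       (\<Prod>i\<in>I. - (?z i * lagrange_prod n (- r) i (\<pi> i - 1) ?z)) *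
       f (\<lambda>k. ?z k - (\<Sum>i\<in>I. shift_vec i (\<pi> i - 1) k)) = 0" (is "?P * ?Q * ?F = 0")
    proof (cases "?P * ?Q = 0")
      case False
      then have "?P \<noteq> 0" "?Q \<noteq> 0" by auto
      then have A: "\<And>i. i \<in> ?X - I \<Longrightarrow> lagrange_prod n r i (\<pi> i - 1) ?z \<noteq> 0"
        and B: "\<And>i. i \<in> I \<Longrightarrow> ?z i * lagrange_prod n (- r) i (\<pi> i - 1) ?z \<noteq> 0"
        using fin by (auto simp: prod_zero_iff)
      obtain \<nu> where \<nu>: "\<nu> \<in> Lambda n" "odd_size n \<nu> < odd_size n \<mu>"
        "\<And>k. k \<in> {1..n} \<Longrightarrow> ?z k - (\<Sum>i\<in>I. shift_vec i (\<pi> i - 1) k) = interp_point n r \<nu> k"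
      proof (rule surviving_shift[OF \<pi> I(1) \<mu> A B])
        fix \<nu> assume "\<nu> \<in> Lambda n" "I \<noteq> {} \<Longrightarrow> odd_size n \<nu> < odd_size n \<mu>"
          "\<And>k. k \<in> {1..n} \<Longrightarrow> ?z k - (\<Sum>i\<in>I. shift_vec i (\<pi> i - 1) k) = interp_point n r \<nu> k"
        with I(2) show thesis by (intro that) auto
      qed
      have "?F = f (interp_point n r \<nu>)" by (rule poly_fun_cong[OF f \<nu>(3)])
      then show ?thesis using vanish[OF \<nu>(1,2)] by simp
    qed simp
  qed auto
  then show ?thesis
    unfolding numerator_op_def lagrange_det_def sum_distrib_left sum_distrib_right
    by (intro sum.cong) (simp_all add: prod.distrib mult_ac)
qed

text \<open>
  At \<open>- \<rho>\<^sub>\<alpha>\<close> the factor \<open>z\<^sub>i - z\<^bsub>i-1\<^esub> - r\<close> is zero, and only \<open>\<pi> i = i\<close> omits it.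
\<close>

lemma lagrange_prod_at_rho:
  assumes z: "\<And>i. i \<in> {1..n} \<Longrightarrow> z i = - rho_shift n r \<alpha> i"
    and \<pi>: "\<pi> permutes xset n" and i: "i \<in> xset n" "2 \<le> i" "\<pi> i \<noteq> i"
  shows "lagrange_prod n (- r) i (\<pi> i - 1) z = 0"
proof (rule lagrange_prod_eq_0[of "i - 1"])
  have n: "n - (i - 1) = Suc (n - i)" using i by (auto simp: xset_def)
  then show Y: "i - 1 \<in> yset n"
    using i(1,2) by (auto simp: xset_def yset_def)
  have "\<pi> i \<in> xset n" using permutes_in_image[OF \<pi>] i(1) by simp
  then show "i - 1 \<noteq> \<pi> i - 1" using i by (auto simp: xset_def)
  have "rho n r (i - 1) = of_nat (Suc (n - i)) * r" by (simp only: rho_def n)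
  then have "rho n r (i - 1) = rho n r i + r" by (simp add: rho_def distrib_right)
  moreover have "i \<in> {1..n}" "i - 1 \<in> {1..n}" using i Y by (auto simp: xset_def yset_def)
  ultimately show "z i - z (i - 1) + - r = 0" by (simp add: z rho_shift_def)
qed

lemma permutes_xset_id:
  assumes \<pi>: "\<pi> permutes xset n" and "\<And>i. i \<in> xset n \<Longrightarrow> 2 \<le> i \<Longrightarrow> \<pi> i = i"
  shows "\<pi> = id"
proof
  fix i
  show "\<pi> i = id i"
  proof (cases "i \<in> xset n")
    case True
    then have X: "\<pi> i \<in> xset n" using permutes_in_image[OF \<pi>] by simp
    show ?thesis
    proof (cases "2 \<le> i")
      case False
      with True have i: "i = 1" by (auto simp: xset_def)
      have "\<pi> (\<pi> i) = \<pi> i \<or> \<pi> i = 1" using assms(2)[OF X] X by (auto simp: xset_def)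
      then show ?thesis using permutes_inj[OF \<pi>] i by (auto dest: injD)
    qed (use assms(2) True in auto)
  next
    case False
    then show ?thesis using permutes_not_in[OF \<pi>] by simp
  qed
qed

lemma lagrange_det_at_rho:
  assumes z: "\<And>i. i \<in> {1..n} \<Longrightarrow> z i = - rho_shift n r \<alpha> i"
  shows "lagrange_det n (- r) z = (\<Prod>i\<in>xset n. lagrange_prod n (- r) i (i - 1) z)"
proof -
  have "(\<Prod>i\<in>xset n. lagrange_prod n (- r) i (\<pi> i - 1) z) = 0"
    if "\<pi> permutes xset n" "\<pi> \<noteq> id" for \<pi>
    using permutes_xset_id[OF that(1)] that(2) lagrange_prod_at_rho[OF z that(1)]
    by (intro prod_zero) auto
  then show ?thesis
    unfolding lagrange_det_def
    by (subst sum.mono_neutral_right[of _ "{id}"]) (auto simp: finite_permutations permutes_id)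
qed

text \<open>
  Going down from \<open>n\<close> one sees that every row must be shifted: for \<open>i = n\<close> the factor
  \<open>z\<^sub>n + \<alpha>\<close> vanishes in the term without shift; for \<open>i < n\<close> the factor \<open>z\<^sub>i - z\<^bsub>i+1\<^esub> + r\<close>
  vanishes, and the only column omitting it is already used by the row \<open>i + 2\<close>. Rows that are
  shifted lie on the diagonal by \<open>lagrange_prod_at_rho\<close>.
\<close>

lemma numerator_op_at_rho:
  assumes f: "poly_fun n d f"
    and z: "\<And>i. i \<in> {1..n} \<Longrightarrow> z i = - rho_shift n r \<alpha> i"
  shows "numerator_op n r (\<lambda>x. x + \<alpha>) (\<lambda>x. x) f z =
    (\<Prod>i\<in>xset n. - z i) * lagrange_det n (- r) z * f (\<lambda>i. z i - 1)"
proof -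
  let ?X = "xset n"
  have survive: "I = ?X \<and> \<pi> = id"
    if \<pi>: "\<pi> permutes ?X" and I: "I \<subseteq> ?X"
      and A: "\<And>i. i \<in> ?X - I \<Longrightarrow> (z i + \<alpha>) * lagrange_prod n r i (\<pi> i - 1) z \<noteq> 0"
      and B: "\<And>i. i \<in> I \<Longrightarrow> lagrange_prod n (- r) i (\<pi> i - 1) z \<noteq> 0" for \<pi> I
  proof -
    have fixed: "\<pi> i = i" if "i \<in> I" "2 \<le> i" for i
      using lagrange_prod_at_rho[OF z \<pi>, of i] B[OF that(1)] that I by auto
    have all: "i \<in> I" if "i \<in> ?X" for i
      using that
    proof (induction "n - i" arbitrary: i rule: less_induct)
      case less
      show ?case
      proof (rule ccontr)
        assume "i \<notin> I"
        with less.prems have ne: "(z i + \<alpha>) * lagrange_prod n r i (\<pi> i - 1) z \<noteq> 0" using A by simp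
        show False
        proof (cases "i = n")
          case True
          have "n \<in> {1..n}" using less.prems True by (simp add: xset_def)
          then have "z i + \<alpha> = 0" using True by (simp add: z rho_shift_def rho_def)
          then show False using ne by simp
        next
          case False
          then have i: "i + 2 \<in> ?X" "i + 1 \<in> yset n" "n - (i + 2) < n - i" "i \<in> {1..n}"
            using less.prems unfolding xset_def yset_def mem_Collect_eq atLeastAtMost_iff
            by presburger+
          have "i + 2 \<in> I" by (rule less.hyps[OF i(3,1)])
          then have "\<pi> (i + 2) = i + 2" by (rule fixed) simp
          moreover have "\<pi> i \<noteq> \<pi> (i + 2)" by (simp add: inj_eq[OF permutes_inj[OF \<pi>]])
          ultimately have "\<pi> i \<noteq> i + 2" by simp
          moreover have "\<pi> i \<in> ?X" using permutes_in_image[OF \<pi>, of i] less.prems by blast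
          then have "1 \<le> \<pi> i" by (simp add: xset_def)
          moreover have "n - i = Suc (n - (i + 1))" using i by (auto simp: yset_def)
          then have "rho n r i = rho n r (i + 1) + r" by (simp add: rho_def algebra_simps)
          then have "z i - z (i + 1) + r = 0"
            using i(2,4) by (simp add: z yset_def rho_shift_def)
          ultimately have "lagrange_prod n r i (\<pi> i - 1) z = 0"
            using i(2) by (intro lagrange_prod_eq_0[of "i + 1"]) auto
          then show False using ne by simp
        qed
      qed
    qed
    have "\<pi> = id" by (rule permutes_xset_id[OF \<pi>]) (use fixed all in auto)
    with all I show ?thesis by auto
  qed
  define T where "T \<pi> I = (\<Prod>i\<in>?X - I. (z i + \<alpha>) * lagrange_prod n r i (\<pi> i - 1) z) *
       (\<Prod>i\<in>I. - (z i * lagrange_prod n (- r) i (\<pi> i - 1) z)) *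
       f (\<lambda>k. z k - (\<Sum>i\<in>I. shift_vec i (\<pi> i - 1) k))" for \<pi> I
  have T0: "T \<pi> I = 0" if "\<pi> permutes ?X" "I \<subseteq> ?X" "I \<noteq> ?X \<or> \<pi> \<noteq> id" for \<pi> I
  proof (rule ccontr)
    have fin: "finite I" using that(2) by (rule finite_subset) simp
    assume "T \<pi> I \<noteq> 0"
    then have "I = ?X \<and> \<pi> = id"
      using fin by (intro survive that(1,2)) (auto simp: T_def prod_zero_iff)
    with that(3) show False by blast
  qed
  have "numerator_op n r (\<lambda>x. x + \<alpha>) (\<lambda>x. x) f z =
    (\<Sum>\<pi> | \<pi> permutes ?X. of_int (sign \<pi>) * (\<Sum>I\<in>Pow ?X. T \<pi> I))"
    unfolding numerator_op_def normal_ordered_def T_def ..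
  also have "\<dots> = (\<Sum>\<pi>\<in>{id}. of_int (sign \<pi>) * (\<Sum>I\<in>Pow ?X. T \<pi> I))"
    by (rule sum.mono_neutral_right) (auto simp: finite_permutations permutes_id T0)
  also have "\<dots> = (\<Sum>I\<in>Pow ?X. T id I)" by simp
  also have "\<dots> = (\<Sum>I\<in>{?X}. T id I)"
    by (rule sum.mono_neutral_right) (auto simp: T0 permutes_id)
  also have "\<dots> = T id ?X" by simp
  also have "\<dots> = (\<Prod>i\<in>?X. - z i) * (\<Prod>i\<in>?X. lagrange_prod n (- r) i (i - 1) z) *
    f (\<lambda>k. z k - (\<Sum>i\<in>?X. shift_vec i (id i - 1) k))"
    by (simp add: T_def flip: prod.distrib)
  also have "f (\<lambda>k. z k - (\<Sum>i\<in>?X. shift_vec i (id i - 1) k)) = f (\<lambda>k. z k - 1)"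
  proof (rule poly_fun_cong[OF f])
    fix k assume k: "k \<in> {1..n}"
    then have "k \<in> ?X \<or> Suc k \<in> id ` ?X"
      by (cases "k = n") (auto simp: xset_def)
    then show "z k - (\<Sum>i\<in>?X. shift_vec i (id i - 1) k) = z k - 1"
      using sum_shift_vec[OF permutes_id subset_refl k] by simp
  qed
  finally show ?thesis by (simp only: lagrange_det_at_rho[OF z])
qed

lemma vandermonde_nonzero:
  assumes "\<And>a b. (a, b) \<in> pairs n \<Longrightarrow> z a \<noteq> z b" shows "vandermonde n z \<noteq> 0"
proof -
  have "diff_form s z \<noteq> 0" if "s \<in> pairs n" for s
    using that assms by (cases s) (auto simp: pairs_def diff_form_def)
  then show ?thesis by (simp add: vandermonde_def)
qed


section \<open>Dependence of the value on the shift parameter\<close>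

text \<open>
  The conditions on \<open>R\<^sub>\<lambda>\<close> except for the normalization, which therefore define a vector space.
\<close>

definition is_interp :: "nat \<Rightarrow> 'k::field_char_0 \<Rightarrow> (nat \<Rightarrow> nat) \<Rightarrow> ((nat \<Rightarrow> 'k) \<Rightarrow> 'k) \<Rightarrow> bool" where
  "is_interp n r l f \<longleftrightarrow> semisym n (int (odd_size n l)) f \<and>
    (\<forall>\<mu> \<in> Lambda n. odd_size n \<mu> \<le> odd_size n l \<longrightarrow> \<mu> \<noteq> l \<longrightarrow> f (interp_point n r \<mu>) = 0)"

lemma not_neg_rat_nonzero:
  assumes "not_neg_rat r" "r \<noteq> 0" "0 < a"
  shows "of_nat a * r + of_nat b \<noteq> 0"
  using assms by (cases "b = 0") (auto simp: not_neg_rat_def)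

lemma vandermonde_interp_point:
  assumes r: "not_neg_rat r" "r \<noteq> 0" and \<mu>: "\<mu> \<in> Lambda n"
  shows "vandermonde n (interp_point n r \<mu>) \<noteq> 0"
proof (rule vandermonde_nonzero)
  fix a b assume ab: "(a, b) \<in> pairs n"
  then have \<mu>_le: "\<mu> a \<le> \<mu> b" by (intro Lambda_antimono[OF \<mu>]) (auto simp: pairs_def)
  have "n - b = (n - a) + (a - b)" using ab by (auto simp: pairs_def)
  then have "interp_point n r \<mu> b = of_nat ((n - a) + (a - b)) * r + of_nat (\<mu> a + (\<mu> b - \<mu> a))"
    using \<mu>_le by (simp only: interp_point_def rho_def le_add_diff_inverse)
  also have "\<dots> = interp_point n r \<mu> a + (of_nat (a - b) * r + of_nat (\<mu> b - \<mu> a))"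
    by (simp only: interp_point_def rho_def of_nat_add distrib_right) (simp add: add_ac)
  finally have "interp_point n r \<mu> b = \<dots>" .
  moreover have "of_nat (a - b) * r + of_nat (\<mu> b - \<mu> a) \<noteq> 0"
    by (rule not_neg_rat_nonzero[OF r]) (use ab in \<open>auto simp: pairs_def\<close>)
  ultimately show "interp_point n r \<mu> a \<noteq> interp_point n r \<mu> b" by simp
qed

lemma rho_of_int: "i \<le> n \<Longrightarrow> rho n r i = of_int (int n - int i) * r"
  by (simp add: rho_def of_nat_diff)

lemma vandermonde_rho:
  fixes r :: "'k::field_char_0"
  assumes "r \<noteq> 0" shows "vandermonde n (\<lambda>i. - rho_shift n r \<alpha> i) \<noteq> 0"
proof (rule vandermonde_nonzero)
  fix a b assume ab: "(a, b) \<in> pairs n"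
  then have "(of_int (int n - int a) :: 'k) \<noteq> of_int (int n - int b)" 
    by (subst of_int_eq_iff) (auto simp: pairs_def)
  then show "- rho_shift n r \<alpha> a \<noteq> - rho_shift n r \<alpha> b"
    using ab assms by (auto simp: rho_shift_def rho_of_int pairs_def)
qed

text \<open>
  At \<open>- \<rho>\<close> the determinant reduces to its diagonal term, which is not zero there.
\<close>

lemma lagrange_det_constant:
  fixes r :: "'k::field_char_0"
  assumes r: "r \<noteq> 0"
  obtains c :: 'k where "c \<noteq> 0" "\<And>s z. lagrange_det n s z = c * vandermonde n z"
proof -
  obtain c :: 'k where c: "\<And>s z. lagrange_det n s z = c * vandermonde n z" using lagrange_det_eq_vandermonde by blast
  let ?z = "\<lambda>i. - rho_shift n r 0 i"
  have "lagrange_prod n (- r) i (i - 1) ?z \<noteq> 0" if i: "i \<in> xset n" for i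
  proof -
    have "?z i - ?z j + - r \<noteq> 0" if j: "j \<in> yset n - {i - 1}" for j
    proof -
      have "i \<le> n" "j \<le> n" "int i - int j - 1 \<noteq> 0"
        using i j by (auto simp: xset_def yset_def)
      moreover from this(1,2) have "?z i - ?z j + - r = of_int (int i - int j - 1) * r"
        by (simp add: rho_shift_def rho_of_int algebra_simps)
      ultimately show ?thesis
        using r by (simp only: mult_eq_0_iff of_int_eq_0_iff) simp
    qed
    then show ?thesis by (simp add: lagrange_prod_def)
  qed
  then have "lagrange_det n (- r) ?z \<noteq> 0" by (subst lagrange_det_at_rho) auto
  then have "c \<noteq> 0" using c by auto
  with c show ?thesis by (rule that[rotated])
qed

text \<open>
  The determinant alternates and is a nonzero multiple of the Vandermonde product.
\<close>

lemma vandermonde_swap: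
  fixes z :: "nat \<Rightarrow> 'k::field_char_0"
  assumes ab: "a \<in> {1..n}" "b \<in> {1..n}" "even (a + b)" "a \<noteq> b"
  shows "vandermonde n (z \<circ> transpose a b) = - vandermonde n z"
proof -
  obtain c :: 'k where c: "c \<noteq> 0" "\<And>s z. lagrange_det n s z = c * vandermonde n z"
    using lagrange_det_constant[of "1 :: 'k"] by auto
  have "lagrange_det n 0 (z \<circ> transpose a b) = - lagrange_det n 0 z"
    unfolding lagrange_det_numerator_op by (rule numerator_op_swap[OF ab]) simp
  with c show ?thesis by (metis mult_left_cancel mult_minus_right)
qed

lemma alternating_divide_semisym:
  fixes F :: "(nat \<Rightarrow> 'k::field_char_0) \<Rightarrow> 'k"
  assumes F: "poly_fun n (d + int (card (pairs n))) F"
    and alt: "\<And>a b z. a \<in> {1..n} \<Longrightarrow> b \<in> {1..n} \<Longrightarrow> even (a + b) \<Longrightarrow> a \<noteq> b \<Longrightarrow>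
      F (z \<circ> transpose a b) = - F z"
  obtains g where "semisym n d g" "\<And>z. F z = vandermonde n z * g z"
proof -
  obtain g where g: "poly_fun n d g" and Fg: "\<And>z. F z = vandermonde n z * g z"
    using alternating_divide[OF F alt] by auto
  have "g (z \<circ> transpose a b) = g z"
    if ab: "a \<in> {1..n}" "b \<in> {1..n}" "even (a + b)" for a b z
  proof (cases "a = b")
    case False
    have "poly_fun n d (\<lambda>z. g (z \<circ> transpose a b))"
      unfolding o_def
      by (rule poly_fun_subst[OF g, where g = "\<lambda>i z. z (transpose a b i)"])
        (use ab in \<open>auto intro!: poly_fun_var simp: transpose_def\<close>)
    from poly_fun_diff[OF this g]
    have "poly_fun n d (\<lambda>z. g (z \<circ> transpose a b) - g z)" .
    moreover have "g (z \<circ> transpose a b) - g z = 0" if "(\<Prod>s\<in>pairs n. diff_form s z) \<noteq> 0" for z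
      using alt[OF ab False, of z] that vandermonde_swap[OF ab False, of z]
      by (simp add: Fg vandermonde_def)
    moreover have "e < c" if "(c, e) \<in> pairs n" for c e using that by (simp add: pairs_def)
    ultimately have "g (z \<circ> transpose a b) - g z = 0"
      by (intro poly_fun_cancel_diff_forms[of "pairs n" n d "\<lambda>z. g (z \<circ> transpose a b) - g z" z])
        simp_all
    then show ?thesis by simp
  qed simp
  with g have "semisym n d g" by (intro semisymI)
  then show ?thesis using Fg by (rule that)
qed

text \<open>
  The difference operator applied to \<open>f\<close>, evaluated at \<open>- \<rho>\<^sub>\<alpha>\<close> in two ways: directly, and by means
  of the fact that \<open>f\<close> is an eigenfunction.
\<close>

lemma interp_shift_relation:
  fixes r :: "'k::field_char_0"
  assumes r: "not_neg_rat r" "r \<noteq> 0" and l: "l \<in> Lambda n" and f: "is_interp n r l f"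
  shows "f (\<lambda>i. - rho_shift n r (\<alpha> + 1) i) * (\<Prod>i\<in>xset n. rho n r i + \<alpha>) =
    (\<Prod>i\<in>xset n. interp_point n r l i + \<alpha>) * f (\<lambda>i. - rho_shift n r \<alpha> i)"
proof -
  let ?d = "int (odd_size n l)"
  have fs: "semisym n ?d f" and fp: "poly_fun n ?d f"
    and f0: "\<And>\<mu>. \<mu> \<in> Lambda n \<Longrightarrow> odd_size n \<mu> \<le> odd_size n l \<Longrightarrow> \<mu> \<noteq> l \<Longrightarrow> f (interp_point n r \<mu>) = 0"
    using f by (auto simp: is_interp_def semisym_def)
  define F where "F = numerator_op n r (\<lambda>x. x + \<alpha>) (\<lambda>x. x) f"
  obtain c :: 'k where c: "c \<noteq> 0" "\<And>s z. lagrange_det n s z = c * vandermonde n z"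
    using lagrange_det_constant[OF r(2)] by blast
  have Fp: "poly_fun n (?d + int (card (pairs n))) F"
    unfolding F_def by (rule poly_fun_numerator_op[OF fp])
  have alt: "F (z \<circ> transpose a b) = - F z"
    if ab: "a \<in> {1..n}" "b \<in> {1..n}" "even (a + b)" "a \<noteq> b" for a b z
    unfolding F_def using numerator_op_swap[where f = f, OF ab semisym_swap[OF fs ab(1,2,3)]] .
  obtain g where g: "semisym n ?d g" and Fg: "\<And>z. F z = vandermonde n z * g z"
    using alternating_divide_semisym[OF Fp alt] by blast
  let ?e = "\<Prod>i\<in>xset n. interp_point n r l i + \<alpha>"
  \<comment> \<open>the image \<open>g\<close> of \<open>f\<close> under the difference operator is a multiple of \<open>f\<close>\<close>
  have "g z - c * ?e * f z = 0" for z
  proof (rule semisym_interp_unique[where f = "\<lambda>z. g z - c * ?e * f z", OF r(1)])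
    show "semisym n ?d (\<lambda>z. g z - c * ?e * f z)"
      by (rule semisym_diff[OF g semisym_cmult[OF fs]])
    fix \<mu> assume \<mu>: "\<mu> \<in> Lambda n" "int (odd_size n \<mu>) \<le> ?d"
    let ?z = "interp_point n r \<mu>"
    have "F ?z = (\<Prod>i\<in>xset n. ?z i + \<alpha>) * lagrange_det n r ?z * f ?z"
      unfolding F_def
    proof (rule numerator_op_at_interp_point[OF fp \<mu>(1)])
      fix \<nu> assume "\<nu> \<in> Lambda n" "odd_size n \<nu> < odd_size n \<mu>"
      then show "f (interp_point n r \<nu>) = 0" using \<mu>(2) by (intro f0) auto
    qed
    then have "g ?z = (\<Prod>i\<in>xset n. ?z i + \<alpha>) * c * f ?z"
      using vandermonde_interp_point[OF r \<mu>(1)] by (simp add: Fg c(2))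
    then show "g ?z - c * ?e * f ?z = 0"
      using f0[OF \<mu>(1)] \<mu>(2) by (cases "\<mu> = l") auto
  qed
  then have gf: "g z = c * ?e * f z" for z by simp
  let ?z = "\<lambda>i. - rho_shift n r \<alpha> i"
  have "F ?z = (\<Prod>i\<in>xset n. - ?z i) * lagrange_det n (- r) ?z * f (\<lambda>i. ?z i - 1)"
    unfolding F_def by (rule numerator_op_at_rho[OF fp]) simp
  then have "g ?z = (\<Prod>i\<in>xset n. - ?z i) * c * f (\<lambda>i. ?z i - 1)"
    using vandermonde_rho[OF r(2), of n \<alpha>] by (simp add: Fg c(2))
  moreover have "(\<lambda>i. ?z i - 1) = (\<lambda>i. - rho_shift n r (\<alpha> + 1) i)"
    by (simp add: fun_eq_iff rho_shift_def)
  moreover have "(\<Prod>i\<in>xset n. - ?z i) = (\<Prod>i\<in>xset n. rho n r i + \<alpha>)"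
    by (simp add: rho_shift_def add.commute)
  ultimately have "c * (f (\<lambda>i. - rho_shift n r (\<alpha> + 1) i) * (\<Prod>i\<in>xset n. rho n r i + \<alpha>)) =
    c * (?e * f ?z)" using gf[of ?z] by (auto simp: mult_ac)
  with c(1) show ?thesis by simp
qed

lemma poly_zero_cofinite:
  fixes P :: "'k::field_char_0 poly"
  assumes "infinite T" "\<And>t. t \<in> T \<Longrightarrow> poly P t = 0" shows "P = 0"
  using assms poly_roots_finite[of P] finite_subset[of T "{t. poly P t = 0}"] by blast

lemma A_factor_xset:
  "A_factor n r l \<alpha> = (\<Prod>i\<in>xset n. pochhammer (\<alpha> + of_nat (n - i) * r) (l i))"
  by (simp add: A_factor_def xset_def)

lemma A_factor_poly: "\<exists>Q. \<forall>\<alpha>. A_factor n r l \<alpha> = poly Q \<alpha>"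
  by (rule exI[of _ "\<Prod>i\<in>xset n. \<Prod>k<l i. [:of_nat (n - i) * r + of_nat k, 1:]"])
    (simp add: A_factor_xset poly_prod pochhammer_prod add_ac atLeast0LessThan)

lemma pochhammer_shift:
  "pochhammer (a + 1) m * a = (a + of_nat m) * pochhammer a m"
  for a :: "'a::comm_ring_1"
  using pochhammer_rec[of a m] pochhammer_rec'[of a m] by (simp add: mult_ac)

lemma A_factor_nonzero:
  assumes r: "not_neg_rat r" "r \<noteq> 0" and l: "l \<in> Lambda n"
  shows "A_factor (Suc n) r l 0 \<noteq> 0"
proof -
  have "pochhammer (of_nat (Suc n - i) * r) (l i) \<noteq> 0" if "i \<in> xset (Suc n)" for i
  proof (cases "i = Suc n")
    case True
    then show ?thesis using Lambda_last[OF l] by simp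
  next
    case False
    then have "0 < Suc n - i" using that by (auto simp: xset_def)
    then have "of_nat (Suc n - i) * r + of_nat k \<noteq> 0" for k
      by (rule not_neg_rat_nonzero[OF r])
    then show ?thesis by (metis pochhammer_eq_0_iff add.left_inverse)
  qed
  then show ?thesis by (simp add: A_factor_xset)
qed

text \<open>
  Both sides are polynomials in \<open>\<alpha>\<close> that agree at \<open>\<alpha> = 0\<close> and obey the first order recursion of
  \<open>interp_shift_relation\<close>, so they agree at all natural numbers. The factor for the index \<open>n + 1\<close>
  is \<open>\<alpha>\<close> on both sides of the recursion since \<open>\<rho>\<close> and \<open>\<lambda>\<close> end in \<open>0\<close>. It has to be cancelled as a
  polynomial, for otherwise nothing would be known about the step from \<open>0\<close> to \<open>1\<close>.
\<close>

lemma interp_value_A_factor: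
  fixes r :: "'k::field_char_0"
  assumes r: "not_neg_rat r" "r \<noteq> 0" and l: "l \<in> Lambda n" and f: "is_interp (Suc n) r l f"
  shows "f (\<lambda>i. - rho_shift (Suc n) r \<alpha> i) * A_factor (Suc n) r l 0 =
    A_factor (Suc n) r l \<alpha> * f (\<lambda>i. - rho_shift (Suc n) r 0 i)"
proof -
  let ?N = "Suc n" and ?X = "xset (Suc n) - {Suc n}"
  have NX: "?N \<in> xset ?N" by (simp add: xset_def)
  have lN: "l ?N = 0" by (rule Lambda_last[OF l])
  have fp: "poly_fun ?N (int (odd_size ?N l)) f" using f by (simp add: is_interp_def semisym_def)
  obtain P where "\<And>t. f (\<lambda>i. - rho ?N r i + t * (- 1)) = poly P t"
    using poly_fun_on_line[OF fp, of "\<lambda>i. - rho ?N r i" "\<lambda>i. - 1"] by blast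
  then have P: "f (\<lambda>i. - rho_shift ?N r t i) = poly P t" for t
    by (simp add: rho_shift_def)
  obtain Q where Q: "\<And>t. A_factor ?N r l t = poly Q t" using A_factor_poly by blast
  define W where "W t = (\<Prod>i\<in>?X. rho ?N r i + t)" for t
  define Y where "Y t = (\<Prod>i\<in>?X. interp_point ?N r l i + t)" for t
  have P_rec: "poly P (t + 1) * W t = Y t * poly P t" for t
  proof -
    define U where "U = pcompose P [:1, 1:] * (\<Prod>i\<in>?X. [:rho ?N r i, 1:]) -
      (\<Prod>i\<in>?X. [:interp_point ?N r l i, 1:]) * P"
    have U: "poly U t = poly P (t + 1) * W t - Y t * poly P t" for t
      by (simp add: U_def W_def Y_def poly_pcompose poly_prod add_ac)
    have "poly U t = 0" if "t \<noteq> 0" for t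
    proof -
      have "poly P (t + 1) * ((rho ?N r ?N + t) * W t) = (interp_point ?N r l ?N + t) * Y t * poly P t"
        using interp_shift_relation[OF r Lambda_Suc[OF l] f, of t]
        unfolding P W_def Y_def prod.remove[OF finite_xset NX] .
      then have "t * (poly P (t + 1) * W t) = t * (Y t * poly P t)"
        by (simp add: interp_point_def rho_def lN mult_ac)
      with that show ?thesis by (simp add: U)
    qed
    moreover have "infinite (- {0 :: 'k})" by (simp add: finite_compl infinite_UNIV_char_0)
    ultimately have "U = 0" by (intro poly_zero_cofinite[of "- {0}"]) auto
    then show ?thesis using U[of t] by simp
  qed
  have Q_rec: "poly Q (t + 1) * W t = Y t * poly Q t" for t
  proof -
    have "poly Q t = (\<Prod>i\<in>?X. pochhammer (rho ?N r i + t) (l i))" for t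
      unfolding Q[symmetric] A_factor_xset
      by (subst prod.remove[OF finite_xset NX]) (simp add: lN rho_def add_ac)
    moreover have "pochhammer (rho ?N r i + (t + 1)) (l i) * (rho ?N r i + t) =
      (interp_point ?N r l i + t) * pochhammer (rho ?N r i + t) (l i)" for i
      using pochhammer_shift[of "rho ?N r i + t" "l i"] by (simp add: interp_point_def add_ac)
    ultimately show ?thesis
      unfolding W_def Y_def by (simp only: flip: prod.distrib)
  qed
  have W: "W (of_nat m) \<noteq> 0" for m
    unfolding W_def
    using not_neg_rat_nonzero[OF r, of "?N - _" m] by (auto simp: rho_def xset_def)
  have "poly P (of_nat m) * poly Q 0 = poly Q (of_nat m) * poly P 0" for m
  proof (induction m)
    case (Suc m)
    have "W (of_nat m) * (poly P (of_nat m + 1) * poly Q 0) =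
      Y (of_nat m) * (poly P (of_nat m) * poly Q 0)"
      using P_rec[of "of_nat m"] by (simp add: mult_ac)
    also have "\<dots> = W (of_nat m) * (poly Q (of_nat m + 1) * poly P 0)"
      unfolding Suc using Q_rec[of "of_nat m"] by (simp add: mult_ac)
    finally show ?case using W[of m] by (simp add: add.commute)
  qed simp
  then have "poly (smult (poly Q 0) P - smult (poly P 0) Q) t = 0" if "t \<in> range of_nat" for t
    using that by (auto simp: mult_ac)
  moreover have "infinite (range (of_nat :: nat \<Rightarrow> 'k))"
    by (simp add: range_inj_infinite inj_of_nat)
  ultimately have "smult (poly Q 0) P - smult (poly P 0) Q = 0"
    by (intro poly_zero_cofinite)
  then have "poly (smult (poly Q 0) P - smult (poly P 0) Q) \<alpha> = 0" by simp
  then show ?thesis by (simp add: P Q mult_ac)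
qed


section \<open>Induction on the tuple\<close>

text \<open>
  Every tuple arises from the empty one by appending a zero and by adding a full column. These are
  the two reductions of an interpolation polynomial.
\<close>

lemma Lambda_induct [consumes 1, case_names zero Suc add_column]:
  assumes "l \<in> Lambda n"
    and zero: "P 0 (\<lambda>i. 0)"
    and Suc: "\<And>n l. l \<in> Lambda n \<Longrightarrow> P n l \<Longrightarrow> P (Suc n) l"
    and add_column: "\<And>n l. l \<in> Lambda (Suc n) \<Longrightarrow> P (Suc n) l \<Longrightarrow> P (Suc n) (add_column (Suc n) l)"
  shows "P n l"
  using assms(1)
proof (induction n arbitrary: l)
  case 0
  then show ?case using zero by (simp add: Lambda_0)
next
  case (Suc n)
  note IHn = Suc.IH
  from Suc.prems show ?case
  proof (induction "odd_size (Suc n) l" arbitrary: l rule: less_induct)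
    case less
    from less.prems show ?case
    proof (cases rule: Lambda_Suc_cases)
      case 1
      then show ?thesis by (intro assms(3) IHn)
    next
      case (2 \<nu>)
      have "Suc n \<in> xset (Suc n)" by (simp add: xset_def)
      then have "0 < card (xset (Suc n))" using card_gt_0_iff by fastforce
      then show ?thesis using 2 less.hyps[of \<nu>] by (simp add: odd_size_add_column add_column)
    qed
  qed
qed

lemma alt_tail_Suc: "l \<in> Lambda n \<Longrightarrow> alt_tail (Suc n) l m = alt_tail n l m"
  by (cases "m \<le> Suc n") (simp_all add: alt_tail_def Lambda_last)

lemma alternating_sum:
  "m \<le> n \<Longrightarrow> (\<Sum>i = m..n. (- 1 :: int) ^ (i - m)) = of_bool (even (n - m))"
proof (induction n rule: dec_induct)
  case (step n)
  then have "Suc n - m = Suc (n - m)" by simp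
  with step show ?case by simp
qed simp

lemma alt_tail_add_column:
  assumes "1 \<le> m" "m \<le> n"
  shows "alt_tail n (add_column n l) m = alt_tail n l m + of_bool (even (n - m))"
proof -
  have "alt_tail n (add_column n l) m = (\<Sum>i = m..n. (- 1) ^ (i - m) * int (l i) + (- 1) ^ (i - m))"
    unfolding alt_tail_def using assms(1)
    by (intro sum.cong) (simp_all add: add_column_def algebra_simps)
  then show ?thesis
    by (simp add: sum.distrib alternating_sum[OF assms(2)] alt_tail_def)
qed

lemma alt_tail_nonneg: "l \<in> Lambda n \<Longrightarrow> 1 \<le> m \<Longrightarrow> 0 \<le> alt_tail n l m"
proof (induction rule: Lambda_induct)
  case (add_column n l)
  then show ?case
    by (cases "m \<le> Suc n") (simp_all add: alt_tail_add_column, simp add: alt_tail_def)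
qed (simp_all add: alt_tail_Suc alt_tail_def[of 0])

lemma alt_exponent_Suc:
  assumes "l \<in> Lambda n" shows "alt_exponent (Suc n) l = alt_exponent n l"
proof -
  have "alt_tail n l (Suc n) = 0" by (simp add: alt_tail_def)
  then show ?thesis by (simp add: alt_exponent_def alt_tail_Suc[OF assms])
qed

lemma alt_exponent_add_column:
  assumes "l \<in> Lambda n"
  shows "alt_exponent n (add_column n l) =
    (\<Sum>i\<in>xset n. Poly_Mapping.single i 1) + alt_exponent n l"
proof -
  have "alt_exponent n (add_column n l) = (\<Sum>m = 1..n. Poly_Mapping.single m (of_bool (even (n - m))) +
    Poly_Mapping.single m (nat (alt_tail n l m)))"
    unfolding alt_exponent_def
  proof (rule sum.cong)
    fix m assume m: "m \<in> {1..n}"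
    then have "nat (alt_tail n (add_column n l) m) = of_bool (even (n - m)) + nat (alt_tail n l m)"
      using alt_tail_nonneg[OF assms, of m] by (simp add: alt_tail_add_column nat_add_distrib)
    then show "Poly_Mapping.single m (nat (alt_tail n (add_column n l) m)) =
      Poly_Mapping.single m (of_bool (even (n - m))) + Poly_Mapping.single m (nat (alt_tail n l m))"
      by (simp add: single_add)
  qed simp
  also have "\<dots> = (\<Sum>m = 1..n. Poly_Mapping.single m (of_bool (even (n - m)))) + alt_exponent n l"
    by (simp add: sum.distrib alt_exponent_def)
  also have "(\<Sum>m = 1..n. Poly_Mapping.single m (of_bool (even (n - m)) :: nat)) =
    (\<Sum>i\<in>xset n. Poly_Mapping.single i 1)"
    by (rule sum.mono_neutral_cong_right) (auto simp: xset_def)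
  finally show ?thesis .
qed

lemma monom_degree_sum: "monom_degree (\<Sum>i\<in>S. m i) = (\<Sum>i\<in>S. monom_degree (m i))"
  by (induction S rule: infinite_finite_induct) (simp_all add: monom_degree_add)

lemma monom_degree_alt_exponent:
  "l \<in> Lambda n \<Longrightarrow> monom_degree (alt_exponent n l) = odd_size n l"
proof (induction rule: Lambda_induct)
  case (add_column n l)
  then show ?case
    by (simp add: alt_exponent_add_column monom_degree_add monom_degree_sum odd_size_add_column del: One_nat_def)
qed (simp_all add: alt_exponent_Suc odd_size_Suc, simp add: alt_exponent_def odd_size_def)

lemma lookup_alt_exponent_outside: "n < i \<Longrightarrow> Poly_Mapping.lookup (alt_exponent n l) i = 0"
  by (auto simp: alt_exponent_def lookup_sum lookup_single when_def intro!: sum.neutral)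

lemma poly_coeff_prod_mult:
  assumes "finite S" "S \<subseteq> {1..n}" "poly_fun n d g"
  shows "poly_coeff (\<lambda>z. (\<Prod>i\<in>S. z i) * g z) ((\<Sum>i\<in>S. Poly_Mapping.single i 1) + m) = poly_coeff g m"
  using assms
proof (induction S rule: finite_induct)
  case (insert a S)
  have "poly_fun n (\<Sum>i\<in>S. 1) (\<lambda>z. \<Prod>i\<in>S. z i)"
    using insert by (intro poly_fun_prod poly_fun_var) auto
  from poly_fun_mult[OF this insert.prems(2)]
  have 1: "poly_fun n ((\<Sum>i\<in>S. 1) + d) (\<lambda>z. (\<Prod>i\<in>S. z i) * g z)" .
  from poly_coeff_var_mult(1)[OF 1, of a "(\<Sum>i\<in>S. Poly_Mapping.single i 1) + m"] insert
  show ?case by (simp add: mult.assoc add.assoc del: One_nat_def)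
qed simp

lemma is_interp_semisym: "is_interp n r l f \<Longrightarrow> semisym n (int (odd_size n l)) f"
  by (simp add: is_interp_def)

lemma is_interp_poly_fun: "is_interp n r l f \<Longrightarrow> poly_fun n (int (odd_size n l)) f"
  by (simp add: is_interp_def semisym_def)

lemma is_interp_vanish:
  "is_interp n r l f \<Longrightarrow> \<mu> \<in> Lambda n \<Longrightarrow> odd_size n \<mu> \<le> odd_size n l \<Longrightarrow> \<mu> \<noteq> l \<Longrightarrow>
    f (interp_point n r \<mu>) = 0"
  by (simp add: is_interp_def)

text \<open>
  The exponent \<open>[\<lambda>]\<close> does not involve the last variable when \<open>\<lambda>\<close> ends in zero, so its
  coefficient survives in the restriction; being of top degree, it is not affected by the translation.
\<close>

lemma is_interp_restrict_last:
  assumes l: "l \<in> Lambda n" and f: "is_interp (Suc n) r l f"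
  shows "is_interp n r l (restrict_last n r f)"
    and "poly_coeff (restrict_last n r f) (alt_exponent n l) = poly_coeff f (alt_exponent (Suc n) l)"
proof -
  let ?d = "int (odd_size n l)" and ?e = "alt_exponent n l"
  note fs = is_interp_semisym[OF f, unfolded odd_size_Suc[OF l]]
  note fp = semisym_poly_fun[OF fs]
  show "is_interp n r l (restrict_last n r f)"
    unfolding is_interp_def
  proof (intro conjI ballI impI)
    show "semisym n ?d (restrict_last n r f)" by (rule semisym_restrict_last[OF fs])
    fix \<mu> assume "\<mu> \<in> Lambda n" "odd_size n \<mu> \<le> odd_size n l" "\<mu> \<noteq> l"
    then show "restrict_last n r f (interp_point n r \<mu>) = 0"
      using is_interp_vanish[OF f, of \<mu>] l
      by (simp add: restrict_last_interp_point[OF fp] Lambda_Suc odd_size_Suc)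
  qed
  have fp0: "poly_fun n ?d (restrict_last n 0 f)" by (rule semisym_poly_fun[OF semisym_restrict_last[OF fs]])
  have fp1: "poly_fun (Suc n) ?d (restrict_last n 0 f)"
    using poly_fun_subst[OF fp0, of "Suc n" "\<lambda>i z. z i"] by (simp add: poly_fun_var)
  obtain g where g: "poly_fun (Suc n) (?d - 1) g"
    and fg: "\<And>z. f z = f (z(Suc n := (z(0 := 0)) 0)) + diff_form (Suc n, 0) z * g z"
    using poly_fun_divide_diff_form[OF fp, of "Suc n" 0] by auto
  have restr0: "f (z(Suc n := 0)) = restrict_last n 0 f z" for z
    by (auto simp: restrict_last_def fun_upd_def intro!: arg_cong[of _ _ f])
  have f_eq: "f = (\<lambda>z. restrict_last n 0 f z + z (Suc n) * g z)"
    using fg restr0 by (simp add: fun_eq_iff diff_form_def)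
  have 2: "poly_fun (Suc n) ?d (\<lambda>z. z (Suc n) * g z)"
    using poly_fun.var_mult[OF g, of "Suc n"] by simp
  have "poly_coeff (restrict_last n r f) ?e = poly_coeff (\<lambda>z. restrict_last n 0 f (\<lambda>i. z i + r)) ?e"
    by (simp add: restrict_last_def[abs_def] cong: if_cong)
  also have "\<dots> = poly_coeff (restrict_last n 0 f) ?e"
    by (rule poly_coeff_translate[OF fp0]) (simp add: monom_degree_alt_exponent[OF l])
  also have "\<dots> = poly_coeff f ?e"
    by (subst (2) f_eq, subst poly_coeff_add[OF fp1 2])
      (simp add: poly_coeff_var_mult(2)[OF g] lookup_alt_exponent_outside)
  finally show "poly_coeff (restrict_last n r f) ?e = poly_coeff f (alt_exponent (Suc n) l)"
    by (simp add: alt_exponent_Suc[OF l])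
qed

text \<open>
  The restriction to \<open>z\<^sub>n = 0\<close> vanishes by uniqueness, as \<open>add_column\<close> produces no tuple ending in zero.
\<close>

lemma is_interp_add_columnE:
  assumes r: "not_neg_rat r" and l: "l \<in> Lambda (Suc n)"
    and f: "is_interp (Suc n) r (add_column (Suc n) l) f"
  obtains g where "is_interp (Suc n) r l g"
    and "\<And>z. f z = (\<Prod>i\<in>xset (Suc n). z i) * g (\<lambda>i. z i - 1)"
    and "poly_coeff g (alt_exponent (Suc n) l) =
      poly_coeff f (alt_exponent (Suc n) (add_column (Suc n) l))"
proof -
  let ?N = "Suc n"
  let ?d = "int (odd_size ?N l)" and ?p = "int (card (xset ?N))"
  have fs: "semisym ?N (?d + ?p) f"
    using is_interp_semisym[OF f] by (simp add: odd_size_add_column)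
  have "restrict_last n r f z = 0" for z
  proof (rule semisym_interp_unique[OF r semisym_restrict_last[OF fs]])
    fix \<mu> assume \<mu>: "\<mu> \<in> Lambda n" "int (odd_size n \<mu>) \<le> ?d + ?p"
    have "\<mu> \<noteq> add_column ?N l"
      using Lambda_last[OF \<mu>(1)] by (auto simp: add_column_def)
    then show "restrict_last n r f (interp_point n r \<mu>) = 0"
      using is_interp_vanish[OF f Lambda_Suc[OF \<mu>(1)]] \<mu>
      by (simp add: restrict_last_interp_point[OF semisym_poly_fun[OF fs]] odd_size_Suc odd_size_add_column)
  qed
  then have "f z = 0" if "z ?N = 0" for z
    using restrict_last_eq[of n "?d + ?p" f z r] semisym_poly_fun[OF fs] that by simp
  then obtain h where h: "semisym ?N ?d h" and fh: "\<And>z. f z = (\<Prod>i\<in>xset ?N. z i) * h z"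
    using semisym_divide[OF _ fs] by auto
  define g where "g z = h (\<lambda>i. z i + 1)" for z
  have gs: "semisym ?N ?d g" unfolding g_def by (rule semisym_translate[OF h])
  have "is_interp ?N r l g"
    unfolding is_interp_def
  proof (intro conjI ballI impI gs)
    fix \<mu> assume \<mu>: "\<mu> \<in> Lambda ?N" "odd_size ?N \<mu> \<le> odd_size ?N l" "\<mu> \<noteq> l"
    have "add_column ?N \<mu> \<noteq> add_column ?N l"
    proof
      assume eq: "add_column ?N \<mu> = add_column ?N l"
      have "\<mu> i = l i" for i
      proof (cases "i \<in> {1..?N}")
        case True
        then show ?thesis using fun_cong[OF eq, of i] by (simp add: add_column_def)
      next
        case False
        then show ?thesis using \<mu>(1) l by (simp add: Lambda_def)
      qed
      with \<mu>(3) show False by auto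
    qed
    then have "f (interp_point ?N r (add_column ?N \<mu>)) = 0"
      using \<mu> by (intro is_interp_vanish[OF f] add_column_Lambda) (simp_all add: odd_size_add_column)
    then have "h (interp_point ?N r (add_column ?N \<mu>)) = 0"
      using prod_interp_point_add_column[OF r, of ?N \<mu>] by (simp add: fh)
    also have "h (interp_point ?N r (add_column ?N \<mu>)) = g (interp_point ?N r \<mu>)"
      unfolding g_def by (rule poly_fun_cong[OF semisym_poly_fun[OF h]]) (rule interp_point_add_column)
    finally show "g (interp_point ?N r \<mu>) = 0" .
  qed
  moreover have "f z = (\<Prod>i\<in>xset ?N. z i) * g (\<lambda>i. z i - 1)" for z
    by (simp add: fh g_def)
  moreover have "poly_coeff g (alt_exponent ?N l) = poly_coeff f (alt_exponent ?N (add_column ?N l))"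
  proof -
    have "poly_coeff g (alt_exponent ?N l) = poly_coeff h (alt_exponent ?N l)"
      unfolding g_def
      by (rule poly_coeff_translate[OF semisym_poly_fun[OF h]])
        (simp add: monom_degree_alt_exponent[OF l])
    also have "\<dots> = poly_coeff (\<lambda>z. (\<Prod>i\<in>xset ?N. z i) * h z)
        ((\<Sum>i\<in>xset ?N. Poly_Mapping.single i 1) + alt_exponent ?N l)"
      by (rule poly_coeff_prod_mult[OF finite_xset _ semisym_poly_fun[OF h], symmetric])
        (auto simp: xset_def)
    finally show ?thesis
      by (simp add: alt_exponent_add_column[OF l] flip: fh)
  qed
  ultimately show ?thesis by (rule that)
qed

lemma poly_coeff_0_vars:
  assumes "poly_fun 0 d f" shows "poly_coeff f 0 = f z"
proof -
  have "f w = eval_poly (Poly_Mapping.single 0 (f z)) w" for w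
    using poly_fun_cong[OF assms, of w z] by simp
  then have "f = eval_poly (Poly_Mapping.single 0 (f z))" by (rule ext)
  then have "poly_coeff f 0 = poly_coeff (eval_poly (Poly_Mapping.single 0 (f z))) 0"
    by (rule arg_cong)
  then show ?thesis by simp
qed

text \<open>
  Both reductions preserve the coefficient. If it is zero, then so is the reduced polynomial by
  induction. In the case of a restriction this only says that \<open>f\<close> vanishes at \<open>\<rho> + \<lambda>\<close> as well, and
  uniqueness of interpolation applies. Consequently the normalization by the coefficient of \<open>z\<^bsup>[\<lambda>]\<^esup>\<close> is possible and
  determines the polynomial.
\<close>

lemma is_interp_eq_0:
  assumes r: "not_neg_rat r" and "l \<in> Lambda n" "is_interp n r l f"
    and "poly_coeff f (alt_exponent n l) = 0"
  shows "f z = 0"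
  using assms(2-)
proof (induction arbitrary: f z rule: Lambda_induct)
  case zero
  have "poly_coeff f 0 = f z" by (rule poly_coeff_0_vars[OF is_interp_poly_fun[OF zero(1)]])
  with zero(2) show ?case by (simp add: alt_exponent_def)
next
  case (Suc n l)
  have "restrict_last n r f w = 0" for w
    using Suc is_interp_restrict_last[OF Suc.hyps Suc.prems(1)] by simp
  then have fl: "f (interp_point (Suc n) r l) = 0"
    using restrict_last_interp_point[OF is_interp_poly_fun[OF Suc.prems(1)] Suc.hyps, of r] by simp
  show ?case
  proof (rule semisym_interp_unique[OF r is_interp_semisym[OF Suc.prems(1)]])
    fix \<mu> assume "\<mu> \<in> Lambda (Suc n)" "int (odd_size (Suc n) \<mu>) \<le> int (odd_size (Suc n) l)"
    then show "f (interp_point (Suc n) r \<mu>) = 0"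
      using is_interp_vanish[OF Suc.prems(1), of \<mu>] fl by (cases "\<mu> = l") simp_all
  qed
next
  case (add_column n l)
  from is_interp_add_columnE[OF r add_column.hyps add_column.prems(1)]
  obtain g where g: "is_interp (Suc n) r l g"
    and fg: "\<And>z. f z = (\<Prod>i\<in>xset (Suc n). z i) * g (\<lambda>i. z i - 1)"
    and coeff: "poly_coeff g (alt_exponent (Suc n) l) =
      poly_coeff f (alt_exponent (Suc n) (add_column (Suc n) l))" by blast
  have "g (\<lambda>i. z i - 1) = 0" by (rule add_column.IH[OF g]) (simp add: coeff add_column.prems(2))
  then show ?case by (simp add: fg)
qed

lemma A_factor_add_column:
  "A_factor n r (add_column n l) \<alpha> = (\<Prod>i\<in>xset n. \<alpha> + of_nat (n - i) * r) * A_factor n r l (\<alpha> + 1)"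
proof -
  have "pochhammer (\<alpha> + of_nat (n - i) * r) (add_column n l i) = (\<alpha> + of_nat (n - i) * r) *
    pochhammer (\<alpha> + 1 + of_nat (n - i) * r) (l i)" if "i \<in> xset n" for i
    using that by (simp add: add_column_def xset_def pochhammer_rec add_ac)
  then show ?thesis by (simp add: A_factor_xset prod.distrib)
qed

lemma B_factor_add_column: "B_factor n r (add_column n l) = B_factor n r l"
  unfolding B_factor_def
  by (intro arg_cong2[of _ _ _ _ "(/)"] prod.cong) (auto simp: add_column_def)

lemma prod_pairs_Suc:
  fixes F :: "nat \<Rightarrow> nat \<Rightarrow> 'k::comm_monoid_mult"
  shows "(\<Prod>(i, j) | 1 \<le> i \<and> i < j \<and> j \<le> Suc n \<and> Q (j - i). F i j) =
    (\<Prod>(i, j) | 1 \<le> i \<and> i < j \<and> j \<le> n \<and> Q (j - i). F i j) *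
    (\<Prod>i | i \<in> {1..n} \<and> Q (Suc n - i). F i (Suc n))"
proof -
  let ?S = "{(i, j). 1 \<le> i \<and> i < j \<and> j \<le> n \<and> Q (j - i)}"
  let ?T = "(\<lambda>i. (i, Suc n)) ` {i. i \<in> {1..n} \<and> Q (Suc n - i)}"
  have "{(i, j). 1 \<le> i \<and> i < j \<and> j \<le> Suc n \<and> Q (j - i)} = ?S \<union> ?T"
    by (auto simp: le_Suc_eq)
  moreover have "finite ?S" by (rule finite_subset[of _ "{..n} \<times> {..n}"]) auto
  moreover have "?S \<inter> ?T = {}" by auto
  ultimately have "(\<Prod>(i, j) | 1 \<le> i \<and> i < j \<and> j \<le> Suc n \<and> Q (j - i). F i j) =
    (\<Prod>(i, j)\<in>?S. F i j) * (\<Prod>(i, j)\<in>?T. F i j)" by (simp add: prod.union_disjoint)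
  also have "(\<Prod>(i, j)\<in>?T. F i j) = (\<Prod>i | i \<in> {1..n} \<and> Q (Suc n - i). F i (Suc n))"
    by (subst prod.reindex) (auto simp: inj_on_def)
  finally show ?thesis .
qed

text \<open>
  The pairs \<open>(i, n + 1)\<close> contribute \<open>A\<^sub>\<lambda>(2r)\<close> in \<open>n\<close> variables to the numerator, and
  \<open>A\<^sub>\<lambda>(0)\<close> in \<open>n + 1\<close> variables to the denominator.
\<close>

lemma B_factor_Suc:
  assumes r: "not_neg_rat r" "r \<noteq> 0" and l: "l \<in> Lambda n"
  shows "A_factor (Suc n) r l 0 * B_factor (Suc n) r l = A_factor n r l (2 * r) * B_factor n r l"
proof -
  have lN: "l (Suc n) = 0" by (rule Lambda_last[OF l])
  have "A_factor (Suc n) r l 0 = pochhammer (of_nat (Suc n - Suc n) * r) (l (Suc n)) *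
    (\<Prod>i\<in>xset (Suc n) - {Suc n}. pochhammer (of_nat (Suc n - i) * r) (l i))"
    unfolding A_factor_xset by (subst prod.remove[of _ "Suc n"]) (simp_all add: xset_def)
  also have "xset (Suc n) - {Suc n} = {i. i \<in> {1..n} \<and> even (Suc n - i)}"
    by (auto simp: xset_def)
  finally have A0: "A_factor (Suc n) r l 0 =
    (\<Prod>i | i \<in> {1..n} \<and> even (Suc n - i). pochhammer (of_nat (Suc n - i) * r) (l i - l (Suc n)))"
    by (simp add: lN)
  have A2: "A_factor n r l (2 * r) =
    (\<Prod>i | i \<in> {1..n} \<and> odd (Suc n - i). pochhammer (of_nat (Suc n - i + 1) * r) (l i - l (Suc n)))"
    unfolding A_factor_def
    by (rule prod.cong) (auto simp: lN Suc_diff_le algebra_simps)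
  have "A_factor (Suc n) r l 0 \<noteq> 0" by (rule A_factor_nonzero[OF r l])
  then show ?thesis
    unfolding B_factor_def prod_pairs_Suc[where n = n and Q = odd]
      prod_pairs_Suc[where n = n and Q = even] A0[symmetric] A2[symmetric] by simp
qed

text \<open>
  Induction by the two reductions. Both sides are linear in \<open>f\<close>, which frees the induction from
  the normalization. A full column changes \<open>\<alpha>\<close> to \<open>\<alpha> + 1\<close>. For an appended zero, the value
  at \<open>\<alpha> = 0\<close> is known in one variable less, and \<open>interp_value_A_factor\<close> transports it to all \<open>\<alpha>\<close>.
\<close>

lemma is_interp_value:
  assumes r: "not_neg_rat r" "r \<noteq> 0" and "l \<in> Lambda n" "is_interp n r l f"
  shows "f (\<lambda>i. - rho_shift n r \<alpha> i) =
    (- 1) ^ odd_size n l * A_factor n r l \<alpha> * B_factor n r l * poly_coeff f (alt_exponent n l)"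
  using assms(3-)
proof (induction arbitrary: f \<alpha> rule: Lambda_induct)
  case zero
  let ?c = "f (\<lambda>i. - rho_shift 0 r \<alpha> i)"
  have "poly_coeff f 0 = ?c" by (rule poly_coeff_0_vars[OF is_interp_poly_fun[OF zero]])
  moreover have "{(i :: nat, j). 1 \<le> i \<and> i < j \<and> j \<le> 0 \<and> Q i j} = {}" for Q by auto
  ultimately show ?case
    by (simp add: odd_size_def A_factor_def B_factor_def alt_exponent_def)
next
  case (Suc n l)
  let ?g = "restrict_last n r f" and ?N = "Suc n"
  \<comment> \<open>one \<open>r\<close> comes from the change of \<open>\<rho>\<close>, the other one from the translation in \<open>?g\<close>\<close>
  have "?g (\<lambda>i. - rho_shift n r (2 * r) i) = (- 1) ^ odd_size n l * A_factor n r l (2 * r) *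
    B_factor n r l * poly_coeff f (alt_exponent ?N l)"
    using Suc.IH[OF is_interp_restrict_last(1)[OF Suc.hyps Suc.prems]]
      is_interp_restrict_last(2)[OF Suc.hyps Suc.prems] by simp
  moreover have "f (\<lambda>i. - rho_shift ?N r 0 i) = ?g (\<lambda>i. - rho_shift n r (2 * r) i)"
    unfolding restrict_last_def
    by (rule poly_fun_cong[OF is_interp_poly_fun[OF Suc.prems]])
      (auto simp: rho_shift_def rho_def Suc_diff_le algebra_simps)
  ultimately have "f (\<lambda>i. - rho_shift ?N r 0 i) = A_factor ?N r l 0 * ((- 1) ^ odd_size n l *
    B_factor ?N r l * poly_coeff f (alt_exponent ?N l))"
    using B_factor_Suc[OF r Suc.hyps] by (simp add: mult_ac)
  with interp_value_A_factor[OF r Suc.hyps Suc.prems, of \<alpha>] A_factor_nonzero[OF r Suc.hyps]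
  show ?case by (simp add: odd_size_Suc[OF Suc.hyps] mult_ac)
next
  case (add_column n l)
  let ?N = "Suc n"
  from is_interp_add_columnE[OF r(1) add_column.hyps add_column.prems]
  obtain g where g: "is_interp ?N r l g"
    and fg: "\<And>z. f z = (\<Prod>i\<in>xset ?N. z i) * g (\<lambda>i. z i - 1)"
    and coeff: "poly_coeff g (alt_exponent ?N l) =
      poly_coeff f (alt_exponent ?N (add_column ?N l))" by blast
  have "(\<lambda>i. - rho_shift ?N r \<alpha> i - 1) = (\<lambda>i. - rho_shift ?N r (\<alpha> + 1) i)"
    by (simp add: fun_eq_iff rho_shift_def)
  moreover have "(\<Prod>i\<in>xset ?N. - rho_shift ?N r \<alpha> i) =
    (- 1) ^ card (xset ?N) * (\<Prod>i\<in>xset ?N. \<alpha> + of_nat (?N - i) * r)"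
    by (simp only: rho_shift_def rho_def prod_uminus add.commute[of "_ * r"])
  ultimately show ?case
    using add_column.IH[OF g, of "\<alpha> + 1"]
    by (simp add: fg[of "\<lambda>i. - rho_shift ?N r \<alpha> i"] coeff A_factor_add_column B_factor_add_column odd_size_add_column power_add mult_ac)
qed

text \<open>
  The polynomial that is \<open>1\<close> at \<open>\<rho> + \<lambda>\<close> and \<open>0\<close> at the other points has a nonzero coefficient
  at \<open>z\<^bsup>[\<lambda>]\<^esup>\<close> by \<open>is_interp_eq_0\<close>, so it can be rescaled; the same lemma, applied to a
  difference, gives uniqueness.
\<close>

lemma semisym_R_properties:
  fixes r :: "'k::field_char_0"
  assumes r: "not_neg_rat r" and l: "l \<in> Lambda n"
  shows "is_interp n r l (eval_poly (semisym_R n r l))"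
    and "Poly_Mapping.lookup (semisym_R n r l) (alt_exponent n l) = 1"
proof -
  let ?d = "odd_size n l" and ?e = "alt_exponent n l"
  let ?P = "\<lambda>p. p \<in> W_invariants n \<and> total_degree p = ?d \<and>
     (\<forall>\<mu> \<in> Lambda n. odd_size n \<mu> \<le> ?d \<and> \<mu> \<noteq> l \<longrightarrow>
        eval_poly p (\<lambda>i. rho n r i + of_nat (\<mu> i)) = 0) \<and> Poly_Mapping.lookup p ?e = 1"
  have interp: "is_interp n r l (eval_poly p)" if "?P p" for p
    using that W_invariants_semisym[of p n ?d] by (simp add: is_interp_def interp_point_def)
  obtain f where f: "semisym n ?d f" and
    fv: "\<And>\<mu>. \<mu> \<in> Lambda n \<Longrightarrow> int (odd_size n \<mu>) \<le> ?d \<Longrightarrow> f (interp_point n r \<mu>) = of_bool (\<mu> = l)"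
    using semisym_interp_exists[OF r, of n ?d "\<lambda>\<mu>. of_bool (\<mu> = l)"] by blast
  have fi: "is_interp n r l f" using f fv by (simp add: is_interp_def)
  have c: "poly_coeff f ?e \<noteq> 0" (is "?c \<noteq> 0")
    using is_interp_eq_0[OF r l fi, of "interp_point n r l"] fv[OF l] by auto
  let ?g = "\<lambda>z. inverse ?c * f z"
  have g: "semisym n ?d ?g" by (rule semisym_cmult[OF f])
  have g1: "poly_coeff ?g ?e = 1"
    using poly_coeff_cmult[OF semisym_poly_fun[OF f]] c by simp
  obtain p where p: "p \<in> polys n" "\<And>m. m \<in> Poly_Mapping.keys p \<Longrightarrow> int (monom_degree m) \<le> ?d"
    "eval_poly p = ?g"
    using poly_fun_eval_poly[OF semisym_poly_fun[OF g]] by blast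
  have lookup: "Poly_Mapping.lookup p ?e = 1" using g1 by (simp flip: p(3))
  have "?P p"
  proof (intro conjI ballI impI)
    show "p \<in> W_invariants n" by (rule semisym_W_invariants[OF g p(1,3)])
    show "total_degree p = ?d"
      unfolding total_degree_def
    proof (rule Max_eqI)
      show "?d \<in> insert 0 (monom_degree ` Poly_Mapping.keys p)"
        using lookup monom_degree_alt_exponent[OF l, symmetric]
        by (intro insertI2 image_eqI[of _ _ ?e]) (simp_all add: in_keys_iff)
    qed (use p(2) in auto)
    fix \<mu> assume "\<mu> \<in> Lambda n" "odd_size n \<mu> \<le> ?d \<and> \<mu> \<noteq> l"
    then show "eval_poly p (\<lambda>i. rho n r i + of_nat (\<mu> i)) = 0"
      using fv[of \<mu>] by (simp add: p(3) interp_point_def)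
  qed (rule lookup)
  moreover have "q = p" if q: "?P q" for q
  proof (rule eval_poly_inject)
    fix z
    let ?h = "\<lambda>z. eval_poly q z - eval_poly p z"
    have qi: "is_interp n r l (eval_poly q)" and pi: "is_interp n r l (eval_poly p)"
      using interp q \<open>?P p\<close> by blast+
    then have "is_interp n r l ?h" by (auto simp: is_interp_def intro: semisym_diff)
    moreover have "poly_coeff ?h ?e = 0"
    proof -
      have "poly_fun n ?d (\<lambda>z. (- 1) * eval_poly p z)"
        by (rule poly_fun_cmult[OF is_interp_poly_fun[OF pi]])
      from poly_coeff_add[OF is_interp_poly_fun[OF qi] this, of ?e]
      have "poly_coeff ?h ?e = poly_coeff (eval_poly q) ?e +
        poly_coeff (\<lambda>z. (- 1) * eval_poly p z) ?e" by simp
      then show ?thesis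
        using q lookup poly_coeff_cmult[OF is_interp_poly_fun[OF pi], of "- 1" ?e]
        by (simp only: poly_coeff_eval) simp
    qed
    ultimately have "?h z = 0" by (rule is_interp_eq_0[OF r l])
    then show "eval_poly q z = eval_poly p z" by simp
  qed
  ultimately have "?P (semisym_R n r l)"
    unfolding semisym_R_def by (rule theI)
  then show "is_interp n r l (eval_poly (semisym_R n r l))"
    and "Poly_Mapping.lookup (semisym_R n r l) ?e = 1"
    using interp by blast+
qed


section \<open>Products over boxes\<close>

lemma pochhammer_row: "pochhammer a m = (\<Prod>j = 1..m. a + of_nat (j - 1))"
  by (induction m) (simp_all add: pochhammer_Suc)

lemma prod_boxes:
  "(\<Prod>s | s \<in> diagram n l \<and> Q s. F s) = (\<Prod>i = 1..n. \<Prod>j | j \<in> {1..l i} \<and> Q (i, j). F (i, j))"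
proof -
  have "{s. s \<in> diagram n l \<and> Q s} = (SIGMA i:{1..n}. {j. j \<in> {1..l i} \<and> Q (i, j)})"
    by (auto simp: diagram_def)
  moreover have "(\<Prod>i = 1..n. \<Prod>j | j \<in> {1..l i} \<and> Q (i, j). F (i, j)) =
    (\<Prod>(i, j)\<in>(SIGMA i:{1..n}. {j. j \<in> {1..l i} \<and> Q (i, j)}). F (i, j))"
  proof (rule prod.Sigma[OF _ ballI])
    show "finite {j. j \<in> {1..l i} \<and> Q (i, j)}" for i
      by (rule finite_subset[of _ "{1..l i}"]) auto
  qed simp
  ultimately show ?thesis by simp
qed

lemma prod_boxes_rows:
  "(\<Prod>s | s \<in> diagram n l \<and> Q (fst s). F (fst s) (snd s)) =
    (\<Prod>i | i \<in> {1..n} \<and> Q i. \<Prod>j = 1..l i. F i j)"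
proof -
  have "{s. s \<in> diagram n l \<and> Q (fst s)} = (SIGMA i:{i. i \<in> {1..n} \<and> Q i}. {1..l i})"
    by (auto simp: diagram_def)
  moreover have "(\<Prod>i | i \<in> {1..n} \<and> Q i. \<Prod>j = 1..l i. F i j) =
    (\<Prod>(i, j)\<in>(SIGMA i:{i. i \<in> {1..n} \<and> Q i}. {1..l i}). F i j)"
  proof (rule prod.Sigma)
    show "finite {i. i \<in> {1..n} \<and> Q i}" by (rule finite_subset[of _ "{1..n}"]) auto
  qed simp
  ultimately show ?thesis by (simp add: case_prod_beta)
qed

lemma A_factor_boxes:
  "A_factor n r l \<alpha> = (\<Prod>s | s \<in> diagram n l \<and> odd (n - coleg s).
    \<alpha> + of_nat (coarm s) + of_nat (n - coleg s - 1) * r)"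
proof -
  have "(\<Prod>s | s \<in> diagram n l \<and> odd (n - coleg s).
      \<alpha> + of_nat (coarm s) + of_nat (n - coleg s - 1) * r) =
    (\<Prod>i | i \<in> {1..n} \<and> odd (n - (i - 1)). \<Prod>j = 1..l i.
      \<alpha> + of_nat (j - 1) + of_nat (n - (i - 1) - 1) * r)"
    unfolding coleg_def coarm_def by (rule prod_boxes_rows)
  also have "\<dots> = A_factor n r l \<alpha>"
    unfolding A_factor_def pochhammer_row
    by (rule prod.cong) (auto simp: Suc_diff_le add_ac intro!: prod.cong)
  finally show ?thesis ..
qed

lemma boxes_even_rows:
  "(\<Prod>s | s \<in> diagram n l \<and> even (n - coleg s). of_nat (coarm s) + of_nat (n - coleg s) * r) =
    (\<Prod>i = 1..n. if odd (n - i) then pochhammer (of_nat (n - i + 1) * r) (l i) else 1)"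
proof -
  have "(\<Prod>s | s \<in> diagram n l \<and> even (n - coleg s).
      of_nat (coarm s) + of_nat (n - coleg s) * r) =
    (\<Prod>i | i \<in> {1..n} \<and> even (n - (i - 1)). \<Prod>j = 1..l i.
      of_nat (j - 1) + of_nat (n - (i - 1)) * r)"
    unfolding coleg_def coarm_def by (rule prod_boxes_rows)
  also have "\<dots> = (\<Prod>i | i \<in> {1..n} \<and> odd (n - i). pochhammer (of_nat (n - i + 1) * r) (l i))"
    unfolding pochhammer_row
    by (rule prod.cong) (auto simp: Suc_diff_le add_ac intro!: prod.cong)
  also have "\<dots> = (\<Prod>i = 1..n. if odd (n - i) then pochhammer (of_nat (n - i + 1) * r) (l i) else 1)"
    by (rule prod.mono_neutral_cong_left) auto
  finally show ?thesis .
qed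

lemma le_dual_iff:
  assumes l: "l \<in> Lambda n" and "1 \<le> j" "1 \<le> m"
  shows "m \<le> dual n l j \<longleftrightarrow> j \<le> l m"
proof
  assume "j \<le> l m"
  then have "m \<le> n" using l assms(2) by (auto simp: Lambda_def intro: ccontr)
  moreover have "j \<le> l i" if "i \<in> {1..m}" for i
    using Lambda_antimono[OF l, of i m] that \<open>j \<le> l m\<close> by auto
  ultimately have "{1..m} \<subseteq> {i \<in> {1..n}. j \<le> l i}" by auto
  from card_mono[OF _ this] show "m \<le> dual n l j" by (simp add: dual_def)
next
  assume m: "m \<le> dual n l j"
  show "j \<le> l m"
  proof (rule ccontr)
    assume "\<not> j \<le> l m"
    then have "\<not> j \<le> l i" if "m \<le> i" for i
      using Lambda_antimono[OF l assms(3) that] by simp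
    then have "i < m" if "j \<le> l i" for i using that by (meson not_le)
    then have "{i \<in> {1..n}. j \<le> l i} \<subseteq> {1..<m}" by auto
    from card_mono[OF _ this] have "dual n l j \<le> m - 1" by (simp add: dual_def)
    with m assms(3) show False by simp
  qed
qed

lemma leg_eq_iff:
  assumes l: "l \<in> Lambda n" and "1 \<le> i" "1 \<le> j" "j \<le> l i"
  shows "leg n l (i, j) = k \<longleftrightarrow> j \<le> l (i + k) \<and> l (i + k + 1) < j"
proof -
  have "i \<le> dual n l j" using le_dual_iff[OF l, of j i] assms by simp
  then have "leg n l (i, j) = k \<longleftrightarrow> i + k \<le> dual n l j \<and> \<not> i + k + 1 \<le> dual n l j"
    by (auto simp: leg_def)
  also have "\<dots> \<longleftrightarrow> j \<le> l (i + k) \<and> l (i + k + 1) < j"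
    using le_dual_iff[OF l assms(3)] assms(2) by (simp add: not_le)
  finally show ?thesis .
qed

lemma pochhammer_extend:
  assumes "b \<le> a" "a \<le> m"
  shows "pochhammer x (m - a) * (\<Prod>j\<in>{b<..a}. of_nat (m - j) + x) = pochhammer x (m - b)"
  using assms(1)
proof (induction b rule: inc_induct)
  case (step b)
  have "{b<..a} = insert (Suc b) {Suc b<..a}" using step.hyps by auto
  then have "pochhammer x (m - a) * (\<Prod>j\<in>{b<..a}. of_nat (m - j) + x) =
    (of_nat (m - Suc b) + x) *
      (pochhammer x (m - a) * (\<Prod>j\<in>{Suc b<..a}. of_nat (m - j) + x))"
    by (simp add: mult.left_commute)
  also have "\<dots> = pochhammer x (Suc (m - Suc b))"
    unfolding step.IH by (simp add: pochhammer_Suc add.commute mult.commute)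
  also have "Suc (m - Suc b) = m - b" using step.hyps assms by simp
  finally show ?case .
qed simp

text \<open>
  For the contribution of row \<open>i\<close>: the boxes of odd leg \<open>k\<close> lie in the columns between
  \<open>\<lambda>\<^bsub>i+k+1\<^esub>\<close> and \<open>\<lambda>\<^bsub>i+k\<^esub>\<close>, and their factors complete the rising factorial of length
  \<open>\<lambda>\<^sub>i - \<lambda>\<^bsub>i+k\<^esub>\<close> to that of length \<open>\<lambda>\<^sub>i - \<lambda>\<^bsub>i+k+1\<^esub>\<close>, which belongs to the even distance
  \<open>k + 1\<close>. If \<open>n - i\<close> is odd, the last of these refers to \<open>\<lambda>\<^bsub>n+1\<^esub> = 0\<close> and gives the factor of
  row \<open>i\<close> in the numerator of the box formula.
\<close>

lemma row_identity:
  fixes r :: "'k::field_char_0"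
  assumes l: "l \<in> Lambda n" and i: "i \<in> {1..n}"
  shows "(\<Prod>k | k \<in> {1..n - i} \<and> odd k. pochhammer (of_nat (k + 1) * r) (l i - l (i + k))) *
      (\<Prod>j | j \<in> {1..l i} \<and> odd (leg n l (i, j)).
        of_nat (arm l (i, j)) + of_nat (leg n l (i, j) + 1) * r) =
    (\<Prod>k | k \<in> {1..n - i} \<and> even k. pochhammer (of_nat k * r) (l i - l (i + k))) *
      (if odd (n - i) then pochhammer (of_nat (n - i + 1) * r) (l i) else 1)"
    (is "?num * ?D = ?den * ?N")
proof -
  let ?K = "{k. k \<in> {1..n - i} \<and> odd k}" and ?J = "{j. j \<in> {1..l i} \<and> odd (leg n l (i, j))}"
  let ?h = "\<lambda>j. of_nat (arm l (i, j)) + of_nat (leg n l (i, j) + 1) * r"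
  have i1: "1 \<le> i" using i by simp
  have leg_le: "leg n l (i, j) \<le> n - i" if "j \<in> {1..l i}" for j
  proof -
    have "j \<le> l (i + leg n l (i, j))"
      using leg_eq_iff[OF l i1, of j "leg n l (i, j)"] that by simp
    then have "i + leg n l (i, j) \<le> n" using l that by (auto simp: Lambda_def intro: ccontr)
    then show ?thesis by simp
  qed
  have "?D = (\<Prod>k\<in>?K. \<Prod>j | j \<in> ?J \<and> leg n l (i, j) = k. ?h j)"
  proof (rule prod.group[symmetric])
    show "(\<lambda>j. leg n l (i, j)) ` ?J \<subseteq> ?K"
      using leg_le by (auto intro: Suc_leI odd_pos)
  qed auto
  also have "\<dots> = (\<Prod>k\<in>?K. \<Prod>j\<in>{l (i + k + 1)<..l (i + k)}. of_nat (l i - j) + of_nat (k + 1) * r)"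
  proof (rule prod.cong)
    fix k assume k: "k \<in> ?K"
    have "l (i + k) \<le> l i" using i1 by (intro Lambda_antimono[OF l]) auto
    have boxes: "{j. j \<in> ?J \<and> leg n l (i, j) = k} = {l (i + k + 1)<..l (i + k)}"
    proof (rule set_eqI)
      fix j
      show "j \<in> {j. j \<in> ?J \<and> leg n l (i, j) = k} \<longleftrightarrow> j \<in> {l (i + k + 1)<..l (i + k)}"
      proof (cases "j \<in> {1..l i}")
        case True
        then show ?thesis using leg_eq_iff[OF l i1, of j k] k by auto
      next
        case False
        then show ?thesis using \<open>l (i + k) \<le> l i\<close> by auto
      qed
    qed
    show "(\<Prod>j | j \<in> ?J \<and> leg n l (i, j) = k. ?h j) =
      (\<Prod>j\<in>{l (i + k + 1)<..l (i + k)}. of_nat (l i - j) + of_nat (k + 1) * r)"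
    proof (rule prod.cong[OF boxes])
      fix j assume "j \<in> {l (i + k + 1)<..l (i + k)}"
      then have "leg n l (i, j) = k" unfolding boxes[symmetric] by simp
      then show "?h j = of_nat (l i - j) + of_nat (k + 1) * r" by (simp add: arm_def)
    qed
  qed simp
  finally have "?num * ?D = (\<Prod>k\<in>?K. pochhammer (of_nat (k + 1) * r) (l i - l (i + k)) *
    (\<Prod>j\<in>{l (i + k + 1)<..l (i + k)}. of_nat (l i - j) + of_nat (k + 1) * r))"
    by (simp only: prod.distrib)
  also have "\<dots> = (\<Prod>k\<in>?K. pochhammer (of_nat (k + 1) * r) (l i - l (i + (k + 1))))"
  proof (rule prod.cong)
    fix k
    have "l (i + k + 1) \<le> l (i + k)" "l (i + k) \<le> l i"
      using i1 by (auto intro!: Lambda_antimono[OF l])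
    from pochhammer_extend[OF this, of "of_nat (k + 1) * r"]
    show "pochhammer (of_nat (k + 1) * r) (l i - l (i + k)) *
      (\<Prod>j\<in>{l (i + k + 1)<..l (i + k)}. of_nat (l i - j) + of_nat (k + 1) * r) =
      pochhammer (of_nat (k + 1) * r) (l i - l (i + (k + 1)))"
      by (simp only: add.assoc)
  qed simp
  also have "\<dots> = (\<Prod>k | k \<in> {1..n - i + 1} \<and> even k. pochhammer (of_nat k * r) (l i - l (i + k)))"
  proof (rule prod.reindex_bij_witness[where j = "\<lambda>k. k + 1" and i = "\<lambda>k. k - 1"])
    fix k assume k: "k \<in> {k. k \<in> {1..n - i + 1} \<and> even k}"
    obtain m where m: "k = Suc m" using k by (cases k) simp_all
    have "m \<noteq> 0" using k by (intro notI) (simp add: m)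
    then show "k - 1 + 1 = k" "k - 1 \<in> ?K" using k by (simp_all add: m)
  qed auto
  also have "\<dots> = ?den * ?N"
  proof (cases "odd (n - i)")
    case True
    have "{k. k \<in> {1..n - i + 1} \<and> even k} = insert (n - i + 1) {k. k \<in> {1..n - i} \<and> even k}"
      using True by (auto simp: le_Suc_eq)
    moreover have "l (i + (n - i + 1)) = 0" using l i by (auto simp: Lambda_def)
    ultimately show ?thesis using True by (simp add: mult.commute)
  next
    case False
    then have "{k. k \<in> {1..n - i + 1} \<and> even k} = {k. k \<in> {1..n - i} \<and> even k}"
      by (auto simp: le_Suc_eq)
    with False show ?thesis by simp
  qed
  finally show ?thesis .
qed

lemma prod_pairs_rows:
  fixes F :: "nat \<Rightarrow> nat \<Rightarrow> 'k::comm_monoid_mult"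
  shows "(\<Prod>(i, j) | 1 \<le> i \<and> i < j \<and> j \<le> n \<and> Q (j - i). F i j) =
    (\<Prod>i = 1..n. \<Prod>k | k \<in> {1..n - i} \<and> Q k. F i (i + k))"
proof -
  have "(\<Prod>i = 1..n. \<Prod>k | k \<in> {1..n - i} \<and> Q k. F i (i + k)) =
    (\<Prod>(i, k)\<in>(SIGMA i:{1..n}. {k. k \<in> {1..n - i} \<and> Q k}). F i (i + k))"
  proof (rule prod.Sigma[OF _ ballI])
    show "finite {k. k \<in> {1..n - i} \<and> Q k}" for i
      by (rule finite_subset[of _ "{1..n - i}"]) auto
  qed simp
  also have "\<dots> = (\<Prod>(i, j) | 1 \<le> i \<and> i < j \<and> j \<le> n \<and> Q (j - i). F i j)"
    by (rule prod.reindex_bij_witness[where j = "\<lambda>(i, k). (i, i + k)" and i = "\<lambda>(i, j). (i, j - i)"])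
      auto
  finally show ?thesis ..
qed

lemma B_factor_boxes:
  fixes r :: "'k::field_char_0"
  assumes r: "not_neg_rat r" "r \<noteq> 0" and l: "l \<in> Lambda n"
  shows "B_factor n r l =
    (\<Prod>s | s \<in> diagram n l \<and> even (n - coleg s). of_nat (coarm s) + of_nat (n - coleg s) * r) /
    (\<Prod>s | s \<in> diagram n l \<and> odd (leg n l s). of_nat (arm l s) + of_nat (leg n l s + 1) * r)"
    (is "_ = ?N / ?D")
proof -
  let ?num = "\<Prod>i = 1..n. \<Prod>k | k \<in> {1..n - i} \<and> odd k.
    pochhammer (of_nat (k + 1) * r) (l i - l (i + k))"
  let ?den = "\<Prod>i = 1..n. \<Prod>k | k \<in> {1..n - i} \<and> even k.
    pochhammer (of_nat k * r) (l i - l (i + k))"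
  have B: "B_factor n r l = ?num / ?den"
    unfolding B_factor_def prod_pairs_rows[where Q = odd] prod_pairs_rows[where Q = even] by simp
  have "?num * ?D = ?den * ?N"
    unfolding boxes_even_rows prod_boxes prod.distrib[symmetric]
    by (rule prod.cong[OF refl row_identity[OF l]])
  moreover have "pochhammer (of_nat k * r) m \<noteq> 0" if "1 \<le> k" for k m
    using not_neg_rat_nonzero[OF r, of k] that by (metis pochhammer_eq_0_iff add.left_inverse
        less_eq_Suc_le One_nat_def)
  then have "?den \<noteq> 0" by simp
  moreover have "of_nat (arm l s) + of_nat (leg n l s + 1) * r \<noteq> 0" for s
    using not_neg_rat_nonzero[OF r, of "leg n l s + 1" "arm l s"] by (simp add: add.commute)
  then have "?D \<noteq> 0"
    by (metis (mono_tags, lifting) prod.infinite prod_zero_iff one_neq_zero)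
  ultimately show ?thesis unfolding B by (simp add: frac_eq_eq mult.commute)
qed

lemma not_neg_ratI:
  fixes r :: "'k::field_char_0"
  assumes "\<forall>q::rat. q < 0 \<longrightarrow> r \<noteq> of_rat q"
  shows "not_neg_rat r"
  unfolding not_neg_rat_def
proof (intro allI impI notI)
  fix a b :: nat
  assume b: "0 < b" and eq: "of_nat a * r + of_nat b = 0"
  have a: "a \<noteq> 0" using eq b by (intro notI) simp
  have "r = - (of_nat b / of_nat a)" using eq a by (simp add: field_simps eq_neg_iff_add_eq_0)
  also have "\<dots> = of_rat (- (of_nat b / of_nat a))"
    by (simp add: of_rat_minus of_rat_divide)
  finally show False using assms a b by (metis divide_pos_pos neg_less_0_iff_less of_nat_0_less_iff gr0I)
qed

theorem theorem8p2:
  fixes r \<alpha> :: "'k::field_char_0"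
    and n :: nat
    and l :: "nat \<Rightarrow> nat"
  assumes "n \<ge> 1"
    and "\<forall>q::rat. q < 0 \<longrightarrow> r \<noteq> of_rat q"
    and "r \<noteq> 0"
    and "l \<in> Lambda n"
  shows "eval_poly (semisym_R n r l) (\<lambda>i. - rho_shift n r \<alpha> i) =
           (-1) ^ odd_size n l * A_factor n r l \<alpha> * B_factor n r l
    \<and> A_factor n r l \<alpha> =
         (\<Prod>s | s \<in> diagram n l \<and> odd (n - coleg s).
            \<alpha> + of_nat (coarm s) + of_nat (n - coleg s - 1) * r)
    \<and> B_factor n r l =
         (\<Prod>s | s \<in> diagram n l \<and> even (n - coleg s).
            of_nat (coarm s) + of_nat (n - coleg s) * r) /
         (\<Prod>s | s \<in> diagram n l \<and> odd (leg n l s).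
            of_nat (arm l s) + of_nat (leg n l s + 1) * r)"
proof -
  have r: "not_neg_rat r" "r \<noteq> 0" using not_neg_ratI assms by auto
  show ?thesis
    using is_interp_value[OF r assms(4) semisym_R_properties(1)[OF r(1) assms(4)], of \<alpha>]
      semisym_R_properties(2)[OF r(1) assms(4)] A_factor_boxes B_factor_boxes[OF r assms(4)]
    by simp
qed

end
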